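(* For any integers $k\geq 2$ and $n\geq \max\{2,5-k\}$, with $N:=(k-1)n+2$, a Hamilton path in $\mathcal{G}_{N,k+1}$ can be computed in time $\mathcal{O}(k)$ on average per node.
   Context: A dissection of a convex $N$-gon into $(k+1)$-gons is a subdivision by non-crossing diagonals into $n$ polygons each with $k+1$ vertices (possible exactly when $N=(k-1)n+2$). A flip removes a diagonal shared by two $(k+1)$-gons and replaces it by one of the other $k-1$ diagonals of the resulting $2k$-gon that split it into two $(k+1)$-gons. $\mathcal{G}_{N,k+1}$ is the graph whose nodes are all dissections of the convex $N$-gon into $(k+1)$-gons, with an edge between two dissections differing in a flip (equivalently, the rotation graph of $k$-ary trees with $n$ vertices). *)

theory Defs
  imports Complex_Main "Graph_Theory.Graph_Theory"
begin

section \<open>Dissections of convex polygons\<close>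

text \<open>
  The points \<open>0, \<dots>, N - 1\<close> are in convex position in this cyclic order, so a convex polygon
  spanned by some of them is given by its finite vertex set \<open>V\<close>. A segment is the set of its two
  end points. In the definition of \<open>sides\<close> the second disjunct is the side joining the least and
  the greatest vertex.
\<close>

definition segments :: "nat set \<Rightarrow> nat set set" where
  "segments V = {{a, b} | a b. a \<in> V \<and> b \<in> V \<and> a < b}"

definition sides :: "nat set \<Rightarrow> nat set set" where
  "sides V = {{a, b} | a b. a \<in> V \<and> b \<in> V \<and> a < b \<and>
                (V \<inter> {a<..<b} = {} \<or> V \<subseteq> {a..b})}"

definition diagonals :: "nat set \<Rightarrow> nat set set" where
  "diagonals V = segments V - sides V"

definition crossing :: "nat set \<Rightarrow> nat set \<Rightarrow> bool" where
  "crossing d e \<longleftrightarrow> (\<exists>a b x y. a < x \<and> x < b \<and> b < y \<and>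
     (d = {a, b} \<and> e = {x, y} \<or> d = {x, y} \<and> e = {a, b}))"

text \<open>
  The polygons into which non-crossing diagonals \<open>D\<close> subdivide the polygon \<open>V\<close>: they are bounded
  by sides of \<open>V\<close> and members of \<open>D\<close>, and no member of \<open>D\<close> passes through their interior.
\<close>

definition cells :: "nat set \<Rightarrow> nat set set \<Rightarrow> nat set set" where
  "cells V D = {F. F \<subseteq> V \<and> 3 \<le> card F \<and> sides F \<subseteq> sides V \<union> D \<and> diagonals F \<inter> D = {}}"

definition dissections :: "nat set \<Rightarrow> nat \<Rightarrow> nat set set set" where
  "dissections V m = {D. D \<subseteq> diagonals V \<and> (\<forall>d\<in>D. \<forall>e\<in>D. \<not> crossing d e) \<and>
                         (\<forall>F\<in>cells V D. card F = m)}"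

definition flip :: "nat set \<Rightarrow> nat \<Rightarrow> nat set set \<Rightarrow> nat set set \<Rightarrow> bool" where
  "flip V m D D' \<longleftrightarrow>
     (\<exists>F\<in>cells V D. \<exists>F'\<in>cells V D. \<exists>d\<in>D. \<exists>d'\<in>diagonals (F \<union> F').
        F \<noteq> F' \<and> d \<in> sides F \<and> d \<in> sides F' \<and>
        d' \<noteq> d \<and> {d'} \<in> dissections (F \<union> F') m \<and>
        D' = insert d' (D - {d}))"

text \<open>The undirected graph is represented by its symmetric arc relation.\<close>

definition flip_graph :: "nat \<Rightarrow> nat \<Rightarrow> nat set set pair_pre_digraph" where
  "flip_graph N m =
     \<lparr>pverts = dissections {..<N} m,
      parcs = {(D, D'). D \<in> dissections {..<N} m \<and> D' \<in> dissections {..<N} m \<and>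
                        flip {..<N} m D D'}\<rparr>"

definition hamilton_path :: "'a list \<Rightarrow> ('a, 'b) pre_digraph \<Rightarrow> bool" where
  "hamilton_path p G \<longleftrightarrow> vpath p G \<and> set p = verts G"


section \<open>Random access machines with unit cost\<close>

text \<open>
  A random access machine with addition and (truncated) subtraction as its only arithmetic
  operations, where every instruction takes one time step. The memory cells also serve as
  registers. The machine stops when the program counter leaves the program.

  An algorithm that lists combinatorial objects keeps the current object in memory, modifies it,
  and visits each object when it is complete. \<open>Visit a\<close> signals such a visit, where the object
  is stored in the memory block whose base address is held in cell \<open>a\<close>.
\<close>

datatype instr =
    Const nat nat
  | Add nat nat nat
  | Sub nat nat nat
  | Load nat nat
  | Store nat nat
  | JumpZero nat nat
  | Visit nat

record config =
  pc :: nat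
  mem :: "nat \<Rightarrow> nat"
  visited :: "(nat \<Rightarrow> nat) list"

fun exec :: "instr \<Rightarrow> config \<Rightarrow> config" where
  "exec (Const a x) c = c\<lparr>pc := pc c + 1, mem := (mem c)(a := x)\<rparr>"
| "exec (Add a b b') c = c\<lparr>pc := pc c + 1, mem := (mem c)(a := mem c b + mem c b')\<rparr>"
| "exec (Sub a b b') c = c\<lparr>pc := pc c + 1, mem := (mem c)(a := mem c b - mem c b')\<rparr>"
| "exec (Load a b) c = c\<lparr>pc := pc c + 1, mem := (mem c)(a := mem c (mem c b))\<rparr>"
| "exec (Store a b) c = c\<lparr>pc := pc c + 1, mem := (mem c)(mem c a := mem c b)\<rparr>"
| "exec (JumpZero a l) c = c\<lparr>pc := if mem c a = 0 then l else pc c + 1\<rparr>"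
| "exec (Visit a) c = c\<lparr>pc := pc c + 1, visited := visited c @ [\<lambda>i. mem c (mem c a + i)]\<rparr>"

definition halted :: "instr list \<Rightarrow> config \<Rightarrow> bool" where
  "halted P c \<longleftrightarrow> length P \<le> pc c"

definition step :: "instr list \<Rightarrow> config \<Rightarrow> config" where
  "step P c = (if halted P c then c else exec (P ! pc c) c)"

definition initial :: "nat \<Rightarrow> nat \<Rightarrow> config" where
  "initial x y = \<lparr>pc = 0, mem = (\<lambda>_. 0)(0 := x, 1 := y), visited = []\<rparr>"

definition lists_within :: "instr list \<Rightarrow> nat \<Rightarrow> nat \<Rightarrow> nat \<Rightarrow> (nat \<Rightarrow> nat) list \<Rightarrow> bool" where
  "lists_within P x y t bs \<longleftrightarrow>
     (let c = (step P ^^ t) (initial x y) in halted P c \<and> visited c = bs)"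

text \<open>
  A dissection into \<open>n\<close> polygons is stored as the array of the end points of its \<open>n - 1\<close>
  diagonals, in any order.
\<close>

definition stored_dissection :: "nat \<Rightarrow> (nat \<Rightarrow> nat) \<Rightarrow> nat set set" where
  "stored_dissection n b = {{b (2 * i), b (2 * i + 1)} | i. i < n - 1}"

end

theory Submission
  imports Defs
begin

text \<open>
  Put \<open>q = k - 1\<close> and \<open>z\<^sub>l = q l + 1\<close>, and let \<open>l\<close> cells dissect the polygon on \<open>0, \<dots>, z\<^sub>l\<close>. Splitting
  the last vertex \<open>z\<^sub>l\<close> into \<open>z\<^sub>l, \<dots>, z\<^sub>l + q\<close> with one new cell between the copies yields the
  dissections into \<open>l + 1\<close> cells, each exactly once; so the dissections are the nodes of a tree,
  whose level \<open>l\<close> consists of those with \<open>l\<close> cells. If \<open>r\<close> cells meet at \<open>z\<^sub>l\<close>, then its children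
  correspond to the nonincreasing sequences of length \<open>q\<close> with entries in \<open>{0..r}\<close>: if \<open>w\<^sub>0 < w\<^sub>1 < \<dots>\<close>
  are the vertices that share a cell with \<open>z\<^sub>l\<close>, then the segment from \<open>w\<close> with index \<open>q i\<close> to \<open>z\<^sub>l\<close>
  turns into the \<^emph>\<open>strut\<close> from \<open>w\<close> with index \<open>q i + d\<close> to \<open>z\<^sub>l + d\<close>, where \<open>d\<close> is the number of entries
  above \<open>i\<close>. The steps of a suitable reflected Gray code for these sequences move a single strut,
  which is a flip. The first and the last sequence, all \<open>0\<close> or all \<open>r\<close>, cut off an ear and
  otherwise keep or relabel the dissection; hence they turn flips of parents into flips of children.
  Listing the children of consecutive nodes alternately forwards and backwards therefore extends a
  Hamilton path from one level to the next.

  A dissection into \<open>n\<close> cells is the same as a set of \<open>n - 1\<close> noncrossing diagonals \<open>{a, b}\<close> such that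
  \<open>q\<close> divides \<open>b - a - 1\<close>; therefore two dissections that differ in one diagonal differ in a flip.

  The machine traverses the tree depth first. Descending from a node costs \<open>O(q r)\<close>, where \<open>r\<close> is
  the number of its fan cells, and moving on to the next sibling costs \<open>O(q)\<close>. As the node has more
  than \<open>r\<close> children, and at least two, the total cost is \<open>O(q)\<close> times the number of leaves.
\<close>

section \<open>Splitting a polygon along a diagonal\<close>

text \<open>The direction bit belongs to a level, not to a node: once the children of a node have
  been listed, the bit of their level is reversed, and the next node of the parent level, wherever
  it is in the tree, reads the reversed bit. The last leaf below one node and the first leaf below
  the next thus arise from their ancestors by the same sequence of ears, so an exchange between the
  ancestors becomes one between the leaves. This forces the Gray code to run from one constant
  sequence to the other for all \<open>r\<close> and \<open>q\<close>, which an order by last entry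
  with alternating directions achieves. Cells are awkward to handle, counting is not: after the
  equivalence of dissections with maximal sets of admissible diagonals, proved by cutting along a
  single diagonal, only cardinalities decide whether a set is a dissection. The running time is paid
  by the leaves. Each leaf is worth \<open>2 * cost\<close>, and every subtree has at least
  \<open>cost\<close> left over; a node with \<open>c\<close> children receives
  \<open>c * cost\<close>, spends at most half of it and can pass on \<open>cost\<close> because
  \<open>c \<ge> 2\<close>.\<close>

lemma doubleton_less_eq_iff:
  fixes a b x y :: nat
  assumes "a < b" "x < y"
  shows "{a, b} = {x, y} \<longleftrightarrow> a = x \<and> b = y"
  using assms by (auto simp: doubleton_eq_iff)

lemma crossing_iff:
  assumes "a < b" "x < y"
  shows "crossing {a, b} {x, y} \<longleftrightarrow> a < x \<and> x < b \<and> b < y \<or> x < a \<and> a < y \<and> y < b"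
proof
  assume "crossing {a, b} {x, y}"
  then obtain a' b' x' y' where *: "a' < x'" "x' < b'" "b' < y'"
    and **: "{a, b} = {a', b'} \<and> {x, y} = {x', y'} \<or> {a, b} = {x', y'} \<and> {x, y} = {a', b'}"
    unfolding crossing_def by blast
  have "a' < b'" "x' < y'" using * by auto
  with ** assms have "a = a' \<and> b = b' \<and> x = x' \<and> y = y' \<or> a = x' \<and> b = y' \<and> x = a' \<and> y = b'"
    by (metis doubleton_less_eq_iff)
  with * show "a < x \<and> x < b \<and> b < y \<or> x < a \<and> a < y \<and> y < b" by auto
next
  assume "a < x \<and> x < b \<and> b < y \<or> x < a \<and> a < y \<and> y < b"
  then show "crossing {a, b} {x, y}" unfolding crossing_def by blast
qed

lemma crossing_commute: "crossing d e \<longleftrightarrow> crossing e d"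
  unfolding crossing_def by blast

lemma segmentsE:
  assumes "d \<in> segments V"
  obtains a b where "a < b" "d = {a, b}" "a \<in> V" "b \<in> V"
  using assms unfolding segments_def by blast

lemma segments_iff: "a < b \<Longrightarrow> {a, b} \<in> segments V \<longleftrightarrow> a \<in> V \<and> b \<in> V"
  unfolding segments_def using doubleton_less_eq_iff by auto

lemma sides_iff:
  assumes "a < b"
  shows "{a, b} \<in> sides V \<longleftrightarrow> a \<in> V \<and> b \<in> V \<and> (V \<inter> {a<..<b} = {} \<or> V \<subseteq> {a..b})"
proof
  assume "{a, b} \<in> sides V"
  then obtain x y where "{a, b} = {x, y}" "x < y" "x \<in> V \<and> y \<in> V \<and> (V \<inter> {x<..<y} = {} \<or> V \<subseteq> {x..y})"
    unfolding sides_def by blast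
  then show "a \<in> V \<and> b \<in> V \<and> (V \<inter> {a<..<b} = {} \<or> V \<subseteq> {a..b})"
    using doubleton_less_eq_iff[OF assms] by metis
qed (use assms in \<open>unfold sides_def, blast\<close>)

lemma sides_subset_segments: "sides V \<subseteq> segments V"
  unfolding sides_def segments_def by blast

lemma diagonals_iff:
  assumes "a < b"
  shows "{a, b} \<in> diagonals V \<longleftrightarrow>
    a \<in> V \<and> b \<in> V \<and> V \<inter> {a<..<b} \<noteq> {} \<and> \<not> V \<subseteq> {a..b}"
  unfolding diagonals_def using assms by (auto simp: segments_iff sides_iff)

lemma diagonals_subset_segments: "diagonals V \<subseteq> segments V"
  unfolding diagonals_def by blast

lemma segments_mono: "F \<subseteq> V \<Longrightarrow> segments F \<subseteq> segments V"
  unfolding segments_def by blast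

lemma sides_restrict:
  assumes "F \<subseteq> V" "d \<in> sides V" "d \<in> segments F"
  shows "d \<in> sides F"
proof -
  obtain a b where "a < b" "d = {a, b}" "a \<in> F" "b \<in> F" using assms(3) by (rule segmentsE)
  with assms show ?thesis by (auto simp: sides_iff)
qed

lemma diagonals_mono: "F \<subseteq> V \<Longrightarrow> diagonals F \<subseteq> diagonals V"
  using segments_mono[of F V] sides_restrict[of F V] unfolding diagonals_def by blast

lemma sides_not_crossing:
  assumes "d \<in> segments V" "e \<in> sides V"
  shows "\<not> crossing d e"
proof -
  obtain a b where d: "a < b" "d = {a, b}" "a \<in> V" "b \<in> V" using assms(1) by (rule segmentsE)
  obtain x y where e: "x < y" "e = {x, y}" "x \<in> V" "y \<in> V"
    using assms(2) sides_subset_segments by (blast elim: segmentsE)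
  have "V \<inter> {x<..<y} = {} \<or> V \<subseteq> {x..y}" using assms(2) e by (auto simp: sides_iff)
  then show ?thesis using d e by (auto simp: crossing_iff)
qed

text \<open>The side that separates a missing vertex \<open>v\<close> from the rest of
  \<open>F\<close>: the gap of \<open>F\<close> around \<open>v\<close>, or the side from the least
  to the greatest vertex if \<open>v\<close> lies outside their range.\<close>

lemma side_around:
  assumes "finite F" "2 \<le> card F" "v \<notin> F"
  obtains x y where "x < y" "{x, y} \<in> sides F"
    "x < v \<and> v < y \<and> F \<inter> {x<..<y} = {} \<or> F \<subseteq> {x..y} \<and> (v < x \<or> y < v)"
proof (cases "(\<exists>x\<in>F. x < v) \<and> (\<exists>y\<in>F. v < y)")
  case True
  define x where "x = Max {x \<in> F. x < v}"
  define y where "y = Min {y \<in> F. v < y}"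
  have x: "x \<in> {x \<in> F. x < v}" unfolding x_def using True assms(1) by (intro Max_in) auto
  have y: "y \<in> {y \<in> F. v < y}" unfolding y_def using True assms(1) by (intro Min_in) auto
  have "\<And>u. u \<in> F \<Longrightarrow> u < v \<Longrightarrow> u \<le> x" unfolding x_def using assms(1) by (intro Max_ge) auto
  moreover have "\<And>u. u \<in> F \<Longrightarrow> v < u \<Longrightarrow> y \<le> u" unfolding y_def using assms(1) by (intro Min_le) auto
  ultimately have e: "F \<inter> {x<..<y} = {}" using assms(3) by (force simp: not_less dest: le_neq_implies_less)
  have "x < y" using x y by auto
  with e x y show ?thesis by (intro that[of x y]) (auto simp: sides_iff)
next
  case False
  define x where "x = Min F"
  define y where "y = Max F"
  have "F \<noteq> {}" using assms(2) by auto
  then have x: "x \<in> F" and y: "y \<in> F" unfolding x_def y_def using assms(1) by auto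
  have sub: "F \<subseteq> {x..y}" unfolding x_def y_def using assms(1) by auto
  have "x \<noteq> y"
  proof
    assume "x = y"
    with sub have "F \<subseteq> {x}" by auto
    then have "card F \<le> 1" using card_mono[of "{x}" F] by simp
    with assms(2) show False by simp
  qed
  then have "x < y" using sub x by fastforce
  moreover have "v < x \<or> y < v" using False x y assms(3) by (metis linorder_neqE_nat)
  ultimately show ?thesis using sub x y by (intro that[of x y]) (auto simp: sides_iff)
qed

section \<open>The two halves of a polygon cut along a diagonal\<close>

locale split_polygon =
  fixes V :: "nat set" and D :: "nat set set" and a b :: nat
  assumes finite_V: "finite V" and D_diag: "D \<subseteq> diagonals V"
    and noncrossing: "\<forall>d\<in>D. \<forall>e\<in>D. \<not> crossing d e"
    and ab: "a < b" and in_D: "{a, b} \<in> D"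
begin

abbreviation "V1 \<equiv> V \<inter> {a..b}"
abbreviation "V2 \<equiv> V - {a<..<b}"
abbreviation "D1 \<equiv> D \<inter> diagonals V1"
abbreviation "D2 \<equiv> D \<inter> diagonals V2"

lemma ab_diagonal: "a \<in> V" "b \<in> V" "V \<inter> {a<..<b} \<noteq> {}" "\<not> V \<subseteq> {a..b}"
  using D_diag in_D ab diagonals_iff[OF ab] by blast+

lemma ab_side1: "{a, b} \<in> sides V1" and ab_side2: "{a, b} \<in> sides V2"
  using ab ab_diagonal by (auto simp: sides_iff)

lemma sides_V1: "sides V1 \<subseteq> insert {a, b} (sides V)"
proof
  fix e assume e: "e \<in> sides V1"
  then obtain x y where xy: "x < y" "e = {x, y}" "x \<in> V1" "y \<in> V1"
    using sides_subset_segments by (blast elim: segmentsE)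
  then consider "V1 \<inter> {x<..<y} = {}" | "V1 \<subseteq> {x..y}" using e by (auto simp: sides_iff)
  then show "e \<in> insert {a, b} (sides V)"
  proof cases
    case 1
    moreover have "V \<inter> {x<..<y} \<subseteq> V1 \<inter> {x<..<y}" using xy by auto
    ultimately have "V \<inter> {x<..<y} = {}" by simp
    then show ?thesis using xy by (auto simp: sides_iff)
  next
    case 2
    moreover have "a \<in> V1" "b \<in> V1" using ab ab_diagonal by auto
    ultimately have "a \<in> {x..y}" "b \<in> {x..y}" by blast+
    then have "x = a" "y = b" using xy by auto
    then show ?thesis using xy by auto
  qed
qed

lemma sides_V2: "sides V2 \<subseteq> insert {a, b} (sides V)"
proof
  fix e assume e: "e \<in> sides V2"
  then obtain x y where xy: "x < y" "e = {x, y}" "x \<in> V2" "y \<in> V2"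
    using sides_subset_segments by (blast elim: segmentsE)
  then consider "V2 \<inter> {x<..<y} = {}" | "V2 \<subseteq> {x..y}" using e by (auto simp: sides_iff)
  then show "e \<in> insert {a, b} (sides V)"
  proof cases
    case 1
    \<comment> \<open>As \<open>a\<close> and \<open>b\<close> lie in \<open>V2\<close>, a gap of
      \<open>V2\<close> other than the cut itself lies to the left of \<open>a\<close> or to the
      right of \<open>b\<close>, where \<open>V\<close> and \<open>V2\<close> agree.\<close>
    have "V \<inter> {x<..<y} = {} \<or> (x = a \<and> y = b)"
    proof (rule disjCI)
      assume "\<not> (x = a \<and> y = b)"
      moreover have "a \<in> V2" "b \<in> V2" using ab_diagonal by auto
      moreover have "c \<le> x \<or> y \<le> c" if "c \<in> V2" for c using 1 that by auto
      moreover have "x \<le> a \<or> b \<le> x" "y \<le> a \<or> b \<le> y" using xy by auto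
      ultimately have "y \<le> a \<or> b \<le> x" using xy(1) ab by (metis le_antisym le_trans less_imp_le_nat not_le)
      then have "V \<inter> {x<..<y} \<subseteq> V2 \<inter> {x<..<y}" by auto
      then show "V \<inter> {x<..<y} = {}" using 1 by simp
    qed
    then show ?thesis using xy by (auto simp: sides_iff)
  next
    case 2
    moreover have "a \<in> V2" "b \<in> V2" using ab_diagonal by auto
    ultimately have "x \<le> a" "b \<le> y" by auto
    then have "V \<subseteq> V2 \<union> {x..y}" by auto
    then have "V \<subseteq> {x..y}" using 2 by blast
    then show ?thesis using xy by (auto simp: sides_iff)
  qed
qed

text \<open>A segment that does not cross \<open>{a, b}\<close> has both ends in one of the halves.
  Not being a side of \<open>V\<close>, it is a diagonal of that half unless it is the cut, the only
  new side.\<close>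

lemma D_subset: "D \<subseteq> insert {a, b} (D1 \<union> D2)"
proof
  fix e assume e: "e \<in> D"
  then have "e \<in> segments V" using D_diag diagonals_subset_segments by blast
  then obtain x y where xy: "x < y" "e = {x, y}" "x \<in> V" "y \<in> V" by (rule segmentsE)
  have "\<not> crossing {a, b} {x, y}" using noncrossing in_D e xy by blast
  then have "e \<in> segments V1 \<or> e \<in> segments V2"
    using xy ab unfolding crossing_iff[OF ab \<open>x < y\<close>] by (auto simp: segments_iff)
  moreover have "e \<notin> sides V" using e D_diag unfolding diagonals_def by blast
  ultimately show "e \<in> insert {a, b} (D1 \<union> D2)"
    using e sides_V1 sides_V2 unfolding diagonals_def by blast
qed

lemma D_eq: "D = insert {a, b} (D1 \<union> D2)"
  using D_subset in_D by blast

lemma D1_D2_disjoint: "D1 \<inter> D2 = {}"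
proof -
  have "e \<in> sides V1" if e: "e \<in> diagonals V1" "e \<in> diagonals V2" for e
  proof -
    obtain x y where xy: "x < y" "e = {x, y}" "x \<in> V1" "y \<in> V1"
      using e diagonals_subset_segments by (blast elim: segmentsE)
    then have "x \<in> V2" "y \<in> V2" using e diagonals_iff by blast+
    then have "x = a" "y = b" using xy by auto
    then show ?thesis using ab_side1 xy by simp
  qed
  then show ?thesis unfolding diagonals_def by blast
qed

lemma ab_notin: "{a, b} \<notin> D1" "{a, b} \<notin> D2"
  using ab_side1 ab_side2 unfolding diagonals_def by blast+

lemma finite_diagonals_V: "finite D"
proof -
  have "segments V \<subseteq> Pow V" unfolding segments_def by auto
  then show ?thesis
    using finite_V D_diag diagonals_subset_segments[of V] by (meson finite_Pow_iff finite_subset)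
qed

lemma card_D: "card D = card D1 + card D2 + 1"
proof -
  have "card D = card (insert {a, b} (D1 \<union> D2))" using D_eq by simp
  also have "\<dots> = Suc (card (D1 \<union> D2))" using ab_notin finite_diagonals_V by (intro card_insert_disjoint) auto
  also have "card (D1 \<union> D2) = card D1 + card D2"
    using D1_D2_disjoint finite_diagonals_V by (intro card_Un_disjoint) auto
  finally show ?thesis by simp
qed

lemma V1_Un_V2: "V1 \<union> V2 = V"
  by auto

lemma V1_neq_V2: "V1 \<noteq> V2"
proof -
  obtain c where "c \<in> V" "c \<in> {a<..<b}" using ab_diagonal(3) by blast
  then have "c \<in> V1" "c \<notin> V2" by auto
  then show ?thesis by blast
qed

lemma V1_eq: "V1 = insert a (insert b (V \<inter> {a<..<b}))"
  using ab ab_diagonal by (auto intro: order.strict_implies_order)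

lemma card_V1: "card V1 = card (V \<inter> {a<..<b}) + 2"
  unfolding V1_eq using ab finite_V by simp

lemma card_V: "card V + 2 = card V1 + card V2"
proof -
  have "card V = card (V2 \<union> V \<inter> {a<..<b})" by (rule arg_cong[where f=card]) auto
  also have "\<dots> = card V2 + card (V \<inter> {a<..<b})" using finite_V by (intro card_Un_disjoint) auto
  finally show ?thesis using card_V1 by simp
qed

lemma card_V1_ge: "3 \<le> card V1"
proof -
  have "0 < card (V \<inter> {a<..<b})" using ab_diagonal finite_V by (simp add: card_gt_0_iff)
  then show ?thesis using card_V1 by linarith
qed

lemma card_V2_ge: "3 \<le> card V2"
proof -
  obtain c where "c \<in> V" "c \<notin> {a..b}" using ab_diagonal by blast
  then have "{a, b, c} \<subseteq> V2" "card {a, b, c} = 3" using ab ab_diagonal by auto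
  then show ?thesis using card_mono[of V2 "{a, b, c}"] finite_V by simp
qed

text \<open>A cell with vertices \<open>p\<close> and \<open>u\<close> on both sides of the cut must
  contain \<open>a\<close> and \<open>b\<close>: the side of the cell that passes around a missing
  end would cross \<open>{a, b}\<close>. But then \<open>{a, b}\<close> is a diagonal of the cell,
  contrary to the definition of cells.\<close>

lemma cell_cases:
  assumes "F \<in> cells V D"
  shows "F \<subseteq> V1 \<or> F \<subseteq> V2"
proof (rule ccontr)
  assume "\<not> (F \<subseteq> V1 \<or> F \<subseteq> V2)"
  moreover have F: "F \<subseteq> V" "3 \<le> card F" "sides F \<subseteq> sides V \<union> D" "diagonals F \<inter> D = {}"
    using assms unfolding cells_def by auto
  ultimately obtain u p where u: "u \<in> F" "u \<notin> {a..b}" and "p \<in> F" "p \<in> {a<..<b}" by blast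
  then have p: "p \<in> F" "a < p" "p < b" by auto
  have "finite F" using F(1) finite_V finite_subset by blast
  \<comment> \<open>A side of the cell is a member of \<open>D\<close> or a side of
    \<open>V\<close>; neither kind crosses \<open>{a, b}\<close>.\<close>
  have nc: "\<not> crossing {a, b} e" if "e \<in> sides F" for e
    using that F(3) noncrossing in_D D_diag diagonals_subset_segments[of V] sides_not_crossing[of "{a, b}" V e]
    by blast
  have "a \<in> F"
  proof (rule ccontr)
    assume "a \<notin> F"
    then obtain x y where xy: "x < y" "{x, y} \<in> sides F"
      and *: "x < a \<and> a < y \<and> F \<inter> {x<..<y} = {} \<or> F \<subseteq> {x..y} \<and> (a < x \<or> y < a)"
      using side_around[OF \<open>finite F\<close>] F(2) by (metis Suc_leD eval_nat_numeral(2,3) semiring_norm(26-28))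
    from * have "crossing {a, b} {x, y}"
    proof
      assume h: "x < a \<and> a < y \<and> F \<inter> {x<..<y} = {}"
      then have "\<not> (x < p \<and> p < y)" using p by auto
      then show ?thesis using h p unfolding crossing_iff[OF ab xy(1)] by linarith
    next
      assume h: "F \<subseteq> {x..y} \<and> (a < x \<or> y < a)"
      then have "x \<le> p" "p \<le> y" "x \<le> u" "u \<le> y" using p u by auto
      then show ?thesis using h p u unfolding crossing_iff[OF ab xy(1)] by auto
    qed
    then show False using nc xy by blast
  qed
  moreover have "b \<in> F"
  proof (rule ccontr)
    assume "b \<notin> F"
    then obtain x y where xy: "x < y" "{x, y} \<in> sides F"
      and *: "x < b \<and> b < y \<and> F \<inter> {x<..<y} = {} \<or> F \<subseteq> {x..y} \<and> (b < x \<or> y < b)"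
      using side_around[OF \<open>finite F\<close>] F(2) by (metis Suc_leD eval_nat_numeral(2,3) semiring_norm(26-28))
    from * have "crossing {a, b} {x, y}"
    proof
      assume h: "x < b \<and> b < y \<and> F \<inter> {x<..<y} = {}"
      then have "\<not> (x < p \<and> p < y)" using p by auto
      then show ?thesis using h p unfolding crossing_iff[OF ab xy(1)] by linarith
    next
      assume h: "F \<subseteq> {x..y} \<and> (b < x \<or> y < b)"
      then have "x \<le> p" "p \<le> y" "x \<le> u" "u \<le> y" using p u by auto
      then show ?thesis using h p u unfolding crossing_iff[OF ab xy(1)] by auto
    qed
    then show False using nc xy by blast
  qed
  ultimately have "{a, b} \<in> diagonals F" using p u unfolding diagonals_iff[OF ab] by auto
  then show False using F(4) in_D by blast
qed

text \<open>Formulated for a general \<open>W\<close> so that one argument serves \<open>V1\<close>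
  and \<open>V2\<close>. Between vertices of \<open>W\<close>, a side of \<open>V\<close> is a side
  of \<open>W\<close>, and a member of \<open>D\<close> is a diagonal or a side of
  \<open>W\<close>.\<close>

lemma cells_restrict:
  assumes W: "W \<subseteq> V" "{a, b} \<in> sides W" "sides W \<subseteq> insert {a, b} (sides V)"
  shows "{F \<in> cells V D. F \<subseteq> W} = cells W (D \<inter> diagonals W)"
proof -
  have D_W: "e \<in> D \<inter> diagonals W \<or> e \<in> sides W" if "e \<in> D" "e \<in> segments W" for e
    using that unfolding diagonals_def by blast
  have "F \<in> cells V D \<longleftrightarrow> F \<in> cells W (D \<inter> diagonals W)" if F: "F \<subseteq> W" for F
  proof -
    have "sides F \<subseteq> sides V \<union> D \<longleftrightarrow> sides F \<subseteq> sides W \<union> (D \<inter> diagonals W)"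
    proof
      assume h: "sides F \<subseteq> sides V \<union> D"
      show "sides F \<subseteq> sides W \<union> (D \<inter> diagonals W)"
      proof
        fix e assume e: "e \<in> sides F"
        then have "e \<in> segments W" using F segments_mono sides_subset_segments by blast
        then show "e \<in> sides W \<union> (D \<inter> diagonals W)" using e h D_W sides_restrict[OF W(1)] by blast
      qed
    next
      assume "sides F \<subseteq> sides W \<union> (D \<inter> diagonals W)"
      then show "sides F \<subseteq> sides V \<union> D" using W(3) in_D by blast
    qed
    moreover have "diagonals F \<inter> D = diagonals F \<inter> (D \<inter> diagonals W)"
      using diagonals_mono[OF F] by blast
    ultimately show ?thesis using F W(1) unfolding cells_def by auto
  qed
  moreover have "F \<subseteq> W" if "F \<in> cells W (D \<inter> diagonals W)" for F
    using that unfolding cells_def by simp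
  ultimately show ?thesis by blast
qed

lemma cells_eq: "cells V D = cells V1 D1 \<union> cells V2 D2"
proof -
  have "cells V1 D1 = {F \<in> cells V D. F \<subseteq> V1}"
    using cells_restrict[of V1] ab_side1 sides_V1 by simp
  moreover have "cells V2 D2 = {F \<in> cells V D. F \<subseteq> V2}"
    using cells_restrict[of V2] ab_side2 sides_V2 by simp
  ultimately show ?thesis using cell_cases by blast
qed

lemma dissections_iff: "D \<in> dissections V m \<longleftrightarrow> D1 \<in> dissections V1 m \<and> D2 \<in> dissections V2 m"
  unfolding dissections_def mem_Collect_eq cells_eq ball_Un using D_diag noncrossing by simp

end

section \<open>Dissections as maximal sets of admissible diagonals\<close>

text \<open>The vertices cut off are counted within \<open>V\<close> and not by their labels, since
  the notion is applied to halves, whose labels have gaps. A polygon dissected into \<open>c\<close>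
  cells with \<open>q + 2\<close> vertices has \<open>q * c\<close> vertices besides the ends of one
  side.\<close>

definition admissible :: "nat \<Rightarrow> nat set \<Rightarrow> nat set \<Rightarrow> bool" where
  "admissible q V d \<longleftrightarrow> (\<exists>a b. a < b \<and> d = {a, b} \<and> q dvd card (V \<inter> {a<..<b}))"

lemma admissible_iff:
  assumes "a < b"
  shows "admissible q V {a, b} \<longleftrightarrow> q dvd card (V \<inter> {a<..<b})"
  unfolding admissible_def using assms doubleton_less_eq_iff by metis

context split_polygon
begin

lemma admissible_V1:
  assumes "e \<in> segments V1"
  shows "admissible q V1 e \<longleftrightarrow> admissible q V e"
proof -
  obtain x y where xy: "x < y" "e = {x, y}" "x \<in> V1" "y \<in> V1" using assms by (rule segmentsE)
  then have "V1 \<inter> {x<..<y} = V \<inter> {x<..<y}" by auto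
  with xy show ?thesis by (simp add: admissible_iff)
qed

text \<open>A segment of \<open>V2\<close> that spans the cut loses exactly the vertices inside
  \<open>{a<..<b}\<close>, a multiple of \<open>q\<close>; all other segments keep their
  count.\<close>

lemma admissible_V2:
  assumes "e \<in> segments V2" "q dvd card (V \<inter> {a<..<b})"
  shows "admissible q V2 e \<longleftrightarrow> admissible q V e"
proof -
  obtain x y where xy: "x < y" "e = {x, y}" "x \<in> V2" "y \<in> V2" using assms(1) by (rule segmentsE)
  show ?thesis
  proof (cases "x \<le> a \<and> b \<le> y")
    case True
    have "card (V \<inter> {x<..<y}) = card (V2 \<inter> {x<..<y} \<union> V \<inter> {a<..<b})"
      using True by (intro arg_cong[where f=card]) auto
    also have "\<dots> = card (V2 \<inter> {x<..<y}) + card (V \<inter> {a<..<b})"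
      using finite_V by (intro card_Un_disjoint) auto
    finally show ?thesis using xy assms(2) by (simp add: admissible_iff dvd_add_left_iff)
  next
    case False
    then have "V2 \<inter> {x<..<y} = V \<inter> {x<..<y}" using xy by auto
    with xy show ?thesis by (simp add: admissible_iff)
  qed
qed

end

text \<open>If a cell misses a vertex \<open>v\<close>, its side around \<open>v\<close> is also a
  side of \<open>V\<close>. Then all of \<open>V\<close> lies on the same side of it as
  \<open>v\<close>, which contradicts a third vertex \<open>u\<close> of the cell.\<close>

lemma cells_empty:
  assumes "finite V" "F \<in> cells V {}"
  shows "F = V"
proof (rule ccontr)
  assume "F \<noteq> V"
  have F: "F \<subseteq> V" "3 \<le> card F" "sides F \<subseteq> sides V" using assms(2) unfolding cells_def by auto
  obtain v where v: "v \<in> V" "v \<notin> F" using F(1) \<open>F \<noteq> V\<close> by blast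
  have "finite F" using F(1) assms(1) finite_subset by blast
  moreover have "2 \<le> card F" using F(2) by simp
  ultimately obtain x y where xy: "x < y" "{x, y} \<in> sides F"
    and *: "x < v \<and> v < y \<and> F \<inter> {x<..<y} = {} \<or> F \<subseteq> {x..y} \<and> (v < x \<or> y < v)"
    using side_around v(2) by metis
  have "{x, y} \<in> sides V" using F(3) xy by blast
  then have xyV: "V \<inter> {x<..<y} = {} \<or> V \<subseteq> {x..y}" using xy by (simp add: sides_iff)
  have "card {x, y} < card F" using F(2) card_insert_le_m1[of 2 "{y}" x] by simp
  then have "\<not> F \<subseteq> {x, y}" using card_mono[of "{x, y}" F] by auto
  then obtain u where u: "u \<in> F" "u \<noteq> x" "u \<noteq> y" by blast
  from * show False
  proof
    assume h: "x < v \<and> v < y \<and> F \<inter> {x<..<y} = {}"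
    then have "v \<in> V \<inter> {x<..<y}" using v by simp
    then have "V \<subseteq> {x..y}" using xyV by blast
    then have "u \<in> {x..y}" using u F(1) by blast
    then have "u \<in> F \<inter> {x<..<y}" using u by auto
    then show False using h by blast
  next
    assume h: "F \<subseteq> {x..y} \<and> (v < x \<or> y < v)"
    then have "v \<notin> {x..y}" by auto
    then have "V \<inter> {x<..<y} = {}" using xyV v by blast
    moreover have "u \<in> {x..y}" using h u by blast
    ultimately show False using u F(1) by auto
  qed
qed

lemma self_in_cells: "3 \<le> card V \<Longrightarrow> V \<in> cells V {}"
  unfolding cells_def by auto

text \<open>Induction by cutting: the halves share two vertices, and their diagonals together with
  the cut make up \<open>D\<close>. The formula for \<open>V1\<close> also shows that the cut is
  admissible, which is what lets admissibility pass from \<open>V2\<close> to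
  \<open>V\<close>.\<close>

lemma dissection_card:
  assumes "finite V" "3 \<le> card V" "D \<in> dissections V (q + 2)"
  shows "card V = q * (card D + 1) + 2 \<and> (\<forall>d\<in>D. admissible q V d)"
  using assms
proof (induction "card V" arbitrary: V D rule: less_induct)
  case less
  show ?case
  proof (cases "D = {}")
    case True
    then show ?thesis using less.prems self_in_cells[of V] unfolding dissections_def by auto
  next
    case False
    then obtain d where d: "d \<in> D" by blast
    have D: "D \<subseteq> diagonals V" "\<forall>d\<in>D. \<forall>e\<in>D. \<not> crossing d e"
      using less.prems(3) unfolding dissections_def by auto
    then obtain a b where ab: "a < b" "d = {a, b}"
      using d diagonals_subset_segments by (blast elim: segmentsE)
    have "{a, b} \<in> D" using d ab by simp
    then interpret split_polygon V D a b using less.prems(1) D ab(1) by (intro split_polygon.intro)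
    have "card V1 = q * (card D1 + 1) + 2 \<and> (\<forall>d\<in>D1. admissible q V1 d)"
      using less.hyps[of V1 D1] less.prems(1,3) dissections_iff card_V card_V1_ge card_V2_ge by auto
    moreover have "card V2 = q * (card D2 + 1) + 2 \<and> (\<forall>d\<in>D2. admissible q V2 d)"
      using less.hyps[of V2 D2] less.prems(1,3) dissections_iff card_V card_V1_ge card_V2_ge by auto
    ultimately have h: "card V1 = q * (card D1 + 1) + 2" "\<forall>d\<in>D1. admissible q V1 d"
      "card V2 = q * (card D2 + 1) + 2" "\<forall>d\<in>D2. admissible q V2 d" by auto
    have q: "q dvd card (V \<inter> {a<..<b})" using h(1) card_V1 by simp
    then have "admissible q V e" if "e \<in> D" for e
      using that D_subset h(2,4) admissible_V1[of e q] admissible_V2[of e q]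
        diagonals_subset_segments ab admissible_iff[of a b q V] by blast
    moreover have "card V = q * (card D + 1) + 2"
      using card_V card_D h(1,3) by (simp add: algebra_simps)
    ultimately show ?thesis by blast
  qed
qed

text \<open>The converse of \<open>dissection_card\<close>. An admissible cut leaves halves for
  \<open>n1\<close> and \<open>n2\<close> cells with \<open>n1 + n2 = n\<close>; the bounds
  \<open>n1 - 1\<close> and \<open>n2 - 1\<close> and the cut add up to \<open>n - 1\<close>, with
  equality only if it holds in both halves.\<close>

lemma admissible_card_le:
  assumes "finite V" "card V = q * n + 2" "1 \<le> n" "1 \<le> q" "D \<subseteq> diagonals V"
    "\<forall>d\<in>D. \<forall>e\<in>D. \<not> crossing d e" "\<forall>d\<in>D. admissible q V d"
  shows "card D \<le> n - 1 \<and> (card D = n - 1 \<longrightarrow> D \<in> dissections V (q + 2))"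
  using assms
proof (induction n arbitrary: V D rule: less_induct)
  case (less n)
  show ?case
  proof (cases "D = {}")
    case True
    have "D \<in> dissections V (q + 2)" if "n = 1"
      using True that less.prems cells_empty[of V] unfolding dissections_def by auto
    then show ?thesis using True less.prems(3) by (cases "n = 1") auto
  next
    case False
    then obtain d where d: "d \<in> D" by blast
    then obtain a b where ab: "a < b" "d = {a, b}"
      using less.prems(5) diagonals_subset_segments by (blast elim: segmentsE)
    have "{a, b} \<in> D" using d ab by simp
    then interpret split_polygon V D a b using less.prems(1,5,6) ab(1) by (intro split_polygon.intro)
    have "q dvd card (V \<inter> {a<..<b})" using less.prems(7) \<open>{a, b} \<in> D\<close> admissible_iff[OF ab(1)] by blast
    then obtain n1 where n1: "card (V \<inter> {a<..<b}) = q * n1" by (auto simp: dvd_def)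
    then have V1: "card V1 = q * n1 + 2" using card_V1 by simp
    have "card V2 = q * n - q * n1 + 2" using card_V card_V2_ge V1 less.prems(2) by linarith
    moreover define n2 where "n2 = n - n1"
    ultimately have V2: "card V2 = q * n2 + 2" by (simp add: diff_mult_distrib2)
    \<comment> \<open>Each half has at least three vertices and hence room for a cell, so
      \<open>n1 - 1\<close> and \<open>n2 - 1\<close> are true differences.\<close>
    have "n1 \<noteq> 0" using V1 card_V1_ge by force
    moreover have "n2 \<noteq> 0" using V2 card_V2_ge by force
    ultimately have n: "1 \<le> n1" "1 \<le> n2" by auto
    then have n12: "n = n1 + n2" unfolding n2_def by simp
    have "\<forall>e\<in>D1. admissible q V1 e" "\<forall>e\<in>D2. admissible q V2 e"
      using less.prems(7) n1 diagonals_subset_segments admissible_V1 admissible_V2 by (metis IntE dvd_triv_left subsetD)+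
    then have 1: "card D1 \<le> n1 - 1 \<and> (card D1 = n1 - 1 \<longrightarrow> D1 \<in> dissections V1 (q + 2))"
      and 2: "card D2 \<le> n2 - 1 \<and> (card D2 = n2 - 1 \<longrightarrow> D2 \<in> dissections V2 (q + 2))"
      using less.IH[of n1 V1 D1] less.IH[of n2 V2 D2] V1 V2 n n12 less.prems(1,4,6) by auto
    have "card D \<le> n - 1" using 1 2 n n12 card_D by linarith
    moreover have "card D1 = n1 - 1 \<and> card D2 = n2 - 1" if "card D = n - 1"
      using that 1 2 n n12 card_D by linarith
    ultimately show ?thesis using 1 2 dissections_iff by blast
  qed
qed

section \<open>Flips\<close>

lemma flipI:
  assumes "F \<in> cells V D" "F' \<in> cells V D" "d \<in> D" "d' \<in> diagonals (F \<union> F')"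
    "F \<noteq> F'" "d \<in> sides F" "d \<in> sides F'" "d' \<noteq> d"
    "{d'} \<in> dissections (F \<union> F') m" "D' = insert d' (D - {d})"
  shows "flip V m D D'"
  unfolding flip_def
  by (intro bexI[OF _ assms(1)] bexI[OF _ assms(2)] bexI[OF _ assms(3)] bexI[OF _ assms(4)]
      conjI assms)

text \<open>\<open>flip\<close> refers to the polygon only through its cells, and the two cells
  involved in a flip of \<open>W\<close> are cells of \<open>V\<close>.\<close>

lemma flip_cells_mono:
  assumes "flip W m (D \<inter> diagonals W) (D' \<inter> diagonals W)"
    "cells W (D \<inter> diagonals W) \<subseteq> cells V D" "D - diagonals W = D' - diagonals W"
  shows "flip V m D D'"
proof -
  obtain F F' d d' where *: "F \<in> cells W (D \<inter> diagonals W)" "F' \<in> cells W (D \<inter> diagonals W)"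
    "d \<in> D \<inter> diagonals W" "d' \<in> diagonals (F \<union> F')" "F \<noteq> F'" "d \<in> sides F" "d \<in> sides F'" "d' \<noteq> d"
    "{d'} \<in> dissections (F \<union> F') m" "D' \<inter> diagonals W = insert d' (D \<inter> diagonals W - {d})"
    using assms(1) unfolding flip_def by (elim bexE conjE) (rule that)
  have "D' = insert d' (D - {d})" using *(3,10) assms(3) by blast
  then show ?thesis
    using *(3-9) subsetD[OF assms(2) *(1)] subsetD[OF assms(2) *(2)] by (intro flipI[of F V D F' d d']) blast+
qed

text \<open>Any further diagonal \<open>e\<close> belongs to both dissections, and cutting along it
  reduces the claim to the half that contains \<open>d\<close>, provided that \<open>d'\<close>
  falls into the same half. If there is no further diagonal, the two cells are the halves at
  \<open>d\<close>.\<close>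

lemma flip_exchange:
  assumes "finite V" "3 \<le> card V" "D \<in> dissections V (q + 2)" "D' \<in> dissections V (q + 2)" "1 \<le> q"
    "d \<in> D" "d' \<notin> D" "D' = insert d' (D - {d})"
  shows "flip V (q + 2) D D'"
  using assms
proof (induction "card V" arbitrary: V D D' rule: less_induct)
  case less
  have D: "D \<subseteq> diagonals V" "\<forall>d\<in>D. \<forall>e\<in>D. \<not> crossing d e"
    using less.prems(3) unfolding dissections_def by auto
  have D': "D' \<subseteq> diagonals V" "\<forall>d\<in>D'. \<forall>e\<in>D'. \<not> crossing d e"
    using less.prems(4) unfolding dissections_def by auto
  show ?case
  proof (cases "D = {d}")
    case True
    then have D'_eq: "D' = {d'}" using less.prems(8) by simp
    obtain a b where pq: "a < b" "d = {a, b}"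
      using D(1) less.prems(6) diagonals_subset_segments by (blast elim: segmentsE)
    have "{a, b} \<in> D" using True pq by simp
    then interpret split_polygon V D a b using less.prems(1) D pq(1) by (intro split_polygon.intro)
    have empty: "D1 = {}" "D2 = {}" using True pq(2) ab_notin by blast+
    have "V1 \<in> cells V1 D1" "V2 \<in> cells V2 D2"
      unfolding empty using self_in_cells card_V1_ge card_V2_ge by blast+
    then have "V1 \<in> cells V D" "V2 \<in> cells V D" using cells_eq by blast+
    moreover have "V1 \<noteq> V2" using V1_neq_V2 .
    moreover have "{d'} \<in> dissections V (q + 2)" "d' \<in> diagonals V" using D'(1) D'_eq less.prems(4) by simp_all
    moreover have "d' \<noteq> d" using less.prems(6,7) by blast
    moreover have "{a, b} \<in> D" "D' = insert d' (D - {{a, b}})" "d' \<noteq> {a, b}"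
      using True pq(2) calculation less.prems(8) by simp_all
    ultimately show ?thesis
      using ab_side1 ab_side2 by (intro flipI[of V1 V D V2 "{a, b}" d']) (simp_all only: V1_Un_V2 not_False_eq_True)
  next
    case False
    have "\<exists>e\<in>D. e \<noteq> d"
    proof (rule ccontr)
      assume "\<not> (\<exists>e\<in>D. e \<noteq> d)"
      then have "D \<subseteq> {d}" by blast
      then show False using False less.prems(6) by blast
    qed
    then obtain e where e: "e \<in> D" "e \<noteq> d" by blast
    then have e': "e \<in> D'" using less.prems(8) by blast
    obtain a b where pq: "a < b" "e = {a, b}"
      using D(1) e(1) diagonals_subset_segments by (blast elim: segmentsE)
    have ab_in: "{a, b} \<in> D" "{a, b} \<in> D'" using e e' pq by simp_all
    interpret P: split_polygon V D a b using less.prems(1) D ab_in(1) pq(1) by (intro split_polygon.intro)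
    interpret P': split_polygon V D' a b using less.prems(1) D' ab_in(2) pq(1) by (intro split_polygon.intro)
    let ?V1 = "V \<inter> {a..b}" and ?V2 = "V - {a<..<b}"
    have dis: "D \<inter> diagonals ?V1 \<in> dissections ?V1 (q + 2)" "D \<inter> diagonals ?V2 \<in> dissections ?V2 (q + 2)"
      "D' \<inter> diagonals ?V1 \<in> dissections ?V1 (q + 2)" "D' \<inter> diagonals ?V2 \<in> dissections ?V2 (q + 2)"
      using less.prems(3,4) P.dissections_iff P'.dissections_iff by blast+
    \<comment> \<open>The number of vertices determines the number of diagonals of a dissection, so
      \<open>D\<close> and \<open>D'\<close> have equally many in each half. A half cannot lose
      \<open>d\<close> without gaining \<open>d'\<close>.\<close>
    have card_eq: "card (D \<inter> diagonals W) = card (D' \<inter> diagonals W)"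
      if "finite W" "3 \<le> card W" "D \<inter> diagonals W \<in> dissections W (q + 2)"
        "D' \<inter> diagonals W \<in> dissections W (q + 2)" for W
      using dissection_card[OF that(1,2,3)] dissection_card[OF that(1,2,4)] \<open>1 \<le> q\<close> by simp
    have fin: "finite D" using P.finite_diagonals_V .
    have both: "d' \<in> diagonals W" if "d \<in> diagonals W" "card (D \<inter> diagonals W) = card (D' \<inter> diagonals W)" for W
    proof (rule ccontr)
      assume "d' \<notin> diagonals W"
      then have "D' \<inter> diagonals W = D \<inter> diagonals W - {d}" using less.prems(8) by blast
      moreover have "d \<in> D \<inter> diagonals W" "finite (D \<inter> diagonals W)" using that less.prems(6) fin by auto
      ultimately show False using that(2) by (metis card_Diff1_less less_irrefl)
    qed
    have *: "flip V (q + 2) D D'" if W: "d \<in> diagonals W" "W = ?V1 \<or> W = ?V2" for W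
    proof -
      have cW: "3 \<le> card W" "card W < card V" "finite W"
        using W(2) P.card_V1_ge P.card_V2_ge P.card_V less.prems(1) by auto
      have "D \<inter> diagonals W \<in> dissections W (q + 2)" "D' \<inter> diagonals W \<in> dissections W (q + 2)"
        using W(2) dis by auto
      moreover have "d' \<in> diagonals W" using both W(1) card_eq cW calculation by blast
      then have "D' \<inter> diagonals W = insert d' (D \<inter> diagonals W - {d})" using less.prems(8) by blast
      ultimately have "flip W (q + 2) (D \<inter> diagonals W) (D' \<inter> diagonals W)"
        using less.hyps[of W "D \<inter> diagonals W" "D' \<inter> diagonals W"] less.prems(5-7) cW W(1) by blast
      moreover have "D - diagonals W = D' - diagonals W" using less.prems(8) W(1) \<open>d' \<in> diagonals W\<close> by blast
      moreover have "cells W (D \<inter> diagonals W) \<subseteq> cells V D" using W(2) P.cells_eq by auto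
      ultimately show ?thesis using flip_cells_mono by blast
    qed
    have "d \<in> diagonals ?V1 \<or> d \<in> diagonals ?V2" using P.D_subset less.prems(6) e pq by blast
    then show ?thesis using * by blast
  qed
qed

section \<open>The fan of the last vertex\<close>

definition noncrossing :: "nat set set \<Rightarrow> bool" where
  "noncrossing D \<longleftrightarrow> (\<forall>d\<in>D. \<forall>e\<in>D. \<not> crossing d e)"

lemma noncrossing_mono: "noncrossing D \<Longrightarrow> D' \<subseteq> D \<Longrightarrow> noncrossing D'"
  unfolding noncrossing_def by blast

lemma noncrossingD: "noncrossing D \<Longrightarrow> {a, b} \<in> D \<Longrightarrow> {x, y} \<in> D \<Longrightarrow> a < x \<Longrightarrow> x < b \<Longrightarrow> \<not> b < y"
  unfolding noncrossing_def crossing_def by blast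

section \<open>Admissible diagonals of polygons with consecutive labels\<close>

locale dissecting =
  fixes q :: nat
  assumes q_pos: "1 \<le> q"
begin

definition top_vertex :: "nat \<Rightarrow> nat" where
  "top_vertex l = q * l + 1"

text \<open>With consecutive labels, \<open>b - a - 1\<close> is the number of vertices between the
  ends. The last two conditions exclude the sides.\<close>

definition good :: "nat \<Rightarrow> nat set set" where
  "good l = {{a, b} | a b. a < b \<and> b \<le> top_vertex l \<and> q dvd (b - a - 1) \<and> 1 < b - a \<and>
                           \<not> (a = 0 \<and> b = top_vertex l)}"

definition full_dissections :: "nat \<Rightarrow> nat set set set" where
  "full_dissections l = {D. D \<subseteq> good l \<and> noncrossing D \<and> card D = l - 1}"

lemma top_vertex_Suc: "top_vertex (Suc l) = top_vertex l + q"
  unfolding top_vertex_def by simp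

lemma goodE:
  assumes "e \<in> good l"
  obtains a b where "a < b" "e = {a, b}" "b \<le> top_vertex l" "q dvd (b - a - 1)" "1 < b - a"
    "\<not> (a = 0 \<and> b = top_vertex l)"
  using assms unfolding good_def mem_Collect_eq by (elim exE conjE) (rule that)

lemma good_iff:
  assumes "a < b"
  shows "{a, b} \<in> good l \<longleftrightarrow>
    b \<le> top_vertex l \<and> q dvd (b - a - 1) \<and> 1 < b - a \<and> \<not> (a = 0 \<and> b = top_vertex l)"
proof
  assume "{a, b} \<in> good l"
  then obtain x y where xy: "x < y" "{a, b} = {x, y}" and
    *: "y \<le> top_vertex l" "q dvd (y - x - 1)" "1 < y - x" "\<not> (x = 0 \<and> y = top_vertex l)"
    by (rule goodE)
  have "x = a" "y = b" using xy doubleton_less_eq_iff[OF assms xy(1)] by simp_all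
  with * show "b \<le> top_vertex l \<and> q dvd (b - a - 1) \<and> 1 < b - a \<and> \<not> (a = 0 \<and> b = top_vertex l)"
    by simp
qed (use assms in \<open>unfold good_def, blast\<close>)

lemma finite_good: "finite (good l)"
proof -
  have "good l \<subseteq> Pow {..top_vertex l}" unfolding good_def by auto
  then show ?thesis by (meson finite_Pow_iff finite_atMost finite_subset)
qed

lemma good_eq: "good l = {d \<in> diagonals {..<q * l + 2}. admissible q {..<q * l + 2} d}" (is "_ = ?R")
proof -
  have *: "{a, b} \<in> good l \<longleftrightarrow> {a, b} \<in> ?R" if "a < b" for a b
  proof (cases "b \<le> top_vertex l")
    case True
    then have "{..<q * l + 2} \<inter> {a<..<b} = {a<..<b}" unfolding top_vertex_def by auto
    moreover have "{..<q * l + 2} \<subseteq> {a..b} \<longleftrightarrow> a = 0 \<and> b = top_vertex l"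
    proof
      assume h: "{..<q * l + 2} \<subseteq> {a..b}"
      have "0 \<in> {a..b}" "q * l + 1 \<in> {a..b}" by (rule subsetD[OF h], simp)+
      then show "a = 0 \<and> b = top_vertex l" using True unfolding top_vertex_def by auto
    qed (auto simp: top_vertex_def)
    moreover have "{a<..<b} \<noteq> {} \<longleftrightarrow> 1 < b - a"
    proof
      assume "1 < b - a"
      then have "Suc a \<in> {a<..<b}" by auto
      then show "{a<..<b} \<noteq> {}" by blast
    qed auto
    ultimately show ?thesis
      using that True by (auto simp: good_iff diagonals_iff admissible_iff top_vertex_def)
  next
    case False
    then show ?thesis using that by (auto simp: good_iff diagonals_iff top_vertex_def)
  qed
  show ?thesis
  proof (intro set_eqI iffI)
    fix e assume "e \<in> good l"
    then obtain a b where "a < b" "e = {a, b}" by (rule goodE)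
    with \<open>e \<in> good l\<close> * show "e \<in> ?R" by blast
  next
    fix e assume "e \<in> ?R"
    then obtain a b where "a < b" "e = {a, b}" using diagonals_subset_segments by (blast elim: segmentsE)
    with \<open>e \<in> ?R\<close> * show "e \<in> good l" by blast
  qed
qed

lemma good_card_le:
  assumes "1 \<le> l" "D \<subseteq> good l" "noncrossing D"
  shows "card D \<le> l - 1"
  using admissible_card_le[of "{..<q * l + 2}" q l D] assms q_pos
  unfolding good_eq noncrossing_def by auto

lemma dissections_eq:
  assumes "1 \<le> l"
  shows "dissections {..<q * l + 2} (q + 2) = full_dissections l"
proof (intro set_eqI iffI)
  fix D assume D: "D \<in> dissections {..<q * l + 2} (q + 2)"
  have "1 * 1 \<le> q * l" using assms q_pos by (intro mult_le_mono) auto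
  then have "card {..<q * l + 2} = q * (card D + 1) + 2 \<and> (\<forall>d\<in>D. admissible q {..<q * l + 2} d)"
    by (intro dissection_card[OF _ _ D]) simp_all
  then have *: "q * l = q * (card D + 1)" "\<forall>d\<in>D. admissible q {..<q * l + 2} d"
    unfolding card_lessThan by (linarith, blast)
  then have "card D = l - 1" using q_pos by (metis add_diff_cancel_right' mult_cancel1 not_one_le_zero)
  moreover have "D \<subseteq> diagonals {..<q * l + 2}" "noncrossing D"
    using D unfolding dissections_def noncrossing_def by auto
  ultimately show "D \<in> full_dissections l"
    unfolding full_dissections_def good_eq using *(2) by blast
next
  fix D assume "D \<in> full_dissections l"
  then show "D \<in> dissections {..<q * l + 2} (q + 2)"
    using admissible_card_le[of "{..<q * l + 2}" q l D] assms q_pos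
    unfolding full_dissections_def good_eq noncrossing_def by auto
qed

text \<open>These diagonals do not touch the vertex that is split, so they persist in all
  descendants.\<close>

definition frozen :: "nat \<Rightarrow> nat set set \<Rightarrow> bool" where
  "frozen l F \<longleftrightarrow> F \<subseteq> good l \<and> (\<forall>e\<in>F. top_vertex l \<notin> e) \<and> noncrossing F"

definition struts :: "nat \<Rightarrow> nat list \<Rightarrow> (nat \<Rightarrow> nat) \<Rightarrow> nat set \<Rightarrow> nat set set" where
  "struts l w d I = (\<lambda>i. {w ! (q * i + d i), top_vertex l + d i}) ` I"

text \<open>The vertices that the top vertex sees.\<close>

definition link_set :: "nat \<Rightarrow> nat set set \<Rightarrow> nat set" where
  "link_set l F = {x. x < top_vertex l \<and> (\<forall>a b. a < b \<longrightarrow> {a, b} \<in> F \<longrightarrow> \<not> (a < x \<and> x < b))}"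

definition link :: "nat \<Rightarrow> nat set set \<Rightarrow> nat list" where
  "link l F = sorted_list_of_set (link_set l F)"

text \<open>Each of the \<open>r\<close> cells at the top vertex has \<open>q + 1\<close> further
  vertices and shares one of them with the next cell, so the link has \<open>q * r + 1\<close>
  entries.\<close>

definition fan_size :: "nat list \<Rightarrow> nat" where
  "fan_size w = (length w - 1) div q"

text \<open>The indices \<open>0\<close> and \<open>fan_size w\<close> are left out because they
  give the two sides at the top vertex.\<close>

definition fan_diagonals :: "nat \<Rightarrow> nat list \<Rightarrow> nat set set" where
  "fan_diagonals l w = (\<lambda>i. {w ! (q * i), top_vertex l}) ` {0<..<fan_size w}"

text \<open>In the sense of partitions, these functions are the conjugates of the nonincreasing
  sequences of length \<open>q\<close>. Their monotonicity keeps the struts nested.\<close>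

definition antitone_below :: "nat list \<Rightarrow> (nat \<Rightarrow> nat) \<Rightarrow> bool" where
  "antitone_below w d \<longleftrightarrow>
     (\<forall>i<fan_size w. d i \<le> q) \<and> (\<forall>i j. i < j \<longrightarrow> j < fan_size w \<longrightarrow> d j \<le> d i)"

text \<open>Meant for \<open>m\<close> the number of struts with shift \<open>q\<close>. Those end
  at the new top vertex and form the fan of the child; the others avoid this vertex and
  freeze.\<close>

definition child_frozen :: "nat \<Rightarrow> nat set set \<Rightarrow> nat list \<Rightarrow> (nat \<Rightarrow> nat) \<Rightarrow> nat \<Rightarrow> nat set set" where
  "child_frozen l F w d m = F \<union> struts l w d {m..<fan_size w}"

text \<open>Strut \<open>m\<close> is the first one that falls short of the new top vertex. It hides
  the old link behind its foot and the copies of the old top vertex before its end.\<close>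

definition child_link :: "nat \<Rightarrow> nat list \<Rightarrow> (nat \<Rightarrow> nat) \<Rightarrow> nat \<Rightarrow> nat list" where
  "child_link l w d m = take (q * m + d m + 1) w @ [top_vertex l + d m..<top_vertex l + q]"

lemma frozenE:
  assumes "frozen l F" "e \<in> F"
  obtains a b where "a < b" "e = {a, b}" "b < top_vertex l" "q dvd (b - a - 1)" "1 < b - a"
proof -
  have "e \<in> good l" "top_vertex l \<notin> e" using assms unfolding frozen_def by auto
  then obtain a b where *: "a < b" "e = {a, b}" "b \<le> top_vertex l" "q dvd (b - a - 1)" "1 < b - a"
    by (elim goodE)
  then have "b \<noteq> top_vertex l" using \<open>top_vertex l \<notin> e\<close> by auto
  then show ?thesis using that * by auto
qed

lemma frozen_doubleton:
  assumes "frozen l F" "{a, b} \<in> F" "a < b"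
  shows "b < top_vertex l" "q dvd (b - a - 1)" "1 < b - a"
  using frozenE[OF assms(1,2)] assms(3) doubleton_less_eq_iff by metis+

lemma finite_link_set: "finite (link_set l F)"
  unfolding link_set_def by auto

lemma set_link: "set (link l F) = link_set l F"
  unfolding link_def using finite_link_set by simp

lemma sorted_link: "sorted_wrt (<) (link l F)"
  unfolding link_def by simp

text \<open>If \<open>y\<close> is not the successor of \<open>x\<close>, the vertices between them
  are hidden by frozen diagonals. The longest of these that starts at \<open>x\<close> ends in a
  visible vertex, which must be \<open>y\<close>; so \<open>{x, y}\<close> is itself frozen and
  hence admissible.\<close>

lemma link_gap:
  assumes F: "frozen l F" and xy: "x < y" "x \<in> link_set l F" "y \<in> link_set l F"
    and gap: "\<And>u. u \<in> link_set l F \<Longrightarrow> x < u \<Longrightarrow> y \<le> u"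
  shows "q dvd (y - x - 1)"
proof (cases "y = Suc x")
  case False
  then have "Suc x \<notin> link_set l F" using gap[of "Suc x"] xy(1) by auto
  moreover have "Suc x < top_vertex l" using xy unfolding link_set_def by auto
  ultimately obtain a b where ab: "a < b" "{a, b} \<in> F" "a < Suc x" "Suc x < b"
    unfolding link_set_def by auto
  \<comment> \<open>A diagonal that hides \<open>Suc x\<close> but not \<open>x\<close> starts at
    \<open>x\<close>.\<close>
  have "\<not> (a < x \<and> x < b)" using xy(2) ab(1,2) unfolding link_set_def by blast
  then have "a = x" using ab by auto
  define B where "B = {b. x < b \<and> {x, b} \<in> F}"
  have "B \<subseteq> {..top_vertex l}" unfolding B_def using less_imp_le[OF frozen_doubleton(1)[OF F]] by auto
  then have "finite B" using finite_subset by blast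
  moreover have "b \<in> B" unfolding B_def using ab \<open>a = x\<close> by auto
  ultimately have Max: "Max B \<in> B" "\<And>c. c \<in> B \<Longrightarrow> c \<le> Max B" using Max_in Max_ge by auto
  define c where "c = Max B"
  have c: "x < c" "{x, c} \<in> F" using Max unfolding B_def c_def by auto
  have "c \<in> link_set l F"
    unfolding link_set_def mem_Collect_eq
  proof (intro conjI allI impI)
    show "c < top_vertex l" using frozen_doubleton[OF F c(2,1)] by simp
    fix a' b' assume h: "a' < b'" "{a', b'} \<in> F"
    show "\<not> (a' < c \<and> c < b')"
    proof
      assume h': "a' < c \<and> c < b'"
      have nc: "\<not> (x < a' \<and> a' < c \<and> c < b')"
        using noncrossingD[of F x c a' b'] F c(2) h(2) unfolding frozen_def by blast
      have "\<not> (a' < x \<and> x < b')" using xy(2) h unfolding link_set_def by blast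
      then have "a' = x" using h' nc c(1) by linarith
      then have "b' \<in> B" unfolding B_def using h by auto
      then show False using Max(2) h' unfolding c_def by fastforce
    qed
  qed
  then have "y \<le> c" using gap c(1) by blast
  moreover have "\<not> (x < y \<and> y < c)" using xy(3) c unfolding link_set_def by blast
  ultimately have "y = c" using xy(1) by auto
  then show ?thesis using frozen_doubleton(2)[OF F c(2,1)] by simp
qed simp

context
  fixes l F w
  assumes F: "frozen l F" and l: "1 \<le> l" and w_def: "w = link l F"
begin

lemma link_strict: "i < j \<Longrightarrow> j < length w \<Longrightarrow> w ! i < w ! j"
  using sorted_link unfolding w_def by (rule sorted_wrt_nth_less)

lemma link_mono: "i \<le> j \<Longrightarrow> j < length w \<Longrightarrow> w ! i \<le> w ! j"
  using link_strict[of i j] by (cases "i = j") auto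

lemma link_in: "i < length w \<Longrightarrow> w ! i \<in> link_set l F"
  using nth_mem set_link w_def by metis

lemma link_lt: "i < length w \<Longrightarrow> w ! i < top_vertex l"
  using link_in unfolding link_set_def by blast

lemma link_obtain:
  assumes "x \<in> link_set l F"
  obtains i where "i < length w" "x = w ! i"
  using assms unfolding set_link[symmetric] w_def by (metis in_set_conv_nth)

lemma zero_in_link: "0 \<in> link_set l F"
  unfolding link_set_def top_vertex_def by simp

lemma end_in_link: "q * l \<in> link_set l F"
  unfolding link_set_def using frozen_doubleton(1)[OF F] by (force simp: top_vertex_def)

lemma length_link_pos: "0 < length w"
  using zero_in_link by (auto elim: link_obtain)

lemma link_0: "w ! 0 = 0"
  using zero_in_link link_mono[of 0] by (metis link_obtain le0 le_zero_eq)

lemma link_last: "w ! (length w - 1) = q * l"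
proof -
  obtain i where i: "i < length w" "q * l = w ! i" using end_in_link by (rule link_obtain)
  then have "q * l \<le> w ! (length w - 1)" using link_mono[of i "length w - 1"] by auto
  moreover have "w ! (length w - 1) < top_vertex l" using link_lt length_link_pos by simp
  ultimately show ?thesis unfolding top_vertex_def by simp
qed

text \<open>By \<open>link_gap\<close>, consecutive link vertices differ by \<open>1\<close> modulo
  \<open>q\<close>, so a link vertex and its index agree modulo \<open>q\<close>. Divisibility
  conditions on labels thereby become conditions on indices.\<close>

lemma link_residue: "i < length w \<Longrightarrow> \<exists>c. w ! i = i + q * c"
proof (induction i)
  case 0
  then show ?case using link_0 by auto
next
  case (Suc i)
  then obtain c where c: "w ! i = i + q * c" by auto
  have lt: "w ! i < w ! Suc i" using link_strict Suc.prems by simp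
  have "w ! Suc i \<le> u" if u: "u \<in> link_set l F" "w ! i < u" for u
  proof -
    obtain j where j: "j < length w" "u = w ! j" using u(1) by (rule link_obtain)
    then have "i < j" using u(2) Suc.prems link_mono[of j i] by (meson Suc_lessD not_le_imp_less not_less)
    then show ?thesis using link_mono[of "Suc i" j] j by auto
  qed
  then have "q dvd (w ! Suc i - w ! i - 1)"
    using link_gap[OF F lt] link_in Suc.prems by auto
  then obtain c' where "w ! Suc i - w ! i - 1 = q * c'" by (auto simp: dvd_def)
  then have "w ! Suc i = Suc i + q * (c + c')" using c lt by (simp add: algebra_simps)
  then show ?case by blast
qed

text \<open>The last link vertex is \<open>q * l\<close>, so the last index is a multiple of
  \<open>q\<close> as well.\<close>

lemma length_link: "length w = q * fan_size w + 1"
proof -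
  obtain c where "w ! (length w - 1) = (length w - 1) + q * c"
    using link_residue[of "length w - 1"] length_link_pos by auto
  then have "length w - 1 = q * l - q * c" using link_last by simp
  then have *: "length w - 1 = q * (l - c)" by (simp add: diff_mult_distrib2)
  then have "fan_size w = l - c" unfolding fan_size_def using q_pos by simp
  moreover have "length w = length w - 1 + 1" using length_link_pos by simp
  ultimately show ?thesis using * by metis
qed

lemma fan_size_pos: "1 \<le> fan_size w"
proof -
  have "0 < q * l" using q_pos l by simp
  then have "length w \<noteq> 1" using link_0 link_last by (metis diff_self_eq_0 less_irrefl)
  then have "fan_size w \<noteq> 0" using length_link by (metis add_0 mult_0_right)
  then show ?thesis by simp
qed

lemma link_end: "w ! (q * fan_size w) = q * l"
  using link_last length_link by simp

lemma index_lt: "i < fan_size w \<Longrightarrow> d \<le> q \<Longrightarrow> q * i + d < length w"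
proof -
  assume "i < fan_size w" "d \<le> q"
  then have "q * i + d \<le> q * Suc i" by simp
  moreover have "q * Suc i \<le> q * fan_size w" using \<open>i < fan_size w\<close> by (intro mult_le_mono) auto
  ultimately show ?thesis using length_link by linarith
qed

lemma strut_good:
  assumes "i < fan_size w" "d \<le> q"
  shows "{w ! (q * i + d), top_vertex l + d} \<in> good (Suc l)"
proof -
  let ?x = "w ! (q * i + d)" and ?y = "top_vertex l + d"
  have idx: "q * i + d < length w" using index_lt assms by simp
  have x: "?x < top_vertex l" using link_lt idx by blast
  obtain c where c: "?x = q * i + d + q * c" using link_residue idx by blast
  have "?y - ?x - 1 = q * l - (q * i + q * c)" unfolding c top_vertex_def by simp
  then have "?y - ?x - 1 = q * (l - (i + c))" by (simp add: diff_mult_distrib2 distrib_left)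
  then have "q dvd (?y - ?x - 1)" by simp
  moreover have "1 < ?y - ?x"
  proof (cases "d = 0")
    case True
    have "q * i < q * fan_size w" using assms q_pos by simp
    then have "?x < q * l" using True link_strict[of "q * i" "q * fan_size w"] length_link link_end by simp
    then show ?thesis using True unfolding top_vertex_def by simp
  next
    case False
    then show ?thesis using x by linarith
  qed
  moreover have "\<not> (?x = 0 \<and> ?y = top_vertex (Suc l))"
  proof
    assume h: "?x = 0 \<and> ?y = top_vertex (Suc l)"
    then have "d = q" unfolding top_vertex_Suc by simp
    then have "0 < q * i + d" using q_pos by simp
    then show False using link_strict[of 0 "q * i + d"] idx h by simp
  qed
  moreover have "?y \<le> top_vertex (Suc l)" using assms unfolding top_vertex_Suc by simp
  ultimately show ?thesis using x by (subst good_iff) auto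
qed

lemma strut_index_le:
  assumes "i < j" "d \<le> q"
  shows "q * i + d \<le> q * j + d'"
proof -
  have "q * Suc i \<le> q * j" using assms by (intro mult_le_mono) auto
  then show ?thesis using assms by simp
qed

lemma strut_eq_iff:
  assumes "i < fan_size w" "j < fan_size w" "d \<le> q" "d' \<le> q"
  shows "{w ! (q * i + d), top_vertex l + d} = {w ! (q * j + d'), top_vertex l + d'} \<longleftrightarrow> i = j \<and> d = d'"
proof
  assume h: "{w ! (q * i + d), top_vertex l + d} = {w ! (q * j + d'), top_vertex l + d'}"
  have idx: "q * i + d < length w" "q * j + d' < length w" using index_lt assms by auto
  then have "w ! (q * i + d) < top_vertex l + d" "w ! (q * j + d') < top_vertex l + d'"
    using link_lt trans_less_add1 by blast+
  then have eq: "w ! (q * i + d) = w ! (q * j + d')" "top_vertex l + d = top_vertex l + d'"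
    using h doubleton_less_eq_iff by blast+
  then have "q * i + d = q * j + d'" using link_strict idx by (metis less_irrefl linorder_neqE_nat)
  then show "i = j \<and> d = d'" using eq q_pos by simp
qed simp

lemma strut_notin_F: "{x, top_vertex l + d} \<notin> F"
proof
  assume "{x, top_vertex l + d} \<in> F"
  then obtain a b where "a < b" "{x, top_vertex l + d} = {a, b}" "b < top_vertex l"
    by (rule frozenE[OF F])
  then have "top_vertex l + d \<in> {a, b}" by blast
  then show False using \<open>a < b\<close> \<open>b < top_vertex l\<close> by auto
qed

lemma finite_F: "finite F"
  using F finite_good finite_subset unfolding frozen_def by blast

lemma inj_on_struts:
  assumes "antitone_below w d"
  shows "inj_on (\<lambda>i. {w ! (q * i + d i), top_vertex l + d i}) {..<fan_size w}"
  using assms strut_eq_iff unfolding antitone_below_def by (intro inj_onI) blast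

lemma card_F_struts:
  assumes "antitone_below w d" "I \<subseteq> {..<fan_size w}"
  shows "card (F \<union> struts l w d I) = card F + card I"
proof -
  have "card (struts l w d I) = card I"
    unfolding struts_def using inj_on_struts[OF assms(1)] assms(2) by (meson card_image inj_on_subset)
  moreover have "F \<inter> struts l w d I = {}" unfolding struts_def using strut_notin_F by blast
  moreover have "finite (struts l w d I)" unfolding struts_def using assms(2) finite_subset by blast
  ultimately show ?thesis using card_Un_disjoint finite_F by metis
qed

lemma struts_good:
  assumes "antitone_below w d"
  shows "F \<union> struts l w d {..<fan_size w} \<subseteq> good (Suc l)"
proof -
  have "e \<in> good (Suc l)" if e: "e \<in> F" for e
  proof -
    obtain a b where "a < b" "e = {a, b}" "b < top_vertex l" "q dvd (b - a - 1)" "1 < b - a"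
      using F e by (rule frozenE)
    then show ?thesis by (simp add: good_iff top_vertex_Suc)
  qed
  then show ?thesis using assms strut_good unfolding struts_def antitone_below_def by auto
qed

text \<open>The feet of struts lie in the link, so frozen diagonals do not hide them. Two struts are
  nested: for \<open>i < j\<close> the index \<open>q * i + d i\<close> is at most
  \<open>q * (i + 1)\<close>, so the feet do not go back, while the ends do not advance because the
  shifts do not increase.\<close>

lemma struts_noncrossing:
  assumes "antitone_below w d"
  shows "noncrossing (F \<union> struts l w d {..<fan_size w})"
proof -
  have 1: "\<not> crossing e {w ! (q * i + d i), top_vertex l + d i}" if eF: "e \<in> F" and i: "i < fan_size w" for e i
  proof -
    obtain a b where e: "a < b" "e = {a, b}" "b < top_vertex l" using F eF by (rule frozenE)
    have idx: "q * i + d i < length w" using index_lt i assms unfolding antitone_below_def by blast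
    then have "w ! (q * i + d i) < top_vertex l + d i" using link_lt trans_less_add1 by blast
    moreover have "\<not> (a < w ! (q * i + d i) \<and> w ! (q * i + d i) < b)"
      using link_in[OF idx] e eF unfolding link_set_def by blast
    ultimately show ?thesis using e by (auto simp: crossing_iff)
  qed
  have 2: "\<not> crossing {w ! (q * i + d i), top_vertex l + d i} {w ! (q * j + d j), top_vertex l + d j}"
    if ij: "i \<le> j" "j < fan_size w" for i j
  proof -
    have d: "d i \<le> q" "d j \<le> q" "d j \<le> d i"
      using ij assms le_neq_implies_less[of i j] unfolding antitone_below_def by fastforce+
    have idx: "q * i + d i < length w" "q * j + d j < length w" using index_lt ij d by auto
    have "q * i + d i \<le> q * j + d j"
      using strut_index_le[of i j "d i" "d j"] ij d by (cases "i = j") auto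
    then have "w ! (q * i + d i) \<le> w ! (q * j + d j)" using link_mono idx by blast
    moreover have "w ! (q * i + d i) < top_vertex l" "w ! (q * j + d j) < top_vertex l"
      using link_lt idx by auto
    ultimately show ?thesis using d by (subst crossing_iff) auto
  qed
  have 3: "\<not> crossing {w ! (q * i + d i), top_vertex l + d i} {w ! (q * j + d j), top_vertex l + d j}"
    if "i < fan_size w" "j < fan_size w" for i j
    using 2[of i j] 2[of j i] that crossing_commute by (metis nat_le_linear)
  have 4: "\<not> crossing e e'" if "e \<in> F" "e' \<in> F" for e e'
    using F that unfolding frozen_def noncrossing_def by blast
  show ?thesis
    unfolding noncrossing_def struts_def using 1 3 4 crossing_commute by auto
qed

lemma antitone_below_const: "c \<le> q \<Longrightarrow> antitone_below w (\<lambda>_. c)"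
  unfolding antitone_below_def by auto

lemma struts_0: "struts l w (\<lambda>_. 0) {..<fan_size w} = insert {0, top_vertex l} (fan_diagonals l w)"
proof -
  have "{..<fan_size w} = insert 0 {0<..<fan_size w}" using fan_size_pos by auto
  then show ?thesis unfolding struts_def fan_diagonals_def using link_0 by simp
qed

lemma base_notin: "{0, top_vertex l} \<notin> F \<union> fan_diagonals l w"
proof -
  have "{0, top_vertex l} \<noteq> {w ! (q * i), top_vertex l}" if "0 < i" "i < fan_size w" for i
  proof -
    have "0 < w ! (q * i)" using link_strict[of 0 "q * i"] link_0 index_lt[of i 0] that q_pos by simp
    then show ?thesis by (auto simp: doubleton_eq_iff top_vertex_def)
  qed
  moreover have "{0, top_vertex l} \<notin> F" using strut_notin_F[of 0 0] by simp
  ultimately show ?thesis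
    unfolding fan_diagonals_def Un_iff image_iff Bex_def greaterThanLessThan_iff by blast
qed

text \<open>The fan diagonals are the struts for the shifts \<open>0\<close>, apart from strut
  \<open>0\<close>, which is the side \<open>{0, top_vertex l}\<close>. So the facts on struts carry
  over.\<close>

lemma fan_dissection:
  shows "F \<union> fan_diagonals l w \<subseteq> good l" "noncrossing (F \<union> fan_diagonals l w)"
    "card (F \<union> fan_diagonals l w) + 1 = card F + fan_size w"
proof -
  have eq: "F \<union> struts l w (\<lambda>_. 0) {..<fan_size w} = insert {0, top_vertex l} (F \<union> fan_diagonals l w)"
    unfolding struts_0 by blast
  show "noncrossing (F \<union> fan_diagonals l w)"
    using struts_noncrossing[OF antitone_below_const[of 0]] noncrossing_mono unfolding eq by blast
  have "card F + fan_size w = card (insert {0, top_vertex l} (F \<union> fan_diagonals l w))"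
    using card_F_struts[OF antitone_below_const[of 0], of "{..<fan_size w}"] eq by simp
  also have "\<dots> = card (F \<union> fan_diagonals l w) + 1"
    using base_notin finite_F by (simp add: fan_diagonals_def)
  finally show "card (F \<union> fan_diagonals l w) + 1 = card F + fan_size w" by simp
  have "{w ! (q * i), top_vertex l} \<in> good l" if i: "0 < i" "i < fan_size w" for i
  proof -
    have *: "{w ! (q * i + 0), top_vertex l + 0} \<in> good (Suc l)" using strut_good[of i 0] i by simp
    have lt: "w ! (q * i) < top_vertex l" using link_lt index_lt[of i 0] i by simp
    have "0 < w ! (q * i)" using link_strict[of 0 "q * i"] link_0 index_lt[of i 0] i q_pos by simp
    then show ?thesis using * lt by (simp add: good_iff)
  qed
  then show "F \<union> fan_diagonals l w \<subseteq> good l" using F unfolding fan_diagonals_def frozen_def by auto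
qed

lemma fan_size_le: "card F + fan_size w \<le> l"
  using good_card_le[OF l fan_dissection(1,2)] fan_dissection(3) l by linarith

text \<open>
  A segment from the link to one of the vertices replacing the top vertex is admissible only if its
  two indices are congruent modulo \<open>q\<close>; it then is one of the struts.
\<close>

lemma strut_of_good:
  assumes e: "{x, y} \<in> good (Suc l)" and x: "x \<in> link_set l F" and y: "top_vertex l \<le> y"
  obtains i d where "i < fan_size w" "d \<le> q" "x = w ! (q * i + d)" "y = top_vertex l + d"
proof -
  obtain c where c: "c < length w" "x = w ! c" using x by (rule link_obtain)
  have lt: "x < top_vertex l" using link_lt c by simp
  then have "x < y" using y by simp
  then have g: "y \<le> top_vertex l + q" "q dvd (y - x - 1)" "1 < y - x" "\<not> (x = 0 \<and> y = top_vertex l + q)"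
    using e by (auto simp: good_iff top_vertex_Suc)
  define d where "d = y - top_vertex l"
  have d: "y = top_vertex l + d" "d \<le> q" unfolding d_def using y g(1) by auto
  obtain c' where c': "x = c + q * c'" using link_residue c by auto
  obtain u where u: "y - x - 1 = q * u" using g(2) by (auto simp: dvd_def)
  have sum: "q * l + d = c + q * (c' + u)"
    using u c' d(1) \<open>x < y\<close> unfolding top_vertex_def by (simp add: distrib_left)
  \<comment> \<open>Since \<open>c\<close> and \<open>d\<close> are congruent modulo
    \<open>q\<close> and \<open>d \<le> q\<close>, the alternative is \<open>d = q\<close> and
    \<open>c = 0\<close>: the segment would be the side from \<open>0\<close> to the new top
    vertex.\<close>
  have "d \<le> c"
  proof (rule ccontr)
    assume "\<not> d \<le> c"
    then have "d - c = q * (c' + u) - q * l" using sum by linarith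
    then have "d - c = q * (c' + u - l)" by (simp add: diff_mult_distrib2)
    moreover have "0 < d - c" "d - c \<le> q" using \<open>\<not> d \<le> c\<close> d(2) by auto
    ultimately have "c' + u - l = 1" using q_pos
      by (metis One_nat_def Suc_leI le_antisym mult.right_neutral mult_le_cancel1 mult_0_right not_gr_zero zero_less_one less_le_trans)
    then have "d - c = q" using \<open>d - c = q * (c' + u - l)\<close> by simp
    then have "d = q" "c = 0" using d(2) q_pos by auto
    then show False using g(4) c d(1) link_0 by simp
  qed
  then have "c - d = q * l - q * (c' + u)" using sum by linarith
  then have cd: "c = q * (l - (c' + u)) + d" using \<open>d \<le> c\<close> by (simp add: diff_mult_distrib2)
  define i where "i = l - (c' + u)"
  have "i < fan_size w"
  proof (rule ccontr)
    assume "\<not> i < fan_size w"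
    then have "q * fan_size w \<le> q * i" by (intro mult_le_mono) auto
    then have "c = q * fan_size w" "d = 0" using cd c(1) length_link unfolding i_def[symmetric] by linarith+
    then have "x = q * l" using c link_end by simp
    then show False using g(3) d(1) \<open>d = 0\<close> unfolding top_vertex_def by simp
  qed
  then show ?thesis using that d c cd unfolding i_def by auto
qed

end

text \<open>A diagonal outside \<open>F\<close> joins the link to a copy of the old top vertex, so
  it is a strut. Without crossings each index has at most one strut, and
  \<open>card F + fan_size w \<le> l\<close> by maximality; as \<open>D\<close> has \<open>l\<close>
  members, each index has exactly one.\<close>

lemma dissection_decompose:
  assumes D: "D \<in> full_dissections (Suc l)" and l: "1 \<le> l"
  obtains F d where "frozen l F" "F = {e \<in> D. e \<subseteq> {..<top_vertex l}}" "antitone_below (link l F) d"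
    "D = F \<union> struts l (link l F) d {..<fan_size (link l F)}" "card F + fan_size (link l F) = l"
proof -
  define F where "F = {e \<in> D. e \<subseteq> {..<top_vertex l}}"
  define w where "w = link l F"
  define strut where "strut i d = {w ! (q * i + d), top_vertex l + d}" for i d
  have D': "D \<subseteq> good (Suc l)" "noncrossing D" "card D = l" using D unfolding full_dissections_def by auto
  have F: "frozen l F"
    unfolding frozen_def
  proof (intro conjI ballI subsetI)
    fix e assume e: "e \<in> F"
    then have "e \<in> good (Suc l)" "e \<subseteq> {..<top_vertex l}" using D' unfolding F_def by auto
    then obtain a b where ab: "a < b" "e = {a, b}" "b \<le> top_vertex (Suc l)" "q dvd (b - a - 1)" "1 < b - a"
      by (elim goodE)
    then have "b < top_vertex l" using \<open>e \<subseteq> {..<top_vertex l}\<close> by auto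
    then show "e \<in> good l" using ab by (simp add: good_iff)
    show "top_vertex l \<notin> e" using \<open>e \<subseteq> {..<top_vertex l}\<close> by auto
  next
    show "noncrossing F" by (rule noncrossing_mono[OF D'(2)]) (simp add: F_def)
  qed
  note ctx = F l w_def
  let ?r = "fan_size w"
  have E: "\<exists>i d. i < ?r \<and> d \<le> q \<and> e = strut i d" if eD: "e \<in> D" and eF: "e \<notin> F" for e
  proof -
    obtain x y where xy: "x < y" "e = {x, y}" "y \<le> top_vertex (Suc l)" "q dvd (y - x - 1)" "1 < y - x"
      using subsetD[OF D'(1) eD] by (elim goodE)
    have y: "top_vertex l \<le> y"
    proof (rule ccontr)
      assume "\<not> top_vertex l \<le> y"
      then have "e \<subseteq> {..<top_vertex l}" using xy by auto
      then show False using eD eF unfolding F_def by blast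
    qed
    have x: "x < top_vertex l"
    proof (rule ccontr)
      assume "\<not> x < top_vertex l"
      then have "y - x - 1 < q" using xy(1,3) q_pos unfolding top_vertex_Suc by linarith
      then have "y - x - 1 = 0" using xy(4) by (meson dvd_imp_le not_less neq0_conv)
      then show False using xy(5) by simp
    qed
    have "\<not> (a < x \<and> x < b)" if "a < b" "{a, b} \<in> F" for a b
    proof
      assume h: "a < x \<and> x < b"
      have "b < y" using frozen_doubleton(1)[OF F that(2,1)] y by simp
      moreover have "{a, b} \<in> D" using that(2) unfolding F_def by blast
      ultimately show False using noncrossingD[OF D'(2), of a b x y] h eD xy(2) by blast
    qed
    then have "x \<in> link_set l F" using x unfolding link_set_def by blast
    moreover have "{x, y} \<in> good (Suc l)" using eD D'(1) xy(2) by blast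
    ultimately obtain i d where "i < ?r" "d \<le> q" "x = w ! (q * i + d)" "y = top_vertex l + d"
      using strut_of_good[OF ctx] y by metis
    then show ?thesis using xy(2) unfolding strut_def by blast
  qed
  \<comment> \<open>For \<open>i = j\<close> this gives uniqueness of the shift, for
    \<open>i < j\<close> its monotonicity.\<close>
  have uniq: "\<not> d < d'" if h: "strut i d \<in> D" "strut j d' \<in> D" "i \<le> j" "j < ?r" "d' \<le> q" for i j d d'
  proof
    assume "d < d'"
    then have "q * i + d < q * j + d'" using \<open>i \<le> j\<close> by (intro add_le_less_mono) simp_all
    moreover have idx: "q * j + d' < length w" using index_lt[OF ctx] h by simp
    ultimately have "w ! (q * i + d) < w ! (q * j + d')" using link_strict[OF ctx] by blast
    moreover have "w ! (q * j + d') < top_vertex l + d"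
      using link_lt[OF ctx idx] by simp
    ultimately show False
      using noncrossingD[OF D'(2)] h(1,2) \<open>d < d'\<close> unfolding strut_def by (meson add_strict_left_mono)
  qed
  define I where "I = {i. i < ?r \<and> (\<exists>d\<le>q. strut i d \<in> D)}"
  define d where "d i = (SOME d. d \<le> q \<and> strut i d \<in> D)" for i
  have d: "d i \<le> q" "strut i (d i) \<in> D" if "i \<in> I" for i
  proof -
    have "\<exists>d. d \<le> q \<and> strut i d \<in> D" using that unfolding I_def by blast
    from someI_ex[OF this] show "d i \<le> q" "strut i (d i) \<in> D" unfolding d_def by auto
  qed
  have sub: "D \<subseteq> F \<union> (\<lambda>i. strut i (d i)) ` I"
  proof
    fix e assume e: "e \<in> D"
    show "e \<in> F \<union> (\<lambda>i. strut i (d i)) ` I"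
    proof (cases "e \<in> F")
      case False
      then obtain i d' where id: "i < ?r" "d' \<le> q" "e = strut i d'" using E e by blast
      then have i: "i \<in> I" using e unfolding I_def by blast
      have "d' = d i"
        using uniq[of i d' i "d i"] uniq[of i "d i" i d'] d[OF i] id e by force
      then show ?thesis using i id by blast
    qed blast
  qed
  have finF: "finite F" using finite_F[OF ctx] .
  have finI: "finite I" "I \<subseteq> {..<?r}" unfolding I_def by auto
  have "l \<le> card (F \<union> (\<lambda>i. strut i (d i)) ` I)"
    using card_mono[OF _ sub] finF finI D'(3) by simp
  also have "\<dots> \<le> card F + card I"
    using card_Un_le[of F "(\<lambda>i. strut i (d i)) ` I"] card_image_le[OF finI(1), of "\<lambda>i. strut i (d i)"] by linarith
  finally have le: "l \<le> card F + card I" .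
  have "card I \<le> ?r" using card_mono[OF _ finI(2)] by simp
  then have *: "card F + ?r = l" "card I = ?r" using le fan_size_le[OF ctx] by linarith+
  then have I: "I = {..<?r}" using card_subset_eq[OF _ finI(2)] by simp
  have "D = F \<union> struts l w d {..<?r}"
    using sub d unfolding I struts_def strut_def F_def by blast
  moreover have "antitone_below w d"
    unfolding antitone_below_def
  proof (intro conjI allI impI)
    fix i assume "i < ?r" then show "d i \<le> q" using d I by blast
  next
    fix i j assume ij: "i < j" "j < ?r"
    then have "\<not> d i < d j" using uniq[of i "d i" j "d j"] d I by simp
    then show "d j \<le> d i" by simp
  qed
  ultimately show ?thesis using that[of F d] F F_def * unfolding w_def by blast
qed

section \<open>Frozen part, link and dissection of a child\<close>

context
  fixes l F w d m
  assumes F: "frozen l F" and l: "1 \<le> l" and w_def: "w = link l F"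
    and card_F: "card F + fan_size w = l" and d: "antitone_below w d"
    and m: "m \<le> fan_size w" "\<And>i. i < m \<Longrightarrow> d i = q" "\<And>i. m \<le> i \<Longrightarrow> i < fan_size w \<Longrightarrow> d i < q"
    and d_end: "d (fan_size w) = 0"
begin

lemmas ctx = F l w_def

abbreviation "F' \<equiv> child_frozen l F w d m"
abbreviation "w' \<equiv> child_link l w d m"

lemma child_subset: "F' \<subseteq> F \<union> struts l w d {..<fan_size w}"
  unfolding child_frozen_def struts_def by auto

text \<open>The assumption \<open>d_end\<close> sets the shift to \<open>0\<close> at the index
  \<open>fan_size w\<close>, where there is no strut. With this default the formulas for the child
  also cover \<open>m = fan_size w\<close>, where every strut reaches the new top vertex.\<close>

lemma child_d_m: "d m < q" "m = fan_size w \<Longrightarrow> d m = 0"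
  using m(1,3) d_end q_pos by (metis le_neq_implies_less le_refl less_le_trans zero_less_one, simp)

lemma child_length: "q * m + d m + 1 \<le> length w"
proof (cases "m = fan_size w")
  case True
  then show ?thesis using d_end length_link[OF ctx] by simp
next
  case False
  then have "q * m + d m < length w"
    using m(1) child_d_m(1) by (intro index_lt[OF ctx]) auto
  then show ?thesis by simp
qed

lemma child_is_frozen: "frozen (Suc l) F'"
  unfolding frozen_def
proof (intro conjI ballI)
  show "F' \<subseteq> good (Suc l)" using child_subset struts_good[OF ctx d] by blast
  show "noncrossing F'" using child_subset struts_noncrossing[OF ctx d] noncrossing_mono by blast
  fix e assume "e \<in> F'"
  then consider "e \<in> F" | i where "m \<le> i" "i < fan_size w" "e = {w ! (q * i + d i), top_vertex l + d i}"
    unfolding child_frozen_def struts_def by auto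
  then show "top_vertex (Suc l) \<notin> e"
  proof cases
    case 1
    then obtain a b where "a < b" "e = {a, b}" "b < top_vertex l" by (rule frozenE[OF F])
    then show ?thesis unfolding top_vertex_Suc by auto
  next
    case 2
    then have "d i < q" using m(3) by simp
    moreover have "w ! (q * i + d i) < top_vertex l"
      using link_lt[OF ctx] index_lt[OF ctx 2(2)] calculation by simp
    ultimately show ?thesis using 2 unfolding top_vertex_Suc by auto
  qed
qed

text \<open>If there is a strut \<open>m\<close>, it alone determines what is newly hidden: later
  struts are nested in it, and earlier ones are not frozen but belong to the fan of the
  child.\<close>

lemma child_link_set: "link_set (Suc l) F' = set w'"
proof -
  let ?c = "q * m + d m"
  have c: "?c < length w" using child_length by simp
  have set_take: "set (take (?c + 1) w) = {w ! j | j. j \<le> ?c}"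
  proof -
    have "set (take (?c + 1) w) = (!) w ` {0..<?c + 1}" using nth_image[of "?c + 1" w] c by simp
    also have "{0..<?c + 1} = {..?c}" by auto
    finally show ?thesis by blast
  qed
  have strut_m: "{w ! ?c, top_vertex l + d m} \<in> F'" if "m < fan_size w"
    using that unfolding child_frozen_def struts_def by auto
  have "x \<in> set w'" if x: "x \<in> link_set (Suc l) F'" for x
  proof -
    have x': "x < top_vertex l + q" "\<And>a b. a < b \<Longrightarrow> {a, b} \<in> F' \<Longrightarrow> \<not> (a < x \<and> x < b)"
      using x unfolding link_set_def top_vertex_Suc by auto
    have cm: "w ! ?c < top_vertex l + d m" using link_lt[OF ctx c] by simp
    show ?thesis
    proof (cases "x < top_vertex l")
      case True
      then have "x \<in> link_set l F" using x'(2) unfolding link_set_def child_frozen_def by blast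
      then obtain j where j: "j < length w" "x = w ! j" by (rule link_obtain[OF ctx])
      have "j \<le> ?c"
      proof (rule ccontr)
        assume "\<not> j \<le> ?c"
        then have "w ! ?c < x" using link_strict[OF ctx] j by simp
        moreover have "m < fan_size w"
        proof (rule ccontr)
          assume "\<not> m < fan_size w"
          then have "m = fan_size w" using m(1) by simp
          then show False using \<open>\<not> j \<le> ?c\<close> j(1) length_link[OF ctx] by simp
        qed
        ultimately show False using x'(2)[OF cm strut_m] True by simp
      qed
      then show ?thesis unfolding child_link_def set_append set_take using j by blast
    next
      case False
      have "top_vertex l + d m \<le> x"
      proof (cases "m < fan_size w")
        case True
        then show ?thesis using x'(2)[OF cm strut_m] False link_lt[OF ctx c] by linarith
      next
        case False
        then show ?thesis using child_d_m(2) m(1) \<open>\<not> x < top_vertex l\<close> by simp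
      qed
      then show ?thesis unfolding child_link_def using x'(1) by simp
    qed
  qed
  moreover have "x \<in> link_set (Suc l) F'" if x: "x \<in> set w'" for x
  proof -
    have x_cases: "(\<exists>j\<le>?c. x = w ! j) \<or> (top_vertex l + d m \<le> x \<and> x < top_vertex l + q)"
      using x unfolding child_link_def set_append set_take by auto
    have xF: "x \<in> link_set l F \<or> top_vertex l \<le> x"
      using x_cases link_in[OF ctx] c by (meson le_less_trans add_leD1)
    have lt: "x < top_vertex (Suc l)"
      using x_cases link_lt[OF ctx] c unfolding top_vertex_Suc by (meson le_less_trans trans_less_add1)
    have "\<not> (a < x \<and> x < b)" if ab: "a < b" "{a, b} \<in> F'" for a b
    proof (cases "{a, b} \<in> F")
      case True
      then show ?thesis
        using xF ab(1) frozen_doubleton(1)[OF F True ab(1)] unfolding link_set_def by auto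
    next
      case False
      then obtain i where i: "m \<le> i" "i < fan_size w" "{a, b} = {w ! (q * i + d i), top_vertex l + d i}"
        using ab(2) unfolding child_frozen_def struts_def by auto
      have di: "d i \<le> q" "d i \<le> d m"
        using d i m(3)[of i] le_neq_implies_less[OF i(1)] unfolding antitone_below_def by fastforce+
      have idx: "q * i + d i < length w" using index_lt[OF ctx i(2) di(1)] .
      then have "w ! (q * i + d i) < top_vertex l + d i" using link_lt[OF ctx] trans_less_add1 by blast
      then have ab_eq: "a = w ! (q * i + d i)" "b = top_vertex l + d i"
        using i(3) ab(1) doubleton_less_eq_iff by blast+
      have "?c \<le> q * i + d i"
        using strut_index_le[OF ctx, of m i "d m" "d i"] child_d_m(1) i(1) by (cases "m = i") auto
      then have "w ! j \<le> a" if "j \<le> ?c" for j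
        using link_mono[OF ctx, of j] idx that ab_eq by simp
      then show ?thesis using x_cases ab_eq di by fastforce
    qed
    then show ?thesis using lt unfolding link_set_def by blast
  qed
  ultimately show ?thesis by blast
qed

lemma sorted_child_link: "sorted_wrt (<) w'"
proof -
  have "sorted_wrt (<) (take (q * m + d m + 1) w)"
    using sorted_link unfolding w_def by (metis append_take_drop_id sorted_wrt_append)
  moreover have "x < top_vertex l" if "x \<in> set (take (q * m + d m + 1) w)" for x
    using that set_take_subset[of _ w] set_link[of l F] unfolding w_def link_set_def by blast
  ultimately show ?thesis unfolding child_link_def by (auto simp: sorted_wrt_append) (meson add_leD1 less_le_trans)
qed

lemma link_child: "link (Suc l) F' = w'"
  unfolding link_def child_link_set
  using sorted_child_link by (simp add: sorted_list_of_set_sort_remdups strict_sorted_iff sorted_sort_id)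

lemma length_child_link: "length w' = q * (m + 1) + 1"
  unfolding child_link_def using child_length child_d_m(1) by simp

lemma fan_size_child: "fan_size w' = m + 1"
  unfolding fan_size_def length_child_link using q_pos by simp

lemma card_child: "card F' + fan_size w' = Suc l"
proof -
  have "card F' = card F + (fan_size w - m)"
    unfolding child_frozen_def using card_F_struts[OF ctx d, of "{m..<fan_size w}"] by (simp add: subset_iff)
  then show ?thesis unfolding fan_size_child using card_F m(1) by simp
qed

text \<open>A strut with shift \<open>q\<close> has its foot at index
  \<open>q * i + q = q * Suc i\<close>, so strut \<open>i\<close> is the fan diagonal
  \<open>Suc i\<close> of the child.\<close>

lemma child_dissection:
  "F' \<union> fan_diagonals (Suc l) w' = F \<union> struts l w d {..<fan_size w}"
proof -
  have "fan_diagonals (Suc l) w' = struts l w d {..<m}"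
  proof -
    have "{0<..<m + 1} = Suc ` {..<m}" by (auto simp: image_iff Suc_le_eq gr0_conv_Suc)
    moreover have "w' ! (q * Suc i) = w ! (q * i + d i)" if "i < m" for i
    proof -
      have "q * Suc i \<le> q * m" using that by (intro mult_le_mono) auto
      then have "q * Suc i < length (take (q * m + d m + 1) w)" using child_length by simp
      then show ?thesis using that m(2) unfolding child_link_def by (simp add: nth_append algebra_simps)
    qed
    ultimately show ?thesis
      unfolding fan_diagonals_def fan_size_child struts_def top_vertex_Suc using m(2)
      by (simp add: image_image)
  qed
  moreover have "{..<fan_size w} = {..<m} \<union> {m..<fan_size w}" using m(1) by auto
  ultimately show ?thesis unfolding child_frozen_def struts_def by (simp add: image_Un Un_ac)
qed

end

end

section \<open>A Gray code for monotone sequences\<close>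

text \<open>
  The nonincreasing sequences of length \<open>p\<close> with entries in \<open>{lo..r}\<close>, by last entry. The parity
  alternates the direction in which the remaining entries are listed.
\<close>

fun monotone_code :: "nat \<Rightarrow> nat \<Rightarrow> nat \<Rightarrow> nat \<Rightarrow> nat list list" where
  "monotone_code b r 0 lo = [[]]"
| "monotone_code b r (Suc p) lo =
     concat (map (\<lambda>v. map (\<lambda>xs. xs @ [v]) (monotone_code b r p v))
       (if even (b + lo) then [lo..<Suc r] else rev [lo..<Suc r]))"

text \<open>
  The moving entry changes by one, away from the bound \<open>hd (suf @ [lo])\<close> or towards it. The
  entries before it are constant, either \<open>r\<close> throughout or equal to the moving entry.
\<close>

definition monotone_move :: "nat \<Rightarrow> nat \<Rightarrow> nat \<Rightarrow> nat list \<Rightarrow> nat list \<Rightarrow> bool" where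
  "monotone_move b r lo xs ys \<longleftrightarrow> (\<exists>p v v' suf.
     xs = replicate p (if even (b + v) then r else v) @ v # suf \<and>
     ys = replicate p (if even (b + v') then v' else r) @ v' # suf \<and>
     (if even (b + hd (suf @ [lo])) then v < r \<and> v' = Suc v else v = Suc v' \<and> hd (suf @ [lo]) \<le> v'))"

lemma last_concat_map: "vs \<noteq> [] \<Longrightarrow> f (last vs) \<noteq> [] \<Longrightarrow> last (concat (map f vs)) = last (f (last vs))"
  by (induction vs rule: rev_induct) auto

text \<open>The first and the last value of \<open>v\<close> are \<open>lo\<close> and
  \<open>r\<close> in some order. The inner code for \<open>v = lo\<close> has the direction of the
  outer one, and the inner code for \<open>v = r\<close> is a single constant sequence; hence both
  ends are constant.\<close>

lemma hd_last_monotone_code: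
  assumes "lo \<le> r"
  shows "monotone_code b r p lo \<noteq> [] \<and>
    hd (monotone_code b r p lo) = replicate p (if even (b + lo) then lo else r) \<and>
    last (monotone_code b r p lo) = replicate p (if even (b + lo) then r else lo)"
  using assms
proof (induction p arbitrary: lo)
  case (Suc p)
  define vs where "vs = (if even (b + lo) then [lo..<Suc r] else rev [lo..<Suc r])"
  define g where "g v = map (\<lambda>xs. xs @ [v]) (monotone_code b r p v)" for v
  have eq: "monotone_code b r (Suc p) lo = concat (map g vs)" unfolding vs_def g_def by simp
  have vs: "vs \<noteq> []" "set vs = {lo..r}" unfolding vs_def using Suc.prems by auto
  have hd_vs: "hd vs = (if even (b + lo) then lo else r)" "last vs = (if even (b + lo) then r else lo)"
    unfolding vs_def using Suc.prems by (auto simp: hd_rev last_rev simp del: upt_Suc)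
  have ne: "g v \<noteq> []" if "v \<in> set vs" for v using Suc.IH[of v] that vs unfolding g_def by auto
  have mem: "hd vs \<in> set vs" "last vs \<in> set vs" using vs by auto
  have "concat (map g vs) \<noteq> []" using ne mem by auto
  moreover have "hd (concat (map g vs)) = hd (g (hd vs))"
    using vs(1) ne mem by (simp add: hd_concat hd_map)
  moreover have "last (concat (map g vs)) = last (g (last vs))"
    using vs(1) ne mem by (intro last_concat_map) auto
  moreover have "hd (g (hd vs)) = replicate (Suc p) (if even (b + lo) then lo else r)"
    using Suc.IH[of "hd vs"] mem vs(2) unfolding g_def hd_vs
    by (auto simp: hd_map replicate_append_same split: if_splits)
  moreover have "last (g (last vs)) = replicate (Suc p) (if even (b + lo) then r else lo)"
    using Suc.IH[of "last vs"] mem vs(2) unfolding g_def hd_vs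
    by (auto simp: last_map replicate_append_same split: if_splits)
  ultimately show ?case unfolding eq by simp
qed simp

lemma set_monotone_code:
  "set (monotone_code b r p lo) = {xs. length xs = p \<and> sorted_wrt (\<ge>) xs \<and> set xs \<subseteq> {lo..r}}"
proof (induction p arbitrary: lo)
  case (Suc p)
  have "set (monotone_code b r (Suc p) lo) =
    {xs @ [v] | xs v. v \<in> {lo..r} \<and> length xs = p \<and> sorted_wrt (\<ge>) xs \<and> set xs \<subseteq> {v..r}}"
    using Suc.IH by auto
  also have "\<dots> = {xs. length xs = Suc p \<and> sorted_wrt (\<ge>) xs \<and> set xs \<subseteq> {lo..r}}" (is "?L = ?R")
  proof (intro set_eqI iffI)
    fix ys assume "ys \<in> ?R"
    then obtain xs v where "ys = xs @ [v]" "length xs = p"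
      by (auto simp: length_Suc_conv_rev)
    with \<open>ys \<in> ?R\<close> show "ys \<in> ?L" by (auto simp: sorted_wrt_append)
  qed (force simp: sorted_wrt_append)
  finally show ?case .
qed auto

lemma distinct_concat_map:
  assumes "distinct vs" "\<And>v. v \<in> set vs \<Longrightarrow> distinct (f v)"
    "\<And>v v' x. v \<in> set vs \<Longrightarrow> v' \<in> set vs \<Longrightarrow> x \<in> set (f v) \<Longrightarrow> x \<in> set (f v') \<Longrightarrow> v = v'"
  shows "distinct (concat (map f vs))"
  using assms
proof (induction vs)
  case (Cons v vs)
  have "distinct (concat (map f vs))" using Cons by auto
  moreover have "set (f v) \<inter> set (concat (map f vs)) = {}" using Cons.prems(1,3) by fastforce
  ultimately show ?case using Cons.prems(2) by simp
qed simp

lemma distinct_monotone_code: "distinct (monotone_code b r p lo)"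
proof (induction p arbitrary: lo)
  case (Suc p)
  have "distinct (map (\<lambda>xs. xs @ [v]) (monotone_code b r p v))" for v
    using Suc.IH by (simp add: distinct_map inj_on_def)
  then show ?case by (simp only: monotone_code.simps) (rule distinct_concat_map; auto)
qed simp

text \<open>Each value of the last entry contributes at least one sequence.\<close>

lemma length_monotone_code: "r + 1 - lo \<le> length (monotone_code b r (Suc p) lo)"
proof -
  define vs where "vs = (if even (b + lo) then [lo..<Suc r] else rev [lo..<Suc r])"
  have len: "length us \<le> length (concat (map g us))" if "\<And>v. v \<in> set us \<Longrightarrow> g v \<noteq> []"
    for us and g :: "nat \<Rightarrow> nat list list"
    using that
  proof (induction us)
    case (Cons u us)
    have "length us \<le> length (concat (map g us))" using Cons by simp
    moreover have "1 \<le> length (g u)" using Cons.prems[of u] by (cases "g u") auto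
    ultimately show ?case by simp
  qed simp
  have "v \<le> r" if "v \<in> set vs" for v using that unfolding vs_def by (auto split: if_splits)
  then have "length vs \<le> length (concat (map (\<lambda>v. map (\<lambda>xs. xs @ [v]) (monotone_code b r p v)) vs))"
    using hd_last_monotone_code by (intro len) simp
  moreover have "length vs = r + 1 - lo" unfolding vs_def by auto
  ultimately show ?thesis unfolding vs_def by simp
qed

lemma successively_concat_map:
  assumes "\<And>v. v \<in> set vs \<Longrightarrow> f v \<noteq> [] \<and> successively P (f v)"
    "successively (\<lambda>v v'. P (last (f v)) (hd (f v'))) vs"
  shows "successively P (concat (map f vs))"
  using assms
proof (induction vs)
  case (Cons v vs)
  show ?case
  proof (cases vs)
    case Nil
    then show ?thesis using Cons.prems by simp
  next
    case (Cons v' vs')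
    then have "concat (map f vs) \<noteq> []" "hd (concat (map f vs)) = hd (f v')"
      using Cons.prems(1)[of v'] by auto
    moreover have "successively P (concat (map f vs))" "P (last (f v)) (hd (f v'))"
      using Cons.IH Cons.prems Cons by auto
    ultimately show ?thesis using Cons.prems(1)[of v] by (simp add: successively_append_iff)
  qed
qed simp

lemma successively_upt: "successively (\<lambda>v v'. v' = Suc v \<and> v < r) [lo..<Suc r]"
  unfolding successively_conv_nth by (auto simp: nth_append)

lemma successively_rev_upt: "successively (\<lambda>v v'. v = Suc v' \<and> lo \<le> v') (rev [lo..<Suc r])"
  unfolding successively_rev unfolding successively_conv_nth by (auto simp del: upt_Suc)

text \<open>Within a block the last entry is fixed and the moves are those of the inner code.
  Between blocks the last entry changes by one and hence in parity: the prefix is all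
  \<open>r\<close> on both sides of the border, or equal to the last entry on both sides.\<close>

lemma successively_monotone_code: "lo \<le> r \<Longrightarrow> successively (monotone_move b r lo) (monotone_code b r p lo)"
proof (induction p arbitrary: lo)
  case (Suc p)
  define g where "g v = map (\<lambda>xs. xs @ [v]) (monotone_code b r p v)" for v
  define vs where "vs = (if even (b + lo) then [lo..<Suc r] else rev [lo..<Suc r])"
  have vs: "set vs = {lo..r}" unfolding vs_def by auto
  have "successively (monotone_move b r lo) (concat (map g vs))"
  proof (rule successively_concat_map)
    fix v assume "v \<in> set vs"
    then have v: "lo \<le> v" "v \<le> r" using vs by auto
    have extend: "monotone_move b r lo (xs @ [v]) (ys @ [v])" if move: "monotone_move b r v xs ys" for xs ys
    proof -
      obtain p u u' suf where *: "xs = replicate p (if even (b + u) then r else u) @ u # suf"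
        "ys = replicate p (if even (b + u') then u' else r) @ u' # suf"
        "if even (b + hd (suf @ [v])) then u < r \<and> u' = Suc u else u = Suc u' \<and> hd (suf @ [v]) \<le> u'"
        using move unfolding monotone_move_def by (elim exE conjE) (rule that)
      \<comment> \<open>The bound of a moving entry is its right neighbour; \<open>lo\<close> is the
        default for the last entry only.\<close>
      have "hd ((suf @ [v]) @ [lo]) = hd (suf @ [v])" by (simp add: hd_append)
      with *(3) show ?thesis unfolding monotone_move_def
        by (intro exI[of _ p] exI[of _ u] exI[of _ u'] exI[of _ "suf @ [v]"] conjI)
          (simp_all only: *(1,2) append_assoc append_Cons)
    qed
    have "successively (monotone_move b r lo) (g v)"
      unfolding g_def successively_map by (rule successively_mono[OF Suc.IH[OF v(2)]]) (rule extend)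
    then show "g v \<noteq> [] \<and> successively (monotone_move b r lo) (g v)"
      using hd_last_monotone_code[OF v(2)] unfolding g_def by simp
  next
    have link: "monotone_move b r lo (last (g v)) (hd (g v'))"
      if "v \<le> r" "v' \<le> r" "if even (b + lo) then v < r \<and> v' = Suc v else v = Suc v' \<and> lo \<le> v'" for v v'
    proof -
      have "last (g v) = replicate p (if even (b + v) then r else v) @ [v]"
        "hd (g v') = replicate p (if even (b + v') then v' else r) @ [v']"
        using hd_last_monotone_code[OF that(1), of b p] hd_last_monotone_code[OF that(2), of b p]
        unfolding g_def by (simp_all add: last_map hd_map)
      then show ?thesis unfolding monotone_move_def using that(3)
        by (intro exI[of _ p] exI[of _ v] exI[of _ v'] exI[of _ "[]"] conjI) simp_all
    qed
    show "successively (\<lambda>v v'. monotone_move b r lo (last (g v)) (hd (g v'))) vs"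
    proof (cases "even (b + lo)")
      case True
      have "successively (\<lambda>v v'. v' = Suc v \<and> v < r) vs" unfolding vs_def using True successively_upt by simp
      then show ?thesis
        by (rule successively_mono) (use True vs link in auto)
    next
      case False
      have "successively (\<lambda>v v'. v = Suc v' \<and> lo \<le> v') vs" unfolding vs_def using False successively_rev_upt by simp
      then show ?thesis
        by (rule successively_mono) (use False vs link in auto)
    qed
  qed
  then show ?case unfolding g_def vs_def by simp
qed simp

section \<open>From sequences to the shifts of struts\<close>

definition count_above :: "nat list \<Rightarrow> nat \<Rightarrow> nat" where
  "count_above f i = length (filter (\<lambda>x. i < x) f)"

lemma count_above_simps [simp]:
  "count_above [] i = 0"
  "count_above (x # f) i = (if i < x then 1 else 0) + count_above f i"
  "count_above (f @ f') i = count_above f i + count_above f' i"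
  "count_above (replicate p c) i = (if i < c then p else 0)"
  unfolding count_above_def by (auto simp: filter_replicate)

lemma count_above_le: "count_above f i \<le> length f"
  unfolding count_above_def by simp

lemma count_above_antimono: "i \<le> j \<Longrightarrow> count_above f j \<le> count_above f i"
  by (induction f) auto

text \<open>The rule for conjugate partitions, on which \<open>code_of_antitone\<close> and
  \<open>code_eqI\<close> rest.\<close>

lemma less_count_above_iff:
  assumes "sorted_wrt (\<ge>) f" "t < length f"
  shows "t < count_above f i \<longleftrightarrow> i < f ! t"
  using assms
proof (induction f arbitrary: t)
  case (Cons x f)
  have "count_above f i = 0" if "\<not> i < x"
    using Cons.prems(1) that unfolding count_above_def by (force simp: filter_empty_conv)
  then show ?case using Cons by (cases t) auto
qed simp

text \<open>The prefix is all \<open>r\<close> before and after, or it changes together with the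
  moving entry. Either way the only threshold that entries pass is \<open>min v v'\<close>, so a
  single shift changes.\<close>

lemma monotone_move_count_above:
  assumes "monotone_move b r 0 f f'" "set f \<subseteq> {..r}"
  obtains i where "i < r" "count_above f i \<noteq> count_above f' i" "\<And>j. j \<noteq> i \<Longrightarrow> count_above f j = count_above f' j"
proof -
  obtain p v v' suf where f: "f = replicate p (if even (b + v) then r else v) @ v # suf"
    "f' = replicate p (if even (b + v') then v' else r) @ v' # suf"
    "if even (b + hd (suf @ [0])) then v < r \<and> v' = Suc v else v = Suc v' \<and> hd (suf @ [0]) \<le> v'"
    using assms(1) unfolding monotone_move_def by (elim exE conjE) (rule that)
  have "v \<le> r" using assms(2) f(1) by auto
  then have c: "v' = Suc v \<and> v < r \<or> v = Suc v' \<and> v' < r" using f(3) by (auto split: if_splits)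
  show ?thesis
  proof (rule that[of "min v v'"])
    show "min v v' < r" using c by auto
    show "count_above f (min v v') \<noteq> count_above f' (min v v')" using c unfolding f by auto
    show "count_above f j = count_above f' j" if "j \<noteq> min v v'" for j using c that unfolding f by auto
  qed
qed

section \<open>The tree of dissections\<close>

text \<open>
  A dissection is represented by the list of its diagonals avoiding the top vertex and by the
  vertices that the top vertex sees.
\<close>

type_synonym node = "(nat \<times> nat) list \<times> nat list"

definition pairs :: "(nat \<times> nat) list \<Rightarrow> nat set set" where
  "pairs ps = (\<lambda>(a, b). {a, b}) ` set ps"

text \<open>A flip without reference to cells. In this form it survives the relabelling of vertices
  and the insertion of an ear; \<open>flip_exchange\<close> turns it into a flip at the very
  end.\<close>

definition exchange :: "nat set set \<Rightarrow> nat set set \<Rightarrow> bool" where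
  "exchange D D' \<longleftrightarrow> (\<exists>d\<in>D. \<exists>d'. d' \<notin> D \<and> D' = insert d' (D - {d}))"

context dissecting
begin

definition bounded_code :: "nat \<Rightarrow> nat list \<Rightarrow> bool" where
  "bounded_code r f \<longleftrightarrow> length f = q \<and> sorted_wrt (\<ge>) f \<and> set f \<subseteq> {0..r}"

lemma bounded_code_iff: "bounded_code r f \<longleftrightarrow> f \<in> set (monotone_code b r q 0)"
  unfolding bounded_code_def set_monotone_code by simp

definition strut_pair :: "nat \<Rightarrow> nat list \<Rightarrow> nat list \<Rightarrow> nat \<Rightarrow> nat \<times> nat" where
  "strut_pair l w f i = (w ! (q * i + count_above f i), top_vertex l + count_above f i)"

text \<open>The struts are listed in reverse so that strut \<open>i\<close> has position
  \<open>l - 1 - i\<close>, whatever \<open>last f\<close> is. The positions behind the list are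
  those of the fan, which changes from level to level.\<close>

definition child :: "nat \<Rightarrow> node \<Rightarrow> nat list \<Rightarrow> node" where
  "child l nd f =
     (fst nd @ map (strut_pair l (snd nd) f) (rev [last f..<fan_size (snd nd)]),
      child_link l (snd nd) (count_above f) (last f))"

definition node_ok :: "nat \<Rightarrow> node \<Rightarrow> bool" where
  "node_ok l nd \<longleftrightarrow> frozen l (pairs (fst nd)) \<and> snd nd = link l (pairs (fst nd)) \<and>
     card (pairs (fst nd)) + fan_size (snd nd) = l \<and> length (fst nd) = card (pairs (fst nd))"

definition dissection_of :: "nat \<Rightarrow> node \<Rightarrow> nat set set" where
  "dissection_of l nd = pairs (fst nd) \<union> fan_diagonals l (snd nd)"

text \<open>All \<open>q\<close> entries exceed \<open>i\<close> iff the least entry does. Therefore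
  \<open>last f\<close> is the number \<open>m\<close> of struts with shift
  \<open>q\<close>.\<close>

lemma bounded_code_above:
  assumes "bounded_code (fan_size w) f"
  shows "antitone_below w (count_above f)" "last f \<le> fan_size w"
    "\<And>i. i < last f \<Longrightarrow> count_above f i = q" "\<And>i. last f \<le> i \<Longrightarrow> count_above f i < q"
    "\<And>i. fan_size w \<le> i \<Longrightarrow> count_above f i = 0"
proof -
  have f: "length f = q" "sorted_wrt (\<ge>) f" "set f \<subseteq> {0..fan_size w}"
    using assms unfolding bounded_code_def by auto
  have ne: "f \<noteq> []" using f(1) q_pos by auto
  show "antitone_below w (count_above f)"
    unfolding antitone_below_def using f(1) count_above_le[of f] count_above_antimono by auto
  show "last f \<le> fan_size w" using f(3) last_in_set[OF ne] by auto
  have iff: "q - 1 < count_above f i \<longleftrightarrow> i < last f" for i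
    using less_count_above_iff[OF f(2), of "q - 1" i] f(1) q_pos ne by (simp add: last_conv_nth)
  show "count_above f i = q" if "i < last f" for i
    using iff[of i] that count_above_le[of f i] f(1) by simp
  show "count_above f i < q" if "last f \<le> i" for i
    using iff[of i] that q_pos by linarith
  show "count_above f i = 0" if "fan_size w \<le> i" for i
    unfolding count_above_def using f(3) that by (force simp: filter_empty_conv)
qed

lemma pairs_append: "pairs (xs @ ys) = pairs xs \<union> pairs ys"
  unfolding pairs_def by (simp add: image_Un)

lemma pairs_struts: "pairs (map (strut_pair l w f) (rev [m..<r])) = struts l w (count_above f) {m..<r}"
  unfolding pairs_def struts_def strut_pair_def by (auto simp: image_image)

lemma child_ok:
  assumes nd: "node_ok l nd" and l: "1 \<le> l" and f: "bounded_code (fan_size (snd nd)) f"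
  shows "node_ok (Suc l) (child l nd f)"
    "dissection_of (Suc l) (child l nd f) =
       pairs (fst nd) \<union> struts l (snd nd) (count_above f) {..<fan_size (snd nd)}"
    "fan_size (snd (child l nd f)) = last f + 1"
proof -
  let ?F = "pairs (fst nd)" and ?w = "snd nd" and ?d = "count_above f" and ?m = "last f"
  have F: "frozen l ?F" "?w = link l ?F" "card ?F + fan_size ?w = l" "length (fst nd) = card ?F"
    using nd unfolding node_ok_def by auto
  note c = bounded_code_above[OF f]
  note ctx = F(1) l F(2) F(3) c(1) c(2) c(3) c(4) c(5)[OF order_refl]
  have fst_child: "pairs (fst (child l nd f)) = child_frozen l ?F ?w ?d ?m"
    unfolding child_def child_frozen_def by (simp add: pairs_append pairs_struts)
  have snd_child: "snd (child l nd f) = child_link l ?w ?d ?m" unfolding child_def by simp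
  have 1: "frozen (Suc l) (child_frozen l ?F ?w ?d ?m)" by (rule child_is_frozen[OF ctx])
  have 2: "link (Suc l) (child_frozen l ?F ?w ?d ?m) = child_link l ?w ?d ?m" by (rule link_child[OF ctx])
  have 3: "card (child_frozen l ?F ?w ?d ?m) + fan_size (child_link l ?w ?d ?m) = Suc l"
    by (rule card_child[OF ctx])
  have 4: "fan_size (child_link l ?w ?d ?m) = ?m + 1" by (rule fan_size_child[OF ctx])
  have "length (fst (child l nd f)) + ?m = l" unfolding child_def using F(3,4) c(2) by simp
  then have "length (fst (child l nd f)) = card (child_frozen l ?F ?w ?d ?m)" using 3 4 by simp
  then show "node_ok (Suc l) (child l nd f)" unfolding node_ok_def fst_child snd_child using 1 2 3 by simp
  show "dissection_of (Suc l) (child l nd f) = ?F \<union> struts l ?w ?d {..<fan_size ?w}"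
    unfolding dissection_of_def fst_child snd_child by (rule child_dissection[OF ctx])
  show "fan_size (snd (child l nd f)) = ?m + 1" unfolding snd_child by (rule 4)
qed

lemma node_ctx:
  assumes "node_ok l nd"
  shows "frozen l (pairs (fst nd))" "snd nd = link l (pairs (fst nd))"
    "card (pairs (fst nd)) + fan_size (snd nd) = l"
  using assms unfolding node_ok_def by auto

lemma dissection_of_full:
  assumes "node_ok l nd" "1 \<le> l"
  shows "dissection_of l nd \<in> full_dissections l"
  using fan_dissection[OF node_ctx(1)[OF assms(1)] assms(2) node_ctx(2)[OF assms(1)]] node_ctx(3)[OF assms(1)]
  unfolding dissection_of_def full_dissections_def by auto

text \<open>Only one shift changes, and different pairs of index and shift give different
  struts.\<close>

lemma exchange_child:
  assumes nd: "node_ok l nd" and l: "1 \<le> l" and f: "bounded_code (fan_size (snd nd)) f"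
    "bounded_code (fan_size (snd nd)) f'" and move: "monotone_move b (fan_size (snd nd)) 0 f f'"
  shows "exchange (dissection_of (Suc l) (child l nd f)) (dissection_of (Suc l) (child l nd f'))"
proof -
  let ?F = "pairs (fst nd)" and ?w = "snd nd" and ?r = "fan_size (snd nd)"
  note ctx = node_ctx(1)[OF nd] l node_ctx(2)[OF nd]
  define strut where "strut i d = {?w ! (q * i + d), top_vertex l + d}" for i d
  have "set f \<subseteq> {..?r}" using f(1) unfolding bounded_code_def by auto
  then obtain i where i: "i < ?r" "count_above f i \<noteq> count_above f' i"
    "\<And>j. j \<noteq> i \<Longrightarrow> count_above f j = count_above f' j"
    by (rule monotone_move_count_above[OF move]) blast
  have le: "count_above f j \<le> q" "count_above f' j \<le> q" for j
    using f count_above_le unfolding bounded_code_def by metis+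
  have eq_iff: "strut i d = strut j d' \<longleftrightarrow> i = j \<and> d = d'"
    if "i < ?r" "j < ?r" "d \<le> q" "d' \<le> q" for i j d d'
    unfolding strut_def using strut_eq_iff[OF ctx that] .
  have notF: "strut i d \<notin> ?F" for i d unfolding strut_def by (rule strut_notin_F[OF ctx])
  have D: "dissection_of (Suc l) (child l nd g) = ?F \<union> (\<lambda>j. strut j (count_above g j)) ` {..<?r}"
    if "bounded_code ?r g" for g
    using child_ok(2)[OF nd l that] unfolding struts_def strut_def .
  let ?e = "strut i (count_above f i)" and ?e' = "strut i (count_above f' i)"
  have split: "{..<?r} = insert i ({..<?r} - {i})" using i(1) by auto
  have rest: "(\<lambda>j. strut j (count_above f j)) ` ({..<?r} - {i}) = (\<lambda>j. strut j (count_above f' j)) ` ({..<?r} - {i})"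
    using i(3) by (intro image_cong) auto
  define R where "R = (\<lambda>j. strut j (count_above f j)) ` ({..<?r} - {i})"
  have "?e \<notin> R" unfolding R_def using eq_iff i(1) le by auto
  moreover have "?e' \<notin> R" unfolding R_def using eq_iff i(1) le by auto
  moreover have "?e \<noteq> ?e'" using eq_iff[OF i(1) i(1) le(1) le(2)] i(2) by blast
  moreover have "dissection_of (Suc l) (child l nd f) = insert ?e (?F \<union> R)"
    unfolding D[OF f(1)] R_def by (subst split) blast
  moreover have "dissection_of (Suc l) (child l nd f') = insert ?e' (?F \<union> R)"
    unfolding D[OF f(2)] R_def rest by (subst split) blast
  ultimately show ?thesis unfolding exchange_def using notF by (intro bexI[of _ ?e] exI[of _ ?e']) auto
qed

section \<open>Ears and the transport of exchanges\<close>

definition relabel :: "nat \<Rightarrow> nat set set \<Rightarrow> nat set set" where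
  "relabel l D = (`) (\<lambda>x. if x = top_vertex l then top_vertex l + q else x) ` D"

text \<open>The two extreme ways to split the top vertex cut off an ear.\<close>

definition add_ear :: "nat \<Rightarrow> nat \<Rightarrow> nat set set \<Rightarrow> nat set set" where
  "add_ear l b D = (if b = 0 then insert {0, top_vertex l} D
     else insert {top_vertex l - 1, top_vertex l + q} (relabel l D))"

lemma bounded_code_extreme: "bounded_code r (replicate q (if b = 0 then 0 else r))"
  unfolding bounded_code_def by (auto simp: sorted_wrt_iff_nth_less)

text \<open>With shifts \<open>0\<close> the struts are the old fan and the side
  \<open>{0, top_vertex l}\<close>. With shifts \<open>q\<close> strut \<open>i\<close> takes over
  the foot of the fan diagonal \<open>i + 1\<close>, and the last strut starts at the last link
  vertex \<open>top_vertex l - 1\<close>; so the fan is relabelled and an ear is cut off at the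
  other side.\<close>

lemma child_extreme:
  assumes nd: "node_ok l nd" and l: "1 \<le> l"
  shows "dissection_of (Suc l) (child l nd (replicate q (if b = 0 then 0 else fan_size (snd nd)))) =
    add_ear l b (dissection_of l nd)"
proof -
  let ?F = "pairs (fst nd)" and ?w = "snd nd" and ?r = "fan_size (snd nd)"
  note ctx = node_ctx(1)[OF nd] l node_ctx(2)[OF nd]
  have D: "dissection_of (Suc l) (child l nd (replicate q (if b = 0 then 0 else ?r))) =
     ?F \<union> struts l ?w (count_above (replicate q (if b = 0 then 0 else ?r))) {..<?r}"
    by (rule child_ok(2)[OF nd l bounded_code_extreme])
  show ?thesis
  proof (cases "b = 0")
    case True
    then have "count_above (replicate q (if b = 0 then 0 else ?r)) = (\<lambda>_. 0)" by auto
    then show ?thesis unfolding D using True struts_0[OF ctx] by (simp add: add_ear_def dissection_of_def)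
  next
    case False
    have "struts l ?w (count_above (replicate q (if b = 0 then 0 else ?r))) {..<?r} =
        (\<lambda>i. {?w ! (q * Suc i), top_vertex l + q}) ` {..<?r}"
      unfolding struts_def using False by (intro image_cong) (auto simp: add.commute)
    also have "\<dots> = (\<lambda>i. {?w ! (q * i), top_vertex l + q}) ` (Suc ` {..<?r})" by (simp add: image_image)
    also have "Suc ` {..<?r} = insert ?r {0<..<?r}"
      using fan_size_pos[OF ctx] by (auto simp: image_iff gr0_conv_Suc less_Suc_eq_le Suc_le_eq intro: le_neq_implies_less)
    also have "(\<lambda>i. {?w ! (q * i), top_vertex l + q}) ` insert ?r {0<..<?r} =
        insert {top_vertex l - 1, top_vertex l + q} ((\<lambda>i. {?w ! (q * i), top_vertex l + q}) ` {0<..<?r})"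
      using link_end[OF ctx] unfolding top_vertex_def by simp
    also have "(\<lambda>i. {?w ! (q * i), top_vertex l + q}) ` {0<..<?r} = relabel l (fan_diagonals l ?w)"
    proof -
      have "?w ! (q * i) \<noteq> top_vertex l" if "0 < i" "i < ?r" for i
        using link_lt[OF ctx, of "q * i"] index_lt[OF ctx that(2), of 0] by auto
      then show ?thesis unfolding relabel_def fan_diagonals_def image_image by (intro image_cong) auto
    qed
    finally have *: "struts l ?w (count_above (replicate q (if b = 0 then 0 else ?r))) {..<?r} =
        insert {top_vertex l - 1, top_vertex l + q} (relabel l (fan_diagonals l ?w))" .
    have "(\<lambda>x. if x = top_vertex l then top_vertex l + q else x) ` e = e" if "e \<in> ?F" for e
      using ctx(1) that unfolding frozen_def by (force simp: image_iff)
    then have "relabel l ?F = ?F" unfolding relabel_def by simp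
    then show ?thesis unfolding D * using False by (simp add: add_ear_def dissection_of_def relabel_def image_Un)
  qed
qed

lemma exchange_insert:
  assumes "exchange D D'" "c \<notin> D" "c \<notin> D'"
  shows "exchange (insert c D) (insert c D')"
proof -
  obtain d d' where *: "d \<in> D" "d' \<notin> D" "D' = insert d' (D - {d})" using assms(1) unfolding exchange_def by blast
  then have "d \<noteq> c" "d' \<noteq> c" using assms(2,3) by auto
  then have "insert c D' = insert d' (insert c D - {d})" "d' \<notin> insert c D" using * by auto
  then show ?thesis unfolding exchange_def using *(1) by blast
qed

lemma exchange_image:
  assumes "exchange D D'" "inj_on g S" "D \<subseteq> S" "D' \<subseteq> S"
  shows "exchange (g ` D) (g ` D')"
proof -
  obtain d d' where *: "d \<in> D" "d' \<notin> D" "D' = insert d' (D - {d})" using assms(1) unfolding exchange_def by blast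
  have "g ` D' = insert (g d') (g ` D - {g d})"
    using inj_on_image_set_diff[OF assms(2), of D "{d}"] * assms(3) by auto
  moreover have "g d' \<notin> g ` D" using assms * by (auto simp: inj_on_def)
  ultimately show ?thesis unfolding exchange_def using *(1) by blast
qed

lemma good_subset: "e \<in> good l \<Longrightarrow> e \<subseteq> {..top_vertex l}"
  by (auto elim!: goodE)

lemma add_ear_good:
  assumes "D \<subseteq> good l" "1 \<le> l"
  shows "add_ear l b D \<subseteq> good (Suc l)"
proof -
  have ql: "0 < q * l" using q_pos assms(2) by simp
  have "{0, top_vertex l} \<in> good (Suc l)"
    using ql q_pos by (subst good_iff) (auto simp: top_vertex_def)
  moreover have "{top_vertex l - 1, top_vertex l + q} \<in> good (Suc l)"
    using ql q_pos by (subst good_iff) (auto simp: top_vertex_def)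
  moreover have "e \<in> good (Suc l)" if eD: "e \<in> D" for e
  proof -
    obtain a b where "a < b" "e = {a, b}" "b \<le> top_vertex l" "q dvd (b - a - 1)" "1 < b - a"
      using subsetD[OF assms(1) eD] by (elim goodE)
    then show ?thesis using q_pos by (auto simp: good_iff top_vertex_Suc)
  qed
  moreover have "(\<lambda>x. if x = top_vertex l then top_vertex l + q else x) ` e \<in> good (Suc l)" if eD: "e \<in> D" for e
  proof -
    obtain a b where ab: "a < b" "e = {a, b}" "b \<le> top_vertex l" "q dvd (b - a - 1)" "1 < b - a"
      "\<not> (a = 0 \<and> b = top_vertex l)"
      using subsetD[OF assms(1) eD] by (elim goodE)
    show ?thesis
    proof (cases "b = top_vertex l")
      case True
      then have "top_vertex l + q - a - 1 = (b - a - 1) + q" using ab(1) by simp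
      then have "q dvd (top_vertex l + q - a - 1)" using ab(4) by simp
      then show ?thesis using ab True by (auto simp: good_iff top_vertex_Suc)
    next
      case False
      then show ?thesis using ab by (auto simp: good_iff top_vertex_Suc)
    qed
  qed
  ultimately show ?thesis unfolding add_ear_def relabel_def by auto
qed

text \<open>Up to relabelling, the ear diagonal is a side of the old polygon, so it was not in
  \<open>D\<close> or \<open>D'\<close>. Relabelling is injective on the old vertices.\<close>

lemma exchange_add_ear:
  assumes "exchange D D'" "D \<subseteq> good l" "D' \<subseteq> good l" "1 \<le> l"
  shows "exchange (add_ear l b D) (add_ear l b D')"
proof (cases "b = 0")
  case True
  have "{0, top_vertex l} \<notin> good l" by (subst good_iff) (auto simp: top_vertex_def)
  then have "{0, top_vertex l} \<notin> D" "{0, top_vertex l} \<notin> D'" using assms(2,3) by blast+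
  then show ?thesis using True exchange_insert[OF assms(1)] unfolding add_ear_def by simp
next
  case False
  define g where "g = (\<lambda>x. if x = top_vertex l then top_vertex l + q else x)"
  have inj: "inj_on g {..top_vertex l}" unfolding g_def inj_on_def using q_pos by auto
  then have inj': "inj_on ((`) g) (Pow {..top_vertex l})" by (rule inj_on_image_Pow)
  have sub: "D \<subseteq> Pow {..top_vertex l}" "D' \<subseteq> Pow {..top_vertex l}" using assms(2,3) good_subset by blast+
  have "{top_vertex l - 1, top_vertex l + q} \<notin> (`) g ` E" if E: "E \<subseteq> good l" for E
  proof
    assume "{top_vertex l - 1, top_vertex l + q} \<in> (`) g ` E"
    then obtain e where e: "e \<in> E" "g ` e = {top_vertex l - 1, top_vertex l + q}" by blast
    have "{top_vertex l - 1, top_vertex l + q} = g ` {top_vertex l - 1, top_vertex l}"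
      unfolding g_def top_vertex_def by auto
    then have "e = {top_vertex l - 1, top_vertex l}"
      using inj_onD[OF inj', of e "{top_vertex l - 1, top_vertex l}"] e E good_subset by auto
    then have "{top_vertex l - 1, top_vertex l} \<in> good l" using e E by auto
    then show False by (subst (asm) good_iff) (auto simp: top_vertex_def)
  qed
  then show ?thesis
    using exchange_insert[OF exchange_image[OF assms(1) inj' sub]] assms False
    unfolding add_ear_def relabel_def g_def[symmetric] by simp
qed

fun add_ears :: "nat \<Rightarrow> nat set set \<Rightarrow> nat list \<Rightarrow> nat set set" where
  "add_ears l D [] = D"
| "add_ears l D (b # bs) = add_ears (Suc l) (add_ear l b D) bs"

lemma exchange_add_ears:
  assumes "exchange D D'" "D \<subseteq> good l" "D' \<subseteq> good l" "1 \<le> l"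
  shows "exchange (add_ears l D bs) (add_ears l D' bs)"
  using assms
proof (induction bs arbitrary: l D D')
  case (Cons b bs)
  then show ?case using exchange_add_ear add_ear_good by simp
qed simp

section \<open>Zigzagging through the tree\<close>

fun zigzags :: "(node \<Rightarrow> nat list \<Rightarrow> node list \<times> nat list) \<Rightarrow> node list \<Rightarrow> nat list \<Rightarrow> node list \<times> nat list"
  where
  "zigzags g [] bs = ([], bs)"
| "zigzags g (x # xs) bs =
     (let (us, bs') = g x bs; (vs, bs'') = zigzags g xs bs' in (us @ vs, bs''))"

text \<open>
  The descendants of a node \<open>h\<close> levels further down. The bits hold the directions in which the
  children are listed next on each of these levels; every traversal reverses the direction.
\<close>

fun zigzag :: "nat \<Rightarrow> nat \<Rightarrow> node \<Rightarrow> nat list \<Rightarrow> node list \<times> nat list" where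
  "zigzag 0 l nd bs = ([nd], bs)"
| "zigzag (Suc h) l nd bs =
     (let (us, bs') = zigzags (zigzag h (Suc l))
            (map (child l nd) (monotone_code (hd bs) (fan_size (snd nd)) q 0)) (tl bs)
      in (us, (1 - hd bs) # bs'))"

text \<open>Two dissections occur because the predicate also has to describe the traversal of a list
  of subtrees: the first leaf arises from the first root by the incoming bits, the last leaf from
  the last root by the outgoing ones.\<close>

definition zigzag_ok ::
    "nat \<Rightarrow> nat \<Rightarrow> nat set set \<Rightarrow> nat set set \<Rightarrow> nat list \<Rightarrow> node list \<times> nat list \<Rightarrow> bool" where
  "zigzag_ok h l D D' bs z \<longleftrightarrow> length (snd z) = h \<and> set (snd z) \<subseteq> {0, 1} \<and> fst z \<noteq> [] \<and>
     dissection_of (l + h) (hd (fst z)) = add_ears l D bs \<and>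
     dissection_of (l + h) (last (fst z)) = add_ears l D' (snd z) \<and>
     successively exchange (map (dissection_of (l + h)) (fst z)) \<and>
     (\<forall>x\<in>set (fst z). node_ok (l + h) x)"

text \<open>The bits that one subtree leaves are the bits that the next one reads. The two leaves at
  the junction thus arise from neighbouring nodes by the same ears.\<close>

lemma zigzags_ok:
  assumes g: "\<And>nd bs. node_ok l nd \<Longrightarrow> length bs = h \<Longrightarrow> set bs \<subseteq> {0, 1} \<Longrightarrow>
      zigzag_ok h l (dissection_of l nd) (dissection_of l nd) bs (g nd bs)" and l: "1 \<le> l"
    and "xs \<noteq> []" "\<forall>x\<in>set xs. node_ok l x" "successively exchange (map (dissection_of l) xs)"
    "length bs = h" "set bs \<subseteq> {0, 1}"
  shows "zigzag_ok h l (dissection_of l (hd xs)) (dissection_of l (last xs)) bs (zigzags g xs bs)"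
  using assms(3-)
proof (induction xs arbitrary: bs)
  case (Cons x xs)
  obtain us bs' where us: "g x bs = (us, bs')" by fastforce
  obtain vs bs'' where vs: "zigzags g xs bs' = (vs, bs'')" by fastforce
  have z: "zigzags g (x # xs) bs = (us @ vs, bs'')" using us vs by simp
  have 1: "zigzag_ok h l (dissection_of l x) (dissection_of l x) bs (us, bs')"
    using g[of x bs] Cons.prems us by simp
  show ?case
  proof (cases "xs = []")
    case True
    then show ?thesis using 1 vs z by simp
  next
    case False
    have bs': "length bs' = h" "set bs' \<subseteq> {0, 1}" using 1 unfolding zigzag_ok_def by auto
    have "successively exchange (map (dissection_of l) xs)"
      and link: "exchange (dissection_of l x) (dissection_of l (hd xs))"
      using Cons.prems(3) False by (auto simp: successively_Cons hd_map)
    then have 2: "zigzag_ok h l (dissection_of l (hd xs)) (dissection_of l (last xs)) bs' (vs, bs'')"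
      using Cons.IH[of bs'] False Cons.prems bs' vs by simp
    have "dissection_of l x \<subseteq> good l" "dissection_of l (hd xs) \<subseteq> good l"
      using Cons.prems(2) False dissection_of_full[OF _ l] unfolding full_dissections_def by auto
    then have "exchange (add_ears l (dissection_of l x) bs') (add_ears l (dissection_of l (hd xs)) bs')"
      using exchange_add_ears link l by blast
    then have "successively exchange (map (dissection_of (l + h)) (us @ vs))"
      using 1 2 unfolding zigzag_ok_def by (simp add: successively_append_iff last_map hd_map)
    then show ?thesis using 1 2 False unfolding z zigzag_ok_def by simp blast
  qed
qed simp

lemma zigzag_is_ok:
  assumes "node_ok l nd" "1 \<le> l" "length bs = h" "set bs \<subseteq> {0, 1}"
  shows "zigzag_ok h l (dissection_of l nd) (dissection_of l nd) bs (zigzag h l nd bs)"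
  using assms
proof (induction h arbitrary: l nd bs)
  case 0
  then show ?case unfolding zigzag_ok_def by simp
next
  case (Suc h)
  obtain b bs1 where bs: "bs = b # bs1" using Suc.prems(3) by (cases bs) auto
  have b: "b = 0 \<or> b = 1" "length bs1 = h" "set bs1 \<subseteq> {0, 1}" using Suc.prems bs by auto
  let ?r = "fan_size (snd nd)" and ?D = "dissection_of l nd"
  define fs where "fs = monotone_code b ?r q 0"
  define xs where "xs = map (child l nd) fs"
  have fs: "fs \<noteq> []" "hd fs = replicate q (if b = 0 then 0 else ?r)" "last fs = replicate q (if 1 - b = 0 then 0 else ?r)"
    using hd_last_monotone_code[of 0 ?r b q] b(1) unfolding fs_def by auto
  have code: "bounded_code ?r f" if "f \<in> set fs" for f using that bounded_code_iff unfolding fs_def by blast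
  have ok: "\<forall>x\<in>set xs. node_ok (Suc l) x" unfolding xs_def using child_ok(1)[OF Suc.prems(1,2)] code by auto
  have "successively (monotone_move b ?r 0) fs" unfolding fs_def by (rule successively_monotone_code) simp
  then have "successively (\<lambda>f f'. exchange (dissection_of (Suc l) (child l nd f)) (dissection_of (Suc l) (child l nd f'))) fs"
    by (rule successively_mono) (use exchange_child[OF Suc.prems(1,2)] code in blast)
  then have succ: "successively exchange (map (dissection_of (Suc l)) xs)" unfolding xs_def by (simp add: successively_map)
  \<comment> \<open>The code starts at the extreme sequence for \<open>b\<close> and ends at the one
    for \<open>1 - b\<close>, which is the bit left behind.\<close>
  have ends: "dissection_of (Suc l) (hd xs) = add_ear l b ?D" "dissection_of (Suc l) (last xs) = add_ear l (1 - b) ?D"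
    unfolding xs_def hd_map[OF fs(1)] last_map[OF fs(1)] fs(2,3) by (rule child_extreme[OF Suc.prems(1,2)])+
  obtain us bs' where us: "zigzags (zigzag h (Suc l)) xs bs1 = (us, bs')" by fastforce
  have z: "zigzag (Suc h) l nd bs = (us, (1 - b) # bs')" using us bs unfolding xs_def fs_def by simp
  have "zigzag_ok h (Suc l) (dissection_of (Suc l) (hd xs)) (dissection_of (Suc l) (last xs)) bs1 (us, bs')"
    unfolding us[symmetric] using Suc.IH b ok succ fs(1) by (intro zigzags_ok) (auto simp: xs_def)
  then show ?case unfolding z unfolding zigzag_ok_def bs ends using b(1) by auto
qed

section \<open>Ancestors: every dissection is reached exactly once\<close>

definition parent :: "nat \<Rightarrow> nat set set \<Rightarrow> nat set set" where
  "parent l D = (let F = {e \<in> D. e \<subseteq> {..<top_vertex l}} in F \<union> fan_diagonals l (link l F))"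

fun ancestor :: "nat \<Rightarrow> nat \<Rightarrow> nat set set \<Rightarrow> nat set set" where
  "ancestor 0 l D = D"
| "ancestor (Suc h) l D = parent l (ancestor h (Suc l) D)"

lemma frozen_of_struts:
  assumes "frozen l F"
  shows "{e \<in> F \<union> struts l w d I. e \<subseteq> {..<top_vertex l}} = F"
proof -
  have "e \<subseteq> {..<top_vertex l}" if "e \<in> F" for e using assms that by (auto elim!: frozenE)
  then show ?thesis unfolding struts_def by auto
qed

lemma parent_child:
  assumes "node_ok l nd" "1 \<le> l" "bounded_code (fan_size (snd nd)) f"
  shows "parent l (dissection_of (Suc l) (child l nd f)) = dissection_of l nd"
  unfolding parent_def child_ok(2)[OF assms] frozen_of_struts[OF node_ctx(1)[OF assms(1)]]
  using node_ctx(2)[OF assms(1)] by (simp add: dissection_of_def Let_def)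

lemma dissection_of_eqD:
  assumes "node_ok l nd" "frozen l F" "F \<union> fan_diagonals l w = dissection_of l nd"
  shows "pairs (fst nd) = F" "link l F = snd nd"
proof -
  have *: "{e \<in> F \<union> fan_diagonals l w. top_vertex l \<notin> e} = F" if "frozen l F" for F w
    using that unfolding frozen_def fan_diagonals_def by auto
  show "pairs (fst nd) = F"
    using *[OF assms(2), of w] *[OF node_ctx(1)[OF assms(1)], of "snd nd"] assms(3)
    unfolding dissection_of_def by simp
  then show "link l F = snd nd" using node_ctx(2)[OF assms(1)] by simp
qed

text \<open>The code is the conjugate of \<open>d\<close>: its entry at \<open>t\<close> counts the
  shifts above \<open>t\<close>.\<close>

lemma code_of_antitone:
  assumes "antitone_below w d"
  obtains f where "bounded_code (fan_size w) f" "\<And>i. i < fan_size w \<Longrightarrow> count_above f i = d i"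
proof -
  let ?r = "fan_size w"
  define c where "c t = card {i. i < ?r \<and> t < d i}" for t
  define f where "f = map c [0..<q]"
  have c_le: "c t \<le> ?r" for t unfolding c_def using card_mono[of "{..<?r}" "{i. i < ?r \<and> t < d i}"] by auto
  have c_mono: "c t' \<le> c t" if "t \<le> t'" for t t'
    unfolding c_def using that by (intro card_mono) auto
  have len: "length f = q" and nth: "\<And>t. t < q \<Longrightarrow> f ! t = c t" unfolding f_def by auto
  have sorted: "sorted_wrt (\<ge>) f" unfolding f_def by (auto simp: sorted_wrt_iff_nth_less c_mono)
  have "bounded_code ?r f" unfolding bounded_code_def using len sorted c_le by (auto simp: f_def)
  moreover have "count_above f i = d i" if i: "i < ?r" for i
  proof -
    have anti: "d j \<le> d j'" if "j' \<le> j" "j < ?r" for j j'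
      using assms that unfolding antitone_below_def by (cases "j' = j") auto
    have c_iff: "i < c t \<longleftrightarrow> t < d i" for t
    proof
      assume "t < d i"
      then have "{..i} \<subseteq> {i. i < ?r \<and> t < d i}"
        using i anti[of _ i] by (auto intro: less_le_trans)
      then have "card {..i} \<le> c t" unfolding c_def by (intro card_mono) auto
      then show "i < c t" by simp
    next
      assume lt: "i < c t"
      show "t < d i"
      proof (rule ccontr)
        assume "\<not> t < d i"
        then have "j < i" if "j < ?r" "t < d j" for j
          using anti[of i j] that by (meson le_trans not_less)
        then have "{i. i < ?r \<and> t < d i} \<subseteq> {..<i}" by auto
        then have "c t \<le> card {..<i}" unfolding c_def by (intro card_mono) auto
        then show False using lt by simp
      qed
    qed
    have "t < count_above f i \<longleftrightarrow> t < d i" if "t < q" for t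
      using less_count_above_iff[OF sorted, of t i] len nth that c_iff by simp
    moreover have "count_above f i \<le> q" "d i \<le> q"
      using count_above_le[of f i] len assms i unfolding antitone_below_def by auto
    ultimately show ?thesis by (metis less_le_not_le linorder_neqE_nat order_less_le_trans)
  qed
  ultimately show ?thesis using that by blast
qed

lemma code_eqI:
  assumes "bounded_code r f" "bounded_code r f'" "\<And>i. i < r \<Longrightarrow> count_above f i = count_above f' i"
  shows "f = f'"
proof (rule nth_equalityI)
  show "length f = length f'" using assms unfolding bounded_code_def by simp
  fix t assume t: "t < length f"
  then have t': "t < length f'" using assms unfolding bounded_code_def by simp
  have s: "sorted_wrt (\<ge>) f" "sorted_wrt (\<ge>) f'" and sub: "set f \<subseteq> {0..r}" "set f' \<subseteq> {0..r}"
    using assms unfolding bounded_code_def by auto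
  have le: "f ! t \<le> r" "f' ! t \<le> r" using sub nth_mem[OF t] nth_mem[OF t'] by auto
  have "i < f ! t \<longleftrightarrow> i < f' ! t" if "i < r" for i
    using less_count_above_iff[OF s(1) t, of i] less_count_above_iff[OF s(2) t', of i] assms(3)[OF that] by simp
  then show "f ! t = f' ! t" using le by (metis linorder_neqE_nat order_less_le_trans less_irrefl)
qed

lemma child_of_parent:
  assumes nd: "node_ok l nd" and l: "1 \<le> l" and D: "D \<in> full_dissections (Suc l)"
    and parent: "parent l D = dissection_of l nd"
  obtains f where "bounded_code (fan_size (snd nd)) f" "D = dissection_of (Suc l) (child l nd f)"
proof -
  obtain F d where F: "frozen l F" "F = {e \<in> D. e \<subseteq> {..<top_vertex l}}" "antitone_below (link l F) d"
    "D = F \<union> struts l (link l F) d {..<fan_size (link l F)}"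
    using D l by (rule dissection_decompose)
  have "F \<union> fan_diagonals l (link l F) = dissection_of l nd" using parent F(2) unfolding parent_def by (simp add: Let_def)
  from dissection_of_eqD[OF nd F(1) this] have eq: "pairs (fst nd) = F" "link l F = snd nd" .
  obtain f where f: "bounded_code (fan_size (snd nd)) f" "\<And>i. i < fan_size (snd nd) \<Longrightarrow> count_above f i = d i"
    using code_of_antitone[OF F(3)] unfolding eq by blast
  have "struts l (snd nd) d {..<fan_size (snd nd)} = struts l (snd nd) (count_above f) {..<fan_size (snd nd)}"
    unfolding struts_def using f(2) by (intro image_cong) auto
  then have "D = dissection_of (Suc l) (child l nd f)" using F(4) child_ok(2)[OF nd l f(1)] eq by simp
  then show ?thesis using that f(1) by blast
qed

lemma parent_full:
  assumes "D \<in> full_dissections (Suc l)" "1 \<le> l"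
  shows "parent l D \<in> full_dissections l"
proof -
  obtain F d where F: "frozen l F" "F = {e \<in> D. e \<subseteq> {..<top_vertex l}}" "card F + fan_size (link l F) = l"
    using assms by (rule dissection_decompose)
  show ?thesis using fan_dissection[OF F(1) assms(2) refl] F(3)
    unfolding parent_def F(2)[symmetric] Let_def full_dissections_def by auto
qed

lemma ancestor_full:
  assumes "D \<in> full_dissections (l + h)" "1 \<le> l"
  shows "ancestor h l D \<in> full_dissections l"
  using assms parent_full by (induction h arbitrary: l) auto

text \<open>Strut \<open>i\<close> of one child must be a strut of the other, and a strut determines
  its index and its shift.\<close>

lemma child_inj:
  assumes "node_ok l nd" "1 \<le> l" "bounded_code (fan_size (snd nd)) f" "bounded_code (fan_size (snd nd)) f'"
    "dissection_of (Suc l) (child l nd f) = dissection_of (Suc l) (child l nd f')"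
  shows "f = f'"
proof (rule code_eqI[OF assms(3,4)])
  fix i assume i: "i < fan_size (snd nd)"
  note ctx = node_ctx(1)[OF assms(1)] assms(2) node_ctx(2)[OF assms(1)]
  have le: "count_above g j \<le> q" if "bounded_code (fan_size (snd nd)) g" for g j
    using that count_above_le unfolding bounded_code_def by metis
  let ?e = "{snd nd ! (q * i + count_above f i), top_vertex l + count_above f i}"
  have "?e \<in> dissection_of (Suc l) (child l nd f')"
    using i unfolding assms(5)[symmetric] child_ok(2)[OF assms(1,2,3)] struts_def by blast
  then obtain j where j: "j < fan_size (snd nd)"
    "?e = {snd nd ! (q * j + count_above f' j), top_vertex l + count_above f' j}"
    using strut_notin_F[OF ctx] unfolding child_ok(2)[OF assms(1,2,4)] struts_def by blast
  then show "count_above f i = count_above f' i"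
    using strut_eq_iff[OF ctx i j(1) le[OF assms(3)] le[OF assms(4)]] by blast
qed

text \<open>Different keys have disjoint fibres under \<open>anc\<close>, so concatenating the leaf
  lists keeps them distinct and unites the fibres.\<close>

lemma zigzags_image:
  assumes "\<And>x bs. x \<in> set xs \<Longrightarrow>
      distinct (map dis (fst (g x bs))) \<and> dis ` set (fst (g x bs)) = {D \<in> A. anc D = key x}"
    "distinct (map key xs)"
  shows "distinct (map dis (fst (zigzags g xs bs))) \<and>
    dis ` set (fst (zigzags g xs bs)) = {D \<in> A. anc D \<in> key ` set xs}"
  using assms
proof (induction xs arbitrary: bs)
  case (Cons x xs)
  obtain us bs' where us: "g x bs = (us, bs')" by fastforce
  obtain vs bs'' where vs: "zigzags g xs bs' = (vs, bs'')" by fastforce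
  have 1: "distinct (map dis us)" "dis ` set us = {D \<in> A. anc D = key x}" using Cons.prems(1)[of x bs] us by auto
  have "distinct (map dis (fst (zigzags g xs bs'))) \<and>
      dis ` set (fst (zigzags g xs bs')) = {D \<in> A. anc D \<in> key ` set xs}"
    using Cons.prems by (intro Cons.IH) auto
  then have 2: "distinct (map dis vs)" "dis ` set vs = {D \<in> A. anc D \<in> key ` set xs}" using vs by auto
  have "key x \<notin> key ` set xs" using Cons.prems(2) by simp
  then have "dis ` set us \<inter> dis ` set vs = {}" unfolding 1(2) 2(2) by (simp add: disjoint_iff)
  then have "distinct (map dis (us @ vs))" using 1(1) 2(1) by simp
  moreover have "dis ` set (us @ vs) = {D \<in> A. anc D \<in> key ` set (x # xs)}"
    unfolding set_append image_Un 1(2) 2(2) by auto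
  ultimately show ?case using us vs by simp
qed simp

text \<open>\<open>ancestor\<close> is a function of the dissection alone, and the leaves below a
  node are its fibre. This shows at once that no dissection is repeated and, at the root, that none
  is missing. The bits are arbitrary as they affect only the order.\<close>

lemma zigzag_image:
  assumes "node_ok l nd" "1 \<le> l"
  shows "distinct (map (dissection_of (l + h)) (fst (zigzag h l nd bs))) \<and>
    dissection_of (l + h) ` set (fst (zigzag h l nd bs)) =
      {D \<in> full_dissections (l + h). ancestor h l D = dissection_of l nd}"
  using assms
proof (induction h arbitrary: l nd bs)
  case 0
  then show ?case using dissection_of_full[OF 0] by auto
next
  case (Suc h)
  let ?r = "fan_size (snd nd)"
  define fs where "fs = monotone_code (hd bs) ?r q 0"
  define xs where "xs = map (child l nd) fs"
  have code: "bounded_code ?r f \<longleftrightarrow> f \<in> set fs" for f using bounded_code_iff unfolding fs_def by blast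
  have ok: "\<forall>x\<in>set xs. node_ok (Suc l) x" unfolding xs_def using child_ok(1)[OF Suc.prems] code by auto
  have "inj_on (\<lambda>f. dissection_of (Suc l) (child l nd f)) (set fs)"
    using child_inj[OF Suc.prems] code by (intro inj_onI) blast
  then have dist: "distinct (map (dissection_of (Suc l)) xs)"
    unfolding xs_def map_map using distinct_monotone_code unfolding fs_def by (simp add: distinct_map comp_def)
  have step: "distinct (map (dissection_of (Suc l + h)) (fst (zigzag h (Suc l) x bs))) \<and>
    dissection_of (Suc l + h) ` set (fst (zigzag h (Suc l) x bs)) =
      {D \<in> full_dissections (Suc l + h). ancestor h (Suc l) D = dissection_of (Suc l) x}"
    if "x \<in> set xs" for x bs
    by (rule Suc.IH) (use ok that in auto)
  have *: "distinct (map (dissection_of (Suc l + h)) (fst (zigzags (zigzag h (Suc l)) xs (tl bs)))) \<and>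
    dissection_of (Suc l + h) ` set (fst (zigzags (zigzag h (Suc l)) xs (tl bs))) =
      {D \<in> full_dissections (Suc l + h). ancestor h (Suc l) D \<in> dissection_of (Suc l) ` set xs}"
    by (rule zigzags_image[OF step dist])
  have "ancestor h (Suc l) D \<in> dissection_of (Suc l) ` set xs \<longleftrightarrow> ancestor (Suc h) l D = dissection_of l nd"
    if D: "D \<in> full_dissections (Suc l + h)" for D
  proof
    assume "ancestor h (Suc l) D \<in> dissection_of (Suc l) ` set xs"
    then obtain f where f: "f \<in> set fs" "ancestor h (Suc l) D = dissection_of (Suc l) (child l nd f)"
      unfolding xs_def by auto
    then show "ancestor (Suc h) l D = dissection_of l nd"
      using parent_child[OF Suc.prems] code by simp
  next
    assume a: "ancestor (Suc h) l D = dissection_of l nd"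
    have "ancestor h (Suc l) D \<in> full_dissections (Suc l)" using ancestor_full[OF D] by simp
    then obtain f where "bounded_code ?r f" "ancestor h (Suc l) D = dissection_of (Suc l) (child l nd f)"
      using child_of_parent[OF Suc.prems] a by (metis ancestor.simps(2))
    then show "ancestor h (Suc l) D \<in> dissection_of (Suc l) ` set xs" unfolding xs_def using code by auto
  qed
  then have "{D \<in> full_dissections (Suc l + h). ancestor h (Suc l) D \<in> dissection_of (Suc l) ` set xs} =
      {D \<in> full_dissections (Suc l + h). ancestor (Suc h) l D = dissection_of l nd}" by blast
  moreover have "fst (zigzag (Suc h) l nd bs) = fst (zigzags (zigzag h (Suc l)) xs (tl bs))"
    unfolding xs_def fs_def by (simp add: case_prod_unfold Let_def)
  ultimately show ?case using * by (simp only: add_Suc_right add_Suc)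
qed

section \<open>The Hamilton path\<close>

definition root :: node where
  "root = ([], [0..<q + 1])"

lemma root_ok: "node_ok 1 root" and dissection_of_root: "dissection_of 1 root = {}"
proof -
  have "link_set 1 {} = {0..<q + 1}" unfolding link_set_def top_vertex_def by auto
  then have "link 1 {} = [0..<q + 1]" unfolding link_def by (simp only: sorted_list_of_set_range)
  moreover have "fan_size [0..<q + 1] = 1" unfolding fan_size_def using q_pos by simp
  ultimately show "node_ok 1 root" "dissection_of 1 root = {}"
    unfolding node_ok_def root_def frozen_def pairs_def noncrossing_def dissection_of_def fan_diagonals_def
    by auto
qed

lemma full_dissections_1: "full_dissections 1 = {{}}"
proof -
  have "finite D" if "D \<subseteq> good 1" for D using that finite_good finite_subset by blast
  then have "D = {}" if "D \<subseteq> good 1" "card D = 0" for D using that by simp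
  then show ?thesis unfolding full_dissections_def noncrossing_def by auto
qed

definition dissection_list :: "nat \<Rightarrow> node list" where
  "dissection_list n = fst (zigzag (n - 1) 1 root (replicate (n - 1) 0))"

lemma hamilton_path_dissection_list:
  assumes "1 \<le> n"
  shows "hamilton_path (map (dissection_of n) (dissection_list n)) (with_proj (flip_graph (q * n + 2) (q + 2)))"
    and "card (pverts (flip_graph (q * n + 2) (q + 2))) = length (dissection_list n)"
proof -
  let ?zs = "dissection_list n" and ?G = "flip_graph (q * n + 2) (q + 2)"
  let ?p = "map (dissection_of n) ?zs"
  have n: "1 + (n - 1) = n" using assms by simp
  have V: "pverts ?G = full_dissections n" unfolding flip_graph_def using dissections_eq[OF assms] by simp
  have img: "distinct ?p" "dissection_of n ` set ?zs = {D \<in> full_dissections n. ancestor (n - 1) 1 D = {}}"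
    using zigzag_image[OF root_ok order_refl, of "n - 1" "replicate (n - 1) 0"]
    unfolding dissection_list_def n dissection_of_root by auto
  \<comment> \<open>All dissections share their ancestor on level \<open>1\<close>, where the empty
    dissection is the only one.\<close>
  have "ancestor (n - 1) 1 D = {}" if "D \<in> full_dissections n" for D
    using ancestor_full[of D 1 "n - 1"] that n full_dissections_1 by auto
  then have set: "set ?p = full_dissections n" using img(2) by auto
  have "zigzag_ok (n - 1) 1 (dissection_of 1 root) (dissection_of 1 root) (replicate (n - 1) 0)
      (zigzag (n - 1) 1 root (replicate (n - 1) 0))"
    by (rule zigzag_is_ok[OF root_ok]) auto
  then have ne: "?zs \<noteq> []" and succ: "successively exchange ?p"
    unfolding zigzag_ok_def n dissection_list_def by auto
  have arc: "(D, D') \<in> parcs ?G" if D: "D \<in> full_dissections n" "D' \<in> full_dissections n" "exchange D D'" for D D'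
  proof -
    obtain d d' where "d \<in> D" "d' \<notin> D" "D' = insert d' (D - {d})" using D(3) unfolding exchange_def by blast
    moreover have "D \<in> dissections {..<q * n + 2} (q + 2)" "D' \<in> dissections {..<q * n + 2} (q + 2)"
      using D dissections_eq[OF assms] by auto
    moreover have "0 < q * n" using assms q_pos by simp
    then have "3 \<le> card {..<q * n + 2}" unfolding card_lessThan by linarith
    ultimately have "flip {..<q * n + 2} (q + 2) D D'"
      using q_pos by (intro flip_exchange) auto
    then show ?thesis unfolding flip_graph_def using D dissections_eq[OF assms] by simp
  qed
  have "set (vwalk_arcs p) \<subseteq> parcs ?G" if "successively exchange p" "set p \<subseteq> full_dissections n" for p
    using that by (induction p rule: vwalk_arcs.induct) (auto intro!: arc simp del: add_2_eq_Suc add_2_eq_Suc')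
  then have "vwalk ?p (with_proj ?G)" unfolding vwalk_def using set V ne succ by simp
  then show "hamilton_path ?p (with_proj ?G)" unfolding hamilton_path_def vpath_def using img(1) set V by simp
  show "card (pverts ?G) = length ?zs" unfolding V set[symmetric] using distinct_card[OF img(1)] by simp
qed

end

section \<open>Structured programs\<close>

text \<open>
  The cells below \<open>num_regs\<close> are registers, accessed directly only; the others are accessed by
  \<open>Load\<close>, \<open>Store\<close> and \<open>Visit\<close> only. Register \<open>2\<close> is constantly zero, which makes
  \<open>JumpZero 2\<close> an unconditional jump.
\<close>

definition num_regs :: nat where
  "num_regs = 32"

record store =
  reg :: "nat \<Rightarrow> nat"
  heap :: "nat \<Rightarrow> nat"
  out :: "(nat \<Rightarrow> nat) list"

datatype com =
    Do "instr list"
  | Seq com com  (infixr \<open>;;\<close> 60)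
  | Cond nat com com
  | While nat com

fun run_instr :: "instr \<Rightarrow> store \<Rightarrow> store" where
  "run_instr (Const a x) s = s\<lparr>reg := (reg s)(a := x)\<rparr>"
| "run_instr (Add a b b') s = s\<lparr>reg := (reg s)(a := reg s b + reg s b')\<rparr>"
| "run_instr (Sub a b b') s = s\<lparr>reg := (reg s)(a := reg s b - reg s b')\<rparr>"
| "run_instr (Load a b) s = s\<lparr>reg := (reg s)(a := heap s (reg s b))\<rparr>"
| "run_instr (Store a b) s = s\<lparr>heap := (heap s)(reg s a := reg s b)\<rparr>"
| "run_instr (JumpZero a l) s = s"
| "run_instr (Visit a) s = s\<lparr>out := out s @ [\<lambda>i. heap s (reg s a + i)]\<rparr>"

text \<open>A store separates registers and heap, whereas the machine has a single memory. The
  separation is faithful as long as computed addresses stay clear of the registers.\<close>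

fun safe_instr :: "instr \<Rightarrow> store \<Rightarrow> bool" where
  "safe_instr (Load a b) s \<longleftrightarrow> num_regs \<le> reg s b"
| "safe_instr (Store a b) s \<longleftrightarrow> num_regs \<le> reg s a"
| "safe_instr (Visit a) s \<longleftrightarrow> num_regs \<le> reg s a"
| "safe_instr _ s \<longleftrightarrow> True"

fun wf_instr :: "instr \<Rightarrow> bool" where
  "wf_instr (Const a x) \<longleftrightarrow> a < num_regs \<and> a \<noteq> 2"
| "wf_instr (Add a b b') \<longleftrightarrow> a < num_regs \<and> a \<noteq> 2 \<and> b < num_regs \<and> b' < num_regs"
| "wf_instr (Sub a b b') \<longleftrightarrow> a < num_regs \<and> a \<noteq> 2 \<and> b < num_regs \<and> b' < num_regs"
| "wf_instr (Load a b) \<longleftrightarrow> a < num_regs \<and> a \<noteq> 2 \<and> b < num_regs"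
| "wf_instr (Store a b) \<longleftrightarrow> a < num_regs \<and> b < num_regs"
| "wf_instr (JumpZero a l) \<longleftrightarrow> False"
| "wf_instr (Visit a) \<longleftrightarrow> a < num_regs"

fun run_block :: "instr list \<Rightarrow> store \<Rightarrow> store" where
  "run_block [] s = s"
| "run_block (i # is) s = run_block is (run_instr i s)"

fun safe_block :: "instr list \<Rightarrow> store \<Rightarrow> bool" where
  "safe_block [] s \<longleftrightarrow> True"
| "safe_block (i # is) s \<longleftrightarrow> safe_instr i s \<and> safe_block is (run_instr i s)"

fun wf_com :: "com \<Rightarrow> bool" where
  "wf_com (Do is) \<longleftrightarrow> list_all wf_instr is"
| "wf_com (c ;; c') \<longleftrightarrow> wf_com c \<and> wf_com c'"
| "wf_com (Cond a c c') \<longleftrightarrow> a < num_regs \<and> wf_com c \<and> wf_com c'"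
| "wf_com (While a c) \<longleftrightarrow> a < num_regs \<and> wf_com c"

text \<open>The increments count the jumps that \<open>compile\<close> inserts: the test, and the
  jump over the other branch or back to the test.\<close>

inductive runs :: "com \<Rightarrow> store \<Rightarrow> nat \<Rightarrow> store \<Rightarrow> bool" where
  Do: "safe_block is s \<Longrightarrow> runs (Do is) s (length is) (run_block is s)"
| Seq: "runs c s t s' \<Longrightarrow> runs c' s' t' s'' \<Longrightarrow> runs (c ;; c') s (t + t') s''"
| Cond_True: "reg s a \<noteq> 0 \<Longrightarrow> runs c s t s' \<Longrightarrow> runs (Cond a c c') s (t + 2) s'"
| Cond_False: "reg s a = 0 \<Longrightarrow> runs c' s t s' \<Longrightarrow> runs (Cond a c c') s (t + 1) s'"
| While_False: "reg s a = 0 \<Longrightarrow> runs (While a c) s 1 s"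
| While_True: "reg s a \<noteq> 0 \<Longrightarrow> runs c s t s' \<Longrightarrow> runs (While a c) s' t' s'' \<Longrightarrow>
    runs (While a c) s (t + t' + 2) s''"

text \<open>The parameter \<open>l\<close> is the address of the first instruction, as jump targets
  are absolute.\<close>

fun compile :: "nat \<Rightarrow> com \<Rightarrow> instr list" where
  "compile l (Do is) = is"
| "compile l (c ;; c') = (let p = compile l c in p @ compile (l + length p) c')"
| "compile l (Cond a c c') =
     (let p = compile (l + 1) c; p' = compile (l + length p + 2) c' in
      JumpZero a (l + length p + 2) # p @ JumpZero 2 (l + length p + 2 + length p') # p')"
| "compile l (While a c) =
     (let p = compile (l + 1) c in JumpZero a (l + length p + 2) # p @ [JumpZero 2 l])"

definition config_of :: "nat \<Rightarrow> store \<Rightarrow> config" where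
  "config_of l s = \<lparr>pc = l, mem = (\<lambda>x. if x < num_regs then reg s x else heap s x), visited = out s\<rparr>"

lemma step_config_of:
  assumes "P = pre @ i # post" "wf_instr i" "safe_instr i s"
  shows "step P (config_of (length pre) s) = config_of (Suc (length pre)) (run_instr i s)"
proof -
  have "step P (config_of (length pre) s) = exec i (config_of (length pre) s)"
    unfolding step_def halted_def config_of_def using assms(1) by simp
  then show ?thesis using assms(2,3)
    by (cases i) (auto simp: config_of_def fun_eq_iff)
qed

lemma step_JumpZero:
  assumes "P = pre @ JumpZero a l # post" "a < num_regs"
  shows "step P (config_of (length pre) s) = config_of (if reg s a = 0 then l else Suc (length pre)) s"
  unfolding step_def halted_def config_of_def using assms by simp

lemma run_instr_reg_2: "wf_instr i \<Longrightarrow> reg (run_instr i s) 2 = reg s 2"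
  by (cases i) auto

lemma steps_add: "(step P ^^ t) c = c' \<Longrightarrow> (step P ^^ t') c' = c'' \<Longrightarrow> (step P ^^ (t + t')) c = c''"
  by (simp add: add.commute[of t] funpow_add)

lemma steps_block:
  assumes "P = pre @ is @ post" "list_all wf_instr is" "safe_block is s"
  shows "(step P ^^ length is) (config_of (length pre) s) = config_of (length pre + length is) (run_block is s) \<and>
    reg (run_block is s) 2 = reg s 2"
  using assms
proof (induction "is" arbitrary: pre s)
  case (Cons i "is")
  have "step P (config_of (length pre) s) = config_of (length (pre @ [i])) (run_instr i s)"
    using step_config_of[of P pre i "is @ post" s] Cons.prems by simp
  moreover have "(step P ^^ length is) (config_of (length (pre @ [i])) (run_instr i s)) =
      config_of (length (pre @ [i]) + length is) (run_block is (run_instr i s)) \<and>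
      reg (run_block is (run_instr i s)) 2 = reg (run_instr i s) 2"
    using Cons.prems by (intro Cons.IH) auto
  ultimately show ?case using run_instr_reg_2[of i s] Cons.prems(2) by (simp add: funpow_swap1)
qed simp

text \<open>The surrounding code is arbitrary so that the induction hypotheses apply to subcommands
  at their own addresses.\<close>

lemma steps_compile:
  assumes "runs c s t s'" "wf_com c" "reg s 2 = 0" "P = pre @ compile (length pre) c @ post"
  shows "(step P ^^ t) (config_of (length pre) s) = config_of (length pre + length (compile (length pre) c)) s' \<and>
    reg s' 2 = 0"
  using assms
proof (induction arbitrary: pre post rule: runs.induct)
  case (Do "is" s)
  then show ?case using steps_block[of P pre "is" post s] by simp
next
  case (Seq c s t s' c' t' s'')
  let ?p = "compile (length pre) c"
  have 1: "(step P ^^ t) (config_of (length pre) s) = config_of (length pre + length ?p) s' \<and> reg s' 2 = 0"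
    using Seq.prems by (intro Seq.IH(1)[of pre "compile (length pre + length ?p) c' @ post"]) (auto simp: Let_def)
  have 2: "(step P ^^ t') (config_of (length (pre @ ?p)) s') =
      config_of (length (pre @ ?p) + length (compile (length (pre @ ?p)) c')) s'' \<and> reg s'' 2 = 0"
    using Seq.prems 1 by (intro Seq.IH(2)[of "pre @ ?p" post]) (auto simp: Let_def)
  have "(step P ^^ (t + t')) (config_of (length pre) s) =
      config_of (length (pre @ ?p) + length (compile (length (pre @ ?p)) c')) s''"
    by (rule steps_add[where c'="config_of (length pre + length ?p) s'"]) (use 1 2 in simp_all)
  then show ?case using 2 by (simp add: Let_def add.assoc)
next
  case (Cond_True s a c t s' c')
  let ?l = "length pre"
  let ?p = "compile (?l + 1) c"
  let ?p' = "compile (?l + length ?p + 2) c'"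
  let ?i = "JumpZero a (?l + length ?p + 2)" and ?i' = "JumpZero 2 (?l + length ?p + 2 + length ?p')"
  have P: "P = pre @ ?i # ?p @ ?i' # ?p' @ post" using Cond_True.prems by (simp add: Let_def)
  have 1: "step P (config_of ?l s) = config_of (length (pre @ [?i])) s"
    using step_JumpZero[OF P] Cond_True.hyps Cond_True.prems by simp
  have 2: "(step P ^^ t) (config_of (length (pre @ [?i])) s) =
      config_of (length (pre @ [?i]) + length (compile (length (pre @ [?i])) c)) s' \<and> reg s' 2 = 0"
    using Cond_True.prems P by (intro Cond_True.IH[of "pre @ [?i]" "?i' # ?p' @ post"]) auto
  have "P = (pre @ ?i # ?p) @ ?i' # ?p' @ post" using P by simp
  from step_JumpZero[OF this] 2 have
    3: "step P (config_of (length (pre @ ?i # ?p)) s') = config_of (?l + length ?p + 2 + length ?p') s'"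
    by (simp add: num_regs_def)
  have "(step P ^^ (1 + t + 1)) (config_of ?l s) = config_of (?l + length ?p + 2 + length ?p') s'"
    using 1 2 3 by (intro steps_add[where P=P and t="1 + t"] steps_add[where P=P and t=1]) auto
  then show ?case using 2 by (simp add: Let_def add.assoc)
next
  case (Cond_False s a c' t s' c)
  let ?l = "length pre"
  let ?p = "compile (?l + 1) c"
  let ?p' = "compile (?l + length ?p + 2) c'"
  let ?i = "JumpZero a (?l + length ?p + 2)" and ?i' = "JumpZero 2 (?l + length ?p + 2 + length ?p')"
  have P: "P = pre @ ?i # ?p @ ?i' # ?p' @ post" using Cond_False.prems by (simp add: Let_def)
  let ?pre = "pre @ ?i # ?p @ [?i']"
  have 1: "step P (config_of ?l s) = config_of (length ?pre) s"
    using step_JumpZero[OF P] Cond_False.hyps Cond_False.prems by simp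
  have 2: "(step P ^^ t) (config_of (length ?pre) s) =
      config_of (length ?pre + length (compile (length ?pre) c')) s' \<and> reg s' 2 = 0"
    using Cond_False.prems P by (intro Cond_False.IH[of ?pre post]) auto
  have "(step P ^^ (1 + t)) (config_of ?l s) = config_of (length ?pre + length (compile (length ?pre) c')) s'"
    using 1 2 by (intro steps_add[where P=P and t=1]) auto
  then show ?case using 2 by (simp add: Let_def add.assoc)
next
  case (While_False s a c)
  let ?p = "compile (length pre + 1) c"
  have "P = pre @ JumpZero a (length pre + length ?p + 2) # ?p @ JumpZero 2 (length pre) # post"
    using While_False.prems by (simp add: Let_def)
  from step_JumpZero[OF this] show ?case using While_False.hyps While_False.prems by (simp add: Let_def)
next
  case (While_True s a c t s' t' s'')
  let ?l = "length pre"
  let ?p = "compile (?l + 1) c"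
  let ?i = "JumpZero a (?l + length ?p + 2)"
  have P: "P = pre @ ?i # ?p @ JumpZero 2 ?l # post" using While_True.prems by (simp add: Let_def)
  have 1: "step P (config_of ?l s) = config_of (length (pre @ [?i])) s"
    using step_JumpZero[OF P] While_True.hyps While_True.prems by simp
  have 2: "(step P ^^ t) (config_of (length (pre @ [?i])) s) =
      config_of (length (pre @ [?i]) + length (compile (length (pre @ [?i])) c)) s' \<and> reg s' 2 = 0"
    using While_True.prems P by (intro While_True.IH(1)[of "pre @ [?i]" "JumpZero 2 ?l # post"]) auto
  have "P = (pre @ ?i # ?p) @ JumpZero 2 ?l # post" using P by simp
  from step_JumpZero[OF this] 2 have
    3: "step P (config_of (length (pre @ ?i # ?p)) s') = config_of ?l s'" by (simp add: num_regs_def)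
  have 4: "(step P ^^ t') (config_of ?l s') = config_of (?l + length (compile ?l (While a c))) s'' \<and> reg s'' 2 = 0"
    using While_True.prems 2 by (intro While_True.IH(2)[of pre post]) auto
  have "(step P ^^ (1 + t + 1 + t')) (config_of ?l s) = config_of (?l + length (compile ?l (While a c))) s''"
    using 1 2 3 4
    by (intro steps_add[where P=P and t="1 + t + 1"] steps_add[where P=P and t="1 + t"] steps_add[where P=P and t=1]) auto
  moreover have "1 + t + 1 + t' = t + t' + 2" by simp
  ultimately show ?case using 4 by (simp only: simp_thms)
qed

definition start_store :: "nat \<Rightarrow> nat \<Rightarrow> store" where
  "start_store x y = \<lparr>reg = (\<lambda>_. 0)(0 := x, 1 := y), heap = (\<lambda>_. 0), out = []\<rparr>"

lemma lists_within_compile: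
  assumes "runs c (start_store x y) t s" "wf_com c"
  shows "lists_within (compile 0 c) x y t (out s)"
proof -
  have "initial x y = config_of 0 (start_store x y)"
    unfolding initial_def config_of_def start_store_def num_regs_def by (auto simp: fun_eq_iff)
  moreover have "(step (compile 0 c) ^^ t) (config_of 0 (start_store x y)) = config_of (length (compile 0 c)) s"
    using steps_compile[OF assms, of "compile 0 c" "[]" "[]"] by (simp add: start_store_def)
  ultimately show ?thesis unfolding lists_within_def Let_def halted_def by (simp add: config_of_def)
qed

section \<open>Total correctness with time bounds\<close>

definition wp :: "com \<Rightarrow> nat \<Rightarrow> (store \<Rightarrow> bool) \<Rightarrow> store \<Rightarrow> bool" where
  "wp c T Q s \<longleftrightarrow> (\<exists>t s'. runs c s t s' \<and> t \<le> T \<and> Q s')"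

lemma wp_mono: "wp c T Q s \<Longrightarrow> T \<le> T' \<Longrightarrow> (\<And>s'. Q s' \<Longrightarrow> Q' s') \<Longrightarrow> wp c T' Q' s"
  unfolding wp_def by (meson le_trans)

lemma wp_Do: "safe_block is s \<Longrightarrow> length is \<le> T \<Longrightarrow> Q (run_block is s) \<Longrightarrow> wp (Do is) T Q s"
  unfolding wp_def using runs.Do by blast

lemma wp_Seq:
  assumes "wp c T (wp c' T' Q) s" "T + T' \<le> T''"
  shows "wp (c ;; c') T'' Q s"
proof -
  obtain t s' t' s'' where "runs c s t s'" "t \<le> T" "runs c' s' t' s''" "t' \<le> T'" "Q s''"
    using assms(1) unfolding wp_def by blast
  then show ?thesis unfolding wp_def using assms(2) runs.Seq[of c s t s' c' t' s'']
    by (intro exI[of _ "t + t'"] exI[of _ s'']) auto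
qed

lemma wp_Cond:
  assumes "if reg s a \<noteq> 0 then wp c T Q s else wp c' T Q s" "T + 2 \<le> T'"
  shows "wp (Cond a c c') T' Q s"
proof (cases "reg s a = 0")
  case True
  then obtain t s' where "runs c' s t s'" "t \<le> T" "Q s'" using assms(1) unfolding wp_def by auto
  then show ?thesis unfolding wp_def using True assms(2) runs.Cond_False[of s a c' t s' c]
    by (intro exI[of _ "t + 1"] exI[of _ s']) auto
next
  case False
  then obtain t s' where "runs c s t s'" "t \<le> T" "Q s'" using assms(1) unfolding wp_def by auto
  then show ?thesis unfolding wp_def using False assms(2) runs.Cond_True[of s a c t s' c']
    by (intro exI[of _ "t + 2"] exI[of _ s']) auto
qed

lemma wp_While_count:
  assumes "I 0 s" "\<And>i s. i < m \<Longrightarrow> I i s \<Longrightarrow> reg s a \<noteq> 0 \<and> wp c B (I (Suc i)) s"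
    "\<And>s. I m s \<Longrightarrow> reg s a = 0 \<and> Q s" "m * (B + 2) + 1 \<le> T"
  shows "wp (While a c) T Q s"
proof -
  have "wp (While a c) ((m - i) * (B + 2) + 1) Q s" if "i \<le> m" "I i s" for i s
    using that
  proof (induction "m - i" arbitrary: i s)
    case 0
    then have "reg s a = 0" "Q s" using assms(3) by auto
    then show ?case
      unfolding wp_def using runs.While_False[of s a c] by (intro exI[of _ 1] exI[of _ s]) auto
  next
    case (Suc x)
    then have "i < m" by simp
    then have ne: "reg s a \<noteq> 0" and "wp c B (I (Suc i)) s" using assms(2) Suc.prems by auto
    then obtain t s' where t: "runs c s t s'" "t \<le> B" "I (Suc i) s'" unfolding wp_def by blast
    have "wp (While a c) ((m - Suc i) * (B + 2) + 1) Q s'"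
      using Suc.hyps(2) t(3) \<open>i < m\<close> by (intro Suc.hyps(1)) auto
    then obtain t' s'' where t': "runs (While a c) s' t' s''" "t' \<le> (m - Suc i) * (B + 2) + 1" "Q s''"
      unfolding wp_def by blast
    have "(m - i) * (B + 2) = (m - Suc i) * (B + 2) + (B + 2)"
      using \<open>i < m\<close> by (metis Suc_diff_Suc add.commute mult_Suc)
    then have "t + t' + 2 \<le> (m - i) * (B + 2) + 1" using t(2) t'(2) by linarith
    then show ?case unfolding wp_def using runs.While_True[OF ne t(1) t'(1)] t'(3) by blast
  qed
  from this[of 0 s] show ?thesis using assms(1,4) wp_mono[of _ "m * (B + 2) + 1" Q s T] by simp
qed

text \<open>Some iterations of a loop, without its exit. The machine has no recursion: the traversal
  of a subtree is a segment in the run of one loop, and such segments have to be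
  concatenated.\<close>

inductive loops :: "nat \<Rightarrow> com \<Rightarrow> store \<Rightarrow> nat \<Rightarrow> store \<Rightarrow> bool" for a c where
  Nil: "loops a c s 0 s"
| Cons: "reg s a \<noteq> 0 \<Longrightarrow> runs c s t s' \<Longrightarrow> loops a c s' t' s'' \<Longrightarrow> loops a c s (t + t' + 2) s''"

lemma loops_trans: "loops a c s t s' \<Longrightarrow> loops a c s' t' s'' \<Longrightarrow> loops a c s (t + t') s''"
proof (induction rule: loops.induct)
  case (Cons s t s1 t1 s2)
  from loops.Cons[OF Cons.hyps(1,2) Cons.IH[OF Cons.prems]] show ?case by (simp add: algebra_simps)
qed simp

lemma runs_While: "loops a c s t s' \<Longrightarrow> reg s' a = 0 \<Longrightarrow> runs (While a c) s (t + 1) s'"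
proof (induction rule: loops.induct)
  case (Nil s)
  then show ?case using runs.While_False by simp
next
  case (Cons s t s1 t1 s2)
  from runs.While_True[OF Cons.hyps(1,2) Cons.IH[OF Cons.prems]] show ?case by (simp add: algebra_simps)
qed

definition reach :: "nat \<Rightarrow> com \<Rightarrow> nat \<Rightarrow> (store \<Rightarrow> bool) \<Rightarrow> store \<Rightarrow> bool" where
  "reach a c T Q s \<longleftrightarrow> (\<exists>t s'. loops a c s t s' \<and> t \<le> T \<and> Q s')"

lemma reach_step: "reg s a \<noteq> 0 \<Longrightarrow> wp c T Q s \<Longrightarrow> T + 2 \<le> T' \<Longrightarrow> reach a c T' Q s"
  unfolding reach_def wp_def using loops.Cons[OF _ _ loops.Nil] by fastforce

lemma reach_trans:
  assumes "reach a c T Q s" "\<And>s'. Q s' \<Longrightarrow> reach a c T' Q' s'" "T + T' \<le> T''"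
  shows "reach a c T'' Q' s"
proof -
  obtain t s' where "loops a c s t s'" "t \<le> T" "Q s'" using assms(1) unfolding reach_def by blast
  moreover then obtain t' s'' where "loops a c s' t' s''" "t' \<le> T'" "Q' s''" using assms(2) unfolding reach_def by blast
  ultimately show ?thesis unfolding reach_def using loops_trans assms(3) by (meson add_mono le_trans)
qed

lemma wp_While_reach:
  assumes "reach a c T Q s" "\<And>s'. Q s' \<Longrightarrow> reg s' a = 0" "T + 1 \<le> T'"
  shows "wp (While a c) T' Q s"
proof -
  obtain t s' where "loops a c s t s'" "t \<le> T" "Q s'" using assms(1) unfolding reach_def by blast
  then show ?thesis unfolding wp_def using runs_While assms(2,3) by fastforce
qed

section \<open>Loops over arrays\<close>

text \<open>The heap is left open; each rule describes its changes separately.\<close>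

definition keeps :: "nat set \<Rightarrow> store \<Rightarrow> store \<Rightarrow> bool" where
  "keeps X s s' \<longleftrightarrow> (\<forall>x. x \<notin> X \<longrightarrow> reg s' x = reg s x) \<and> out s' = out s"

lemma keepsD: "keeps X s s' \<Longrightarrow> x \<notin> X \<Longrightarrow> reg s' x = reg s x"
  unfolding keeps_def by blast

lemma keeps_out: "keeps X s s' \<Longrightarrow> out s' = out s"
  unfolding keeps_def by blast

definition fill_code :: com where
  "fill_code = While 15 (Do [Store 20 21, Add 20 20 3, Sub 15 15 3])"

lemma wp_fill:
  assumes "reg s 3 = 1" "num_regs \<le> reg s 20" "5 * reg s 15 + 1 \<le> T"
  shows "wp fill_code T (\<lambda>s'. keeps {15, 20} s s' \<and>
    heap s' = (\<lambda>y. if reg s 20 \<le> y \<and> y < reg s 20 + reg s 15 then reg s 21 else heap s y)) s"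
  unfolding fill_code_def
proof (rule wp_While_count[where m="reg s 15" and B=3 and
    I="\<lambda>i s'. keeps {15, 20} s s' \<and> reg s' 15 = reg s 15 - i \<and> reg s' 20 = reg s 20 + i \<and>
      heap s' = (\<lambda>y. if reg s 20 \<le> y \<and> y < reg s 20 + i then reg s 21 else heap s y)"])
  fix i s'
  assume i: "i < reg s 15"
    and I: "keeps {15, 20} s s' \<and> reg s' 15 = reg s 15 - i \<and> reg s' 20 = reg s 20 + i \<and>
      heap s' = (\<lambda>y. if reg s 20 \<le> y \<and> y < reg s 20 + i then reg s 21 else heap s y)"
  have r: "reg s' 3 = 1" "reg s' 21 = reg s 21" using I keepsD[of "{15, 20}" s s'] assms(1) by auto
  show "reg s' 15 \<noteq> 0 \<and> wp (Do [Store 20 21, Add 20 20 3, Sub 15 15 3]) 3 (\<lambda>s'. keeps {15, 20} s s' \<and>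
      reg s' 15 = reg s 15 - Suc i \<and> reg s' 20 = reg s 20 + Suc i \<and>
      heap s' = (\<lambda>y. if reg s 20 \<le> y \<and> y < reg s 20 + Suc i then reg s 21 else heap s y)) s'"
    using i I r assms(2) by (auto intro!: wp_Do simp: keeps_def fun_eq_iff)
qed (use assms in \<open>auto simp: keeps_def\<close>)

definition copy_code :: com where
  "copy_code = While 15 (Do [Load 16 14, Store 20 16, Add 14 14 3, Add 20 20 3, Sub 15 15 3])"

text \<open>The source ends before the target begins, so every word is still intact when it is
  read.\<close>

lemma wp_copy:
  assumes "reg s 3 = 1" "num_regs \<le> reg s 20" "num_regs \<le> reg s 14" "reg s 14 + reg s 15 \<le> reg s 20"
    "7 * reg s 15 + 1 \<le> T"
  shows "wp copy_code T (\<lambda>s'. keeps {14, 15, 16, 20} s s' \<and> reg s' 20 = reg s 20 + reg s 15 \<and>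
    heap s' = (\<lambda>y. if reg s 20 \<le> y \<and> y < reg s 20 + reg s 15 then heap s (reg s 14 + (y - reg s 20))
                   else heap s y)) s"
  unfolding copy_code_def
proof (rule wp_While_count[where m="reg s 15" and B=5 and
    I="\<lambda>i s'. keeps {14, 15, 16, 20} s s' \<and> reg s' 15 = reg s 15 - i \<and> reg s' 20 = reg s 20 + i \<and>
      reg s' 14 = reg s 14 + i \<and>
      heap s' = (\<lambda>y. if reg s 20 \<le> y \<and> y < reg s 20 + i then heap s (reg s 14 + (y - reg s 20)) else heap s y)"])
  fix i s'
  assume i: "i < reg s 15"
    and I: "keeps {14, 15, 16, 20} s s' \<and> reg s' 15 = reg s 15 - i \<and> reg s' 20 = reg s 20 + i \<and>
      reg s' 14 = reg s 14 + i \<and>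
      heap s' = (\<lambda>y. if reg s 20 \<le> y \<and> y < reg s 20 + i then heap s (reg s 14 + (y - reg s 20)) else heap s y)"
  have r: "reg s' 3 = 1" using I keepsD[of "{14, 15, 16, 20}" s s'] assms(1) by auto
  have "heap s' (reg s 14 + i) = heap s (reg s 14 + i)" using I i assms(4) by simp
  then show "reg s' 15 \<noteq> 0 \<and> wp (Do [Load 16 14, Store 20 16, Add 14 14 3, Add 20 20 3, Sub 15 15 3]) 5
      (\<lambda>s'. keeps {14, 15, 16, 20} s s' \<and> reg s' 15 = reg s 15 - Suc i \<and> reg s' 20 = reg s 20 + Suc i \<and>
      reg s' 14 = reg s 14 + Suc i \<and> heap s' =
        (\<lambda>y. if reg s 20 \<le> y \<and> y < reg s 20 + Suc i then heap s (reg s 14 + (y - reg s 20)) else heap s y)) s'"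
    using i I r assms(2,3) by (auto intro!: wp_Do simp: keeps_def fun_eq_iff)
qed (use assms in \<open>auto simp: keeps_def\<close>)

definition ramp_code :: com where
  "ramp_code = While 15 (Do [Store 20 21, Add 20 20 3, Add 21 21 3, Sub 15 15 3])"

lemma wp_ramp:
  assumes "reg s 3 = 1" "num_regs \<le> reg s 20" "6 * reg s 15 + 1 \<le> T"
  shows "wp ramp_code T (\<lambda>s'. keeps {15, 20, 21} s s' \<and>
    heap s' = (\<lambda>y. if reg s 20 \<le> y \<and> y < reg s 20 + reg s 15 then reg s 21 + (y - reg s 20) else heap s y)) s"
  unfolding ramp_code_def
proof (rule wp_While_count[where m="reg s 15" and B=4 and
    I="\<lambda>i s'. keeps {15, 20, 21} s s' \<and> reg s' 15 = reg s 15 - i \<and> reg s' 20 = reg s 20 + i \<and>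
      reg s' 21 = reg s 21 + i \<and>
      heap s' = (\<lambda>y. if reg s 20 \<le> y \<and> y < reg s 20 + i then reg s 21 + (y - reg s 20) else heap s y)"])
  fix i s'
  assume i: "i < reg s 15"
    and I: "keeps {15, 20, 21} s s' \<and> reg s' 15 = reg s 15 - i \<and> reg s' 20 = reg s 20 + i \<and>
      reg s' 21 = reg s 21 + i \<and>
      heap s' = (\<lambda>y. if reg s 20 \<le> y \<and> y < reg s 20 + i then reg s 21 + (y - reg s 20) else heap s y)"
  have r: "reg s' 3 = 1" using I keepsD[of "{15, 20, 21}" s s'] assms(1) by auto
  show "reg s' 15 \<noteq> 0 \<and> wp (Do [Store 20 21, Add 20 20 3, Add 21 21 3, Sub 15 15 3]) 4
      (\<lambda>s'. keeps {15, 20, 21} s s' \<and> reg s' 15 = reg s 15 - Suc i \<and> reg s' 20 = reg s 20 + Suc i \<and>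
      reg s' 21 = reg s 21 + Suc i \<and> heap s' =
        (\<lambda>y. if reg s 20 \<le> y \<and> y < reg s 20 + Suc i then reg s 21 + (y - reg s 20) else heap s y)) s'"
    using i I r assms(2) by (auto intro!: wp_Do simp: keeps_def fun_eq_iff)
qed (use assms in \<open>auto simp: keeps_def\<close>)

text \<open>Truncated subtraction serves as a comparison: entry minus threshold is nonzero iff the
  entry exceeds the threshold.\<close>

definition count_code :: com where
  "count_code = Do [Const 18 0, Const 14 2, Add 14 14 8, Add 15 4 2] ;;
     While 15 (Do [Load 16 14, Sub 16 16 19, Add 14 14 3, Sub 15 15 3] ;;
               Cond 16 (Do [Add 18 18 3]) (Do []))"

lemma wp_count:
  assumes "reg s 3 = 1" "reg s 2 = 0" "num_regs \<le> reg s 8" "length f = reg s 4"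
    "\<And>t. t < length f \<Longrightarrow> heap s (reg s 8 + 2 + t) = f ! t" "9 * reg s 4 + 5 \<le> T"
  shows "wp count_code T (\<lambda>s'. keeps {14, 15, 16, 18} s s' \<and> heap s' = heap s \<and>
    reg s' 18 = count_above f (reg s 19)) s"
  unfolding count_code_def
proof (rule wp_Seq[where T=4 and T'="9 * reg s 4 + 1"])
  let ?I = "\<lambda>i s'. keeps {14, 15, 16, 18} s s' \<and> heap s' = heap s \<and> reg s' 15 = reg s 4 - i \<and>
    reg s' 14 = reg s 8 + 2 + i \<and> reg s' 18 = count_above (take i f) (reg s 19)"
  let ?body = "Do [Load 16 14, Sub 16 16 19, Add 14 14 3, Sub 15 15 3] ;; Cond 16 (Do [Add 18 18 3]) (Do [])"
  have step: "reg s' 15 \<noteq> 0 \<and> wp ?body 7 (?I (Suc i)) s'" if i: "i < reg s 4" and I: "?I i s'" for i s'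
  proof -
    have r: "reg s' 3 = 1" "reg s' 19 = reg s 19" using I keepsD[of "{14, 15, 16, 18}" s s'] assms(1) by auto
    have h: "heap s' (reg s 8 + 2 + i) = f ! i" using I i assms(4,5) by simp
    have take: "take (Suc i) f = take i f @ [f ! i]" using i assms(4) by (simp add: take_Suc_conv_app_nth)
    have "wp ?body 7 (?I (Suc i)) s'"
      by (rule wp_Seq[where T=4 and T'=3])
        (use i I r h assms(3) in \<open>auto intro!: wp_Do wp_Cond[where T=1] simp: keeps_def take\<close>)
    then show ?thesis using i I by simp
  qed
  have loop: "wp (While 15 ?body) (9 * reg s 4 + 1) (\<lambda>s'. keeps {14, 15, 16, 18} s s' \<and> heap s' = heap s \<and>
    reg s' 18 = count_above f (reg s 19)) s'" if "?I 0 s'" for s'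
    by (rule wp_While_count[where m="reg s 4" and B=7 and I="?I"]) (use that step assms(4) in auto)
  show "wp (Do [Const 18 0, Const 14 2, Add 14 14 8, Add 15 4 2]) 4
      (wp (While 15 ?body) (9 * reg s 4 + 1) (\<lambda>s'. keeps {14, 15, 16, 18} s s' \<and> heap s' = heap s \<and>
    reg s' 18 = count_above f (reg s 19))) s"
    by (rule wp_Do[OF _ _ loop]) (use assms(2) in \<open>auto simp: keeps_def\<close>)
qed (use assms in auto)

text \<open>Pairs are written downwards since strut \<open>i\<close> belongs at position
  \<open>j - 1 - i\<close>. Register \<open>14\<close> advances by \<open>q\<close> from foot to
  foot, as all shifts are equal here.\<close>

definition struts_code :: com where
  "struts_code =
     While 15 (Do [Sub 20 20 3, Store 20 21, Sub 20 20 3, Load 16 14, Store 20 16, Add 14 14 4, Sub 15 15 3])"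

lemma wp_struts:
  assumes "reg s 3 = 1" "num_regs + 2 * reg s 15 \<le> reg s 20" "reg s 20 \<le> reg s 14" "9 * reg s 15 + 1 \<le> T"
  shows "wp struts_code T (\<lambda>s'. keeps {14, 15, 16, 20} s s' \<and>
    (\<forall>y. \<not> (reg s 20 - 2 * reg s 15 \<le> y \<and> y < reg s 20) \<longrightarrow> heap s' y = heap s y) \<and>
    (\<forall>i<reg s 15. heap s' (reg s 20 - 2 * i - 1) = reg s 21 \<and>
       heap s' (reg s 20 - 2 * i - 2) = heap s (reg s 14 + reg s 4 * i))) s"
  unfolding struts_code_def
proof (rule wp_While_count[where m="reg s 15" and B=7 and
    I="\<lambda>i s'. keeps {14, 15, 16, 20} s s' \<and> reg s' 15 = reg s 15 - i \<and> reg s' 20 = reg s 20 - 2 * i \<and>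
      reg s' 14 = reg s 14 + reg s 4 * i \<and>
      (\<forall>y. \<not> (reg s 20 - 2 * i \<le> y \<and> y < reg s 20) \<longrightarrow> heap s' y = heap s y) \<and>
      (\<forall>j<i. heap s' (reg s 20 - 2 * j - 1) = reg s 21 \<and>
         heap s' (reg s 20 - 2 * j - 2) = heap s (reg s 14 + reg s 4 * j))"])
  fix i s'
  assume i: "i < reg s 15"
    and I: "keeps {14, 15, 16, 20} s s' \<and> reg s' 15 = reg s 15 - i \<and> reg s' 20 = reg s 20 - 2 * i \<and>
      reg s' 14 = reg s 14 + reg s 4 * i \<and>
      (\<forall>y. \<not> (reg s 20 - 2 * i \<le> y \<and> y < reg s 20) \<longrightarrow> heap s' y = heap s y) \<and>
      (\<forall>j<i. heap s' (reg s 20 - 2 * j - 1) = reg s 21 \<and>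
         heap s' (reg s 20 - 2 * j - 2) = heap s (reg s 14 + reg s 4 * j))"
  have r: "reg s' 3 = 1" "reg s' 4 = reg s 4" "reg s' 21 = reg s 21"
    using I keepsD[of "{14, 15, 16, 20}" s s'] assms(1) by auto
  have a: "num_regs + 2 * i + 2 \<le> reg s 20" using assms(2) i by linarith
  define a where "a = reg s 20 - 2 * i - 2"
  have a20: "reg s 20 = a + 2 * i + 2" "num_regs \<le> a" using a unfolding a_def by linarith+
  define x where "x = heap s (reg s 14 + reg s 4 * i)"
  have x: "heap s' (reg s 14 + reg s 4 * i) = x" using I assms(3) a20 unfolding x_def by auto
  define h where "h = (heap s')(Suc a := reg s 21, a := x)"
  have body: "wp (Do [Sub 20 20 3, Store 20 21, Sub 20 20 3, Load 16 14, Store 20 16, Add 14 14 4, Sub 15 15 3]) 7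
      (\<lambda>s''. keeps {14, 15, 16, 20} s s'' \<and> reg s'' 15 = reg s 15 - Suc i \<and> reg s'' 20 = a \<and>
        reg s'' 14 = reg s 14 + reg s 4 * Suc i \<and> heap s'' = h) s'"
    using i I r a20 x assms(3) by (auto intro!: wp_Do simp: keeps_def h_def)
  have h1: "h y = heap s y" if "\<not> (a \<le> y \<and> y < reg s 20)" for y
    using that I a20 unfolding h_def by auto
  have h2: "h (reg s 20 - 2 * j - 1) = reg s 21 \<and> h (reg s 20 - 2 * j - 2) = heap s (reg s 14 + reg s 4 * j)"
    if "j < Suc i" for j
  proof (cases "j = i")
    case True
    then show ?thesis using a20 unfolding h_def x_def by simp
  next
    case False
    then have "j < i" using that by simp
    then have "reg s 20 - 2 * j - 1 > Suc a" "reg s 20 - 2 * j - 2 > Suc a" using a20 by linarith+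
    then show ?thesis using I \<open>j < i\<close> unfolding h_def by auto
  qed
  show "reg s' 15 \<noteq> 0 \<and> wp (Do [Sub 20 20 3, Store 20 21, Sub 20 20 3, Load 16 14, Store 20 16, Add 14 14 4, Sub 15 15 3]) 7
      (\<lambda>s'. keeps {14, 15, 16, 20} s s' \<and> reg s' 15 = reg s 15 - Suc i \<and> reg s' 20 = reg s 20 - 2 * Suc i \<and>
      reg s' 14 = reg s 14 + reg s 4 * Suc i \<and>
      (\<forall>y. \<not> (reg s 20 - 2 * Suc i \<le> y \<and> y < reg s 20) \<longrightarrow> heap s' y = heap s y) \<and>
      (\<forall>j<Suc i. heap s' (reg s 20 - 2 * j - 1) = reg s 21 \<and>
         heap s' (reg s 20 - 2 * j - 2) = heap s (reg s 14 + reg s 4 * j))) s'"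
  proof (rule conjI)
    show "reg s' 15 \<noteq> 0" using i I by simp
    have "a = reg s 20 - 2 * Suc i" unfolding a_def by simp
    then show "wp (Do [Sub 20 20 3, Store 20 21, Sub 20 20 3, Load 16 14, Store 20 16, Add 14 14 4, Sub 15 15 3]) 7
      (\<lambda>s'. keeps {14, 15, 16, 20} s s' \<and> reg s' 15 = reg s 15 - Suc i \<and> reg s' 20 = reg s 20 - 2 * Suc i \<and>
      reg s' 14 = reg s 14 + reg s 4 * Suc i \<and>
      (\<forall>y. \<not> (reg s 20 - 2 * Suc i \<le> y \<and> y < reg s 20) \<longrightarrow> heap s' y = heap s y) \<and>
      (\<forall>j<Suc i. heap s' (reg s 20 - 2 * j - 1) = reg s 21 \<and>
         heap s' (reg s 20 - 2 * j - 2) = heap s (reg s 14 + reg s 4 * j))) s'"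
      by (intro wp_mono[OF body order_refl]) (use h1 h2 in metis)
  qed
qed (use assms in \<open>auto simp: keeps_def\<close>)

lemma wp_Seq':
  assumes "wp c T P s" "\<And>s'. P s' \<Longrightarrow> wp c' T' Q s'" "T + T' \<le> T''"
  shows "wp (c ;; c') T'' Q s"
  using wp_Seq[OF wp_mono[OF assms(1) order_refl assms(2)] assms(3)] .

section \<open>The program\<close>

text \<open>
  Registers: \<open>0\<close> and \<open>1\<close> the input, \<open>2\<close> zero, \<open>3\<close> one, \<open>4\<close> the number \<open>q\<close>, \<open>5\<close> the size of a memory
  region, \<open>6\<close> the region with the multiples of \<open>q\<close> and the parities, \<open>7\<close> the region with the diagonals,
  \<open>8\<close> the region of the current level, \<open>9\<close> the current level, \<open>10\<close> the mode (\<open>1\<close> on the way down the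
  tree, \<open>2\<close> on the way up, \<open>0\<close> at the end), \<open>11\<close> the end of the used part of region \<open>7\<close>, \<open>12\<close> the
  top vertex, \<open>13\<close> the number of levels below the current one.

  The region of a level holds the direction, the number of fan cells, the code of the
  current child followed by a zero, and the link.
\<close>

definition count_last_code :: com where
  "count_last_code = Do [Const 14 1, Add 14 14 4, Add 14 14 8, Load 19 14] ;; count_code"

text \<open>In the absence of multiplication, \<open>q * m\<close> is read from the table, at entry
  \<open>2 * m\<close> of the region in register \<open>6\<close>.\<close>

definition copy_link_code :: com where
  "copy_link_code =
     Do [Add 22 6 19, Add 22 22 19, Load 22 22, Add 15 22 18, Add 15 15 3,
         Const 14 3, Add 14 14 4, Add 14 14 8, Add 20 14 5] ;;
     copy_code ;; Do [Sub 15 4 18, Add 21 12 18] ;; ramp_code"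

text \<open>The first code on a new level is one of the two constant ones, as selected by the
  direction bit; hence a single fill suffices.\<close>

definition descend_code :: com where
  "descend_code =
     Do [Add 8 8 5, Add 9 9 3, Sub 13 13 3, Add 12 12 4, Add 11 11 3, Add 11 11 3,
         Add 23 19 3, Add 14 8 3, Store 14 23, Load 22 8] ;;
     Cond 22 (Do [Add 21 23 2]) (Do [Const 21 0]) ;;
     Do [Const 20 2, Add 20 20 8, Add 15 4 2] ;; fill_code"

definition write_struts_code :: com where
  "write_struts_code =
     Do [Const 14 3, Add 14 14 4, Add 14 14 8, Add 21 12 2, Add 20 11 2, Add 15 23 2] ;;
     Cond 22 (Do [Add 14 14 4, Add 21 21 4]) (Do []) ;; struts_code"

definition init_code :: com where
  "init_code = count_last_code ;; copy_link_code ;; descend_code ;; write_struts_code"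

section \<open>Memory layout and invariants on its contents\<close>

context dissecting
begin

text \<open>Large enough for every kind of region: \<open>3 + q\<close> words and a link of at most
  \<open>q * n + 1\<close> vertices for a level, \<open>2 * (n + 1)\<close> words for the table, and
  fewer for the diagonals. With a common size, changing the level is one addition or
  subtraction.\<close>

definition stride :: "nat \<Rightarrow> nat" where
  "stride n = q * (n + 1) + 2 * n + 8"

definition adr :: "nat \<Rightarrow> nat \<Rightarrow> nat \<Rightarrow> nat" where
  "adr n x i = num_regs + x * stride n + i"

text \<open>The region of a level, after the table and the diagonals.\<close>

definition lv :: "nat \<Rightarrow> nat" where
  "lv j = j + 2"

lemma lv_neq: "lv j \<noteq> 0" "lv j \<noteq> 1" "0 \<noteq> lv j" "1 \<noteq> lv j" "lv j = lv j' \<longleftrightarrow> j = j'"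
  unfolding lv_def by auto

lemma adr_range:
  assumes "i' < stride n" "i + m \<le> stride n"
  shows "adr n x i \<le> adr n x' i' \<and> adr n x' i' < adr n x i + m \<longleftrightarrow> x' = x \<and> i \<le> i' \<and> i' < i + m"
proof (cases x x' rule: linorder_cases)
  case less
  then have "Suc x * stride n \<le> x' * stride n" by (intro mult_le_mono) auto
  then show ?thesis using assms less unfolding adr_def by auto
next
  case greater
  then have "Suc x' * stride n \<le> x * stride n" by (intro mult_le_mono) auto
  then show ?thesis using assms greater unfolding adr_def by auto
next
  case equal
  then show ?thesis unfolding adr_def by auto
qed

lemma adr_eq_iff:
  assumes "i < stride n" "i' < stride n"
  shows "adr n x i = adr n x' i' \<longleftrightarrow> x = x' \<and> i = i'"
  using adr_range[of i' n i 1 x x'] assms by auto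

lemma num_regs_le_adr: "num_regs \<le> adr n x i"
  unfolding adr_def by simp

lemma adr_add: "adr n x i + i' = adr n x (i + i')"
  unfolding adr_def by simp

lemma adr_simps: "Suc (adr n x i) = adr n x (Suc i)" "adr n x i + i' = adr n x (i + i')"
  "i' + adr n x i = adr n x (i' + i)" "adr n x (Suc (Suc 0)) = adr n x 2"
  unfolding adr_def by simp_all

lemma adr_Suc_level: "adr n (lv j) i + stride n = adr n (lv (Suc j)) i"
  unfolding adr_def lv_def by simp

text \<open>On level \<open>j\<close> the array holds the diagonals of the current child, which has
  \<open>j + 1\<close> cells and so \<open>j\<close> diagonals; hence the end \<open>2 * j\<close>
  in register \<open>11\<close>.\<close>

definition regs_ok :: "nat \<Rightarrow> nat \<Rightarrow> nat \<Rightarrow> store \<Rightarrow> bool" where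
  "regs_ok n j M s \<longleftrightarrow> reg s 2 = 0 \<and> reg s 3 = 1 \<and> reg s 4 = q \<and> reg s 5 = stride n \<and>
     reg s 6 = adr n 0 0 \<and> reg s 7 = adr n 1 0 \<and> reg s 8 = adr n (lv j) 0 \<and> reg s 9 = j \<and>
     reg s 10 = M \<and> reg s 11 = adr n 1 (2 * j) \<and> reg s 12 = top_vertex j \<and> reg s 13 = n - 1 - j"

lemma regs_okD:
  assumes "regs_ok n j M s"
  shows "reg s 2 = 0" "reg s 3 = 1" "reg s 4 = q" "reg s 5 = stride n" "reg s 6 = adr n 0 0"
    "reg s 7 = adr n 1 0" "reg s 8 = adr n (lv j) 0" "reg s 9 = j" "reg s 10 = M"
    "reg s 11 = adr n 1 (2 * j)" "reg s 12 = top_vertex j" "reg s 13 = n - 1 - j"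
  using assms unfolding regs_ok_def by auto

lemma regs_ok_keeps:
  assumes "regs_ok n j M s" "keeps X s s'" "X \<subseteq> {14..}"
  shows "regs_ok n j M s'"
proof -
  have "reg s' x = reg s x" if "x < 14" for x using assms(2,3) that unfolding keeps_def by force
  then show ?thesis using assms(1) unfolding regs_ok_def by simp
qed

definition tables_ok :: "nat \<Rightarrow> (nat \<Rightarrow> nat) \<Rightarrow> bool" where
  "tables_ok n h \<longleftrightarrow> (\<forall>i\<le>n. h (adr n 0 (2 * i)) = q * i \<and> h (adr n 0 (2 * i + 1)) = i mod 2)"

definition level_ok :: "nat \<Rightarrow> (nat \<Rightarrow> nat) \<Rightarrow> nat \<Rightarrow> nat list \<Rightarrow> nat list \<Rightarrow> bool" where
  "level_ok n h j w f \<longleftrightarrow> h (adr n (lv j) 1) = fan_size w \<and> (\<forall>t<q. h (adr n (lv j) (2 + t)) = f ! t) \<and>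
     h (adr n (lv j) (2 + q)) = 0 \<and> (\<forall>i\<le>q * fan_size w. h (adr n (lv j) (3 + q + i)) = w ! i)"

definition slot_ok :: "nat \<Rightarrow> (nat \<Rightarrow> nat) \<Rightarrow> nat \<Rightarrow> nat \<times> nat \<Rightarrow> bool" where
  "slot_ok n h i p \<longleftrightarrow> h (adr n 1 (2 * i)) = fst p \<and> h (adr n 1 (2 * i + 1)) = snd p"

text \<open>The positions of the struts below \<open>last f\<close> are lent to deeper levels, which
  overwrite them. In general only the struts from \<open>last f\<close> on can be relied on;
  \<open>lo = 0\<close> is for a freshly initialized level and for the last one, where nothing lies
  deeper.\<close>

definition slots_ok :: "nat \<Rightarrow> (nat \<Rightarrow> nat) \<Rightarrow> nat \<Rightarrow> node \<Rightarrow> nat list \<Rightarrow> nat \<Rightarrow> bool" where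
  "slots_ok n h j nd f lo \<longleftrightarrow> (\<forall>i<length (fst nd). slot_ok n h i (fst nd ! i)) \<and>
     (\<forall>i. lo \<le> i \<longrightarrow> i < fan_size (snd nd) \<longrightarrow> slot_ok n h (j - 1 - i) (strut_pair j (snd nd) f i))"

definition coded :: "nat \<Rightarrow> nat \<Rightarrow> node \<Rightarrow> nat list \<Rightarrow> bool" where
  "coded n j nd f \<longleftrightarrow> length (fst nd) + fan_size (snd nd) = j \<and>
     length (snd nd) = q * fan_size (snd nd) + 1 \<and> bounded_code (fan_size (snd nd)) f \<and> j < n"

lemma codedD:
  assumes "coded n j nd f"
  shows "last f \<le> fan_size (snd nd)" "count_above f (last f) < q" "fan_size (snd nd) \<le> j" "j < n"
    "length f = q" "q * last f + count_above f (last f) + 1 \<le> length (snd nd)" "f \<noteq> []" "last f < n"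
proof -
  have c: "length (snd nd) = q * fan_size (snd nd) + 1" "bounded_code (fan_size (snd nd)) f"
    using assms unfolding coded_def by auto
  note b = bounded_code_above[OF c(2)]
  show le: "last f \<le> fan_size (snd nd)" by (rule b(2))
  show lt: "count_above f (last f) < q" by (rule b(4)) simp
  show j: "fan_size (snd nd) \<le> j" "j < n" using assms unfolding coded_def by auto
  then show "last f < n" using le by simp
  show len: "length f = q" using c(2) unfolding bounded_code_def by simp
  then show "f \<noteq> []" using q_pos by auto
  show "q * last f + count_above f (last f) + 1 \<le> length (snd nd)"
  proof (cases "last f = fan_size (snd nd)")
    case True
    then show ?thesis using c(1) b(5)[of "last f"] by simp
  next
    case False
    then have "q * Suc (last f) \<le> q * fan_size (snd nd)" using le by (intro mult_le_mono) auto
    then show ?thesis using c(1) lt by simp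
  qed
qed

lemma level_size: "r \<le> n \<Longrightarrow> i \<le> q * r \<Longrightarrow> 3 + q + i < stride n"
proof -
  assume "r \<le> n" "i \<le> q * r"
  then have "i \<le> q * n" by (meson le_trans mult_le_mono2)
  then show ?thesis unfolding stride_def by simp
qed

section \<open>Descending to a child\<close>

lemma wp_count_last:
  assumes regs: "regs_ok n j M s" and level: "level_ok n (heap s) j (snd nd) f" and "coded n j nd f"
    and T: "9 * q + 9 \<le> T"
  shows "wp count_last_code T (\<lambda>s'. keeps {14, 15, 16, 18, 19} s s' \<and> heap s' = heap s \<and>
    reg s' 19 = last f \<and> reg s' 18 = count_above f (last f)) s"
proof -
  note r = regs_okD[OF regs]
  note c = codedD[OF assms(3)]
  have last: "heap s (adr n (lv j) (q + 1)) = last f"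
  proof -
    have "2 + (q - 1) = q + 1" using q_pos by simp
    then have "heap s (adr n (lv j) (q + 1)) = f ! (q - 1)" using level q_pos unfolding level_ok_def
      by (metis diff_less less_le_trans zero_less_one)
    then show ?thesis using c(5,7) by (simp add: last_conv_nth)
  qed
  have f: "heap s (adr n (lv j) 0 + 2 + t) = f ! t" if "t < length f" for t
    using level that c(5) unfolding level_ok_def adr_add by simp
  have addr: "Suc (q + adr n (lv j) 0) = adr n (lv j) (q + 1)" unfolding adr_def by simp
  show ?thesis
    unfolding count_last_code_def
  proof (rule wp_Seq'[where T=4 and T'="9 * q + 5" and P="\<lambda>s'. keeps {14, 19} s s' \<and> heap s' = heap s \<and> reg s' 19 = last f"])
    show "wp (Do [Const 14 1, Add 14 14 4, Add 14 14 8, Load 19 14]) 4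
        (\<lambda>s'. keeps {14, 19} s s' \<and> heap s' = heap s \<and> reg s' 19 = last f) s"
      using last by (intro wp_Do) (simp_all add: r keeps_def addr num_regs_le_adr)
  next
    fix s1 assume s1: "keeps {14, 19} s s1 \<and> heap s1 = heap s \<and> reg s1 19 = last f"
    have r1: "reg s1 3 = 1" "reg s1 2 = 0" "reg s1 8 = adr n (lv j) 0" "reg s1 4 = q"
      using s1 by (simp_all add: keeps_def r)
    have "wp count_code (9 * q + 5) (\<lambda>s'. keeps {14, 15, 16, 18} s1 s' \<and> heap s' = heap s1 \<and>
        reg s' 18 = count_above f (reg s1 19)) s1"
      by (rule wp_count) (use s1 f in \<open>simp_all add: r1 c(5) num_regs_le_adr\<close>)
    then show "wp count_code (9 * q + 5) (\<lambda>s'. keeps {14, 15, 16, 18, 19} s s' \<and> heap s' = heap s \<and>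
        reg s' 19 = last f \<and> reg s' 18 = count_above f (last f)) s1"
      by (rule wp_mono) (use s1 in \<open>auto simp: keeps_def\<close>)
  qed (use T in simp)
qed

lemma wp_copy_link:
  assumes regs: "regs_ok n j M s" and tables: "tables_ok n (heap s)" and level: "level_ok n (heap s) j w f"
    and m: "reg s 19 = m" "reg s 18 = d" "m < n" "d < q" "q * m + d \<le> q * fan_size w" "fan_size w < n"
    and T: "7 * (q * m + q) + 6 * q + 13 \<le> T"
  shows "wp copy_link_code T (\<lambda>s'. keeps {14, 15, 16, 20, 21, 22} s s' \<and>
    (\<forall>x i. i < stride n \<longrightarrow> x \<noteq> lv (Suc j) \<or> i < 3 + q \<longrightarrow> heap s' (adr n x i) = heap s (adr n x i)) \<and>
    (\<forall>i\<le>q * (m + 1). heap s' (adr n (lv (Suc j)) (3 + q + i)) =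
       (if i \<le> q * m + d then w ! i else top_vertex j + (i - q * m - 1)))) s"
proof -
  note r = regs_okD[OF regs]
  have qm: "heap s (adr n 0 (2 * m)) = q * m" using tables m(3) unfolding tables_ok_def by simp
  have addr: "adr n 0 0 + m + m = adr n 0 (2 * m)" "3 + q + adr n (lv j) 0 = adr n (lv j) (3 + q)"
    "adr n (lv j) (3 + q) + stride n = adr n (lv (Suc j)) (3 + q)"
    unfolding adr_def lv_def by simp_all
  let ?a = "adr n (lv j) (3 + q)" and ?a' = "adr n (lv (Suc j)) (3 + q)"
  have size: "3 + q + q * (m + 1) < stride n" by (rule level_size[of "m + 1"]) (use m(3) in simp_all)
  have cm: "q * m + d + 1 \<le> q * (m + 1)" using m(4) by simp
  define P1 where "P1 s' \<longleftrightarrow> keeps {14, 15, 20, 22} s s' \<and> heap s' = heap s \<and> reg s' 15 = q * m + d + 1 \<and>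
    reg s' 14 = ?a \<and> reg s' 20 = ?a'" for s'
  define P2 where "P2 s' \<longleftrightarrow> keeps {14, 15, 16, 20, 22} s s' \<and> reg s' 20 = ?a' + (q * m + d + 1) \<and>
    heap s' = (\<lambda>y. if ?a' \<le> y \<and> y < ?a' + (q * m + d + 1) then heap s (?a + (y - ?a')) else heap s y)" for s'
  define P3 where "P3 s' \<longleftrightarrow> keeps {14, 15, 16, 20, 21, 22} s s' \<and> reg s' 20 = ?a' + (q * m + d + 1) \<and>
    reg s' 15 = q - d \<and> reg s' 21 = top_vertex j + d \<and>
    heap s' = (\<lambda>y. if ?a' \<le> y \<and> y < ?a' + (q * m + d + 1) then heap s (?a + (y - ?a')) else heap s y)" for s'
  have 1: "wp (Do [Add 22 6 19, Add 22 22 19, Load 22 22, Add 15 22 18, Add 15 15 3,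
         Const 14 3, Add 14 14 4, Add 14 14 8, Add 20 14 5]) 9 P1 s"
    using qm by (intro wp_Do) (simp_all add: r m(1,2) P1_def keeps_def addr num_regs_le_adr)
  have 2: "wp copy_code (7 * (q * m + d + 1) + 1) P2 s1" if "P1 s1" for s1
  proof -
    have s1: "keeps {14, 15, 20, 22} s s1" "heap s1 = heap s" "reg s1 15 = q * m + d + 1"
      "reg s1 14 = ?a" "reg s1 20 = ?a'" using that unfolding P1_def by auto
    have "?a + (q * m + d + 1) \<le> ?a'" using addr(3) size cm by linarith
    moreover have "reg s1 3 = 1" using s1(1) by (simp add: keeps_def r)
    ultimately have "wp copy_code (7 * reg s1 15 + 1) (\<lambda>s'. keeps {14, 15, 16, 20} s1 s' \<and>
        reg s' 20 = reg s1 20 + reg s1 15 \<and>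
        heap s' = (\<lambda>y. if reg s1 20 \<le> y \<and> y < reg s1 20 + reg s1 15 then heap s1 (reg s1 14 + (y - reg s1 20))
                   else heap s1 y)) s1"
      by (intro wp_copy) (simp_all add: s1 num_regs_le_adr)
    then show ?thesis unfolding s1(2-5)
      by (rule wp_mono) (use s1(1) in \<open>auto simp: P2_def keeps_def\<close>)
  qed
  have 3: "wp (Do [Sub 15 4 18, Add 21 12 18]) 2 P3 s2" if "P2 s2" for s2
  proof -
    have s2: "keeps {14, 15, 16, 20, 22} s s2" using that unfolding P2_def by auto
    then have "reg s2 4 = q" "reg s2 18 = d" "reg s2 12 = top_vertex j"
      by (simp_all add: keeps_def r m)
    then show ?thesis using that by (intro wp_Do) (simp_all add: P2_def P3_def keeps_def)
  qed
  have 4: "wp ramp_code (6 * q + 1) (\<lambda>s'. keeps {14, 15, 16, 20, 21, 22} s s' \<and>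
    (\<forall>x i. i < stride n \<longrightarrow> x \<noteq> lv (Suc j) \<or> i < 3 + q \<longrightarrow> heap s' (adr n x i) = heap s (adr n x i)) \<and>
    (\<forall>i\<le>q * (m + 1). heap s' (adr n (lv (Suc j)) (3 + q + i)) =
       (if i \<le> q * m + d then w ! i else top_vertex j + (i - q * m - 1)))) s3" if "P3 s3" for s3
  proof -
    let ?c = "q * m + d + 1"
    have s3: "keeps {14, 15, 16, 20, 21, 22} s s3" "reg s3 20 = ?a' + ?c" "reg s3 15 = q - d"
      "reg s3 21 = top_vertex j + d"
      "heap s3 = (\<lambda>y. if ?a' \<le> y \<and> y < ?a' + ?c then heap s (?a + (y - ?a')) else heap s y)"
      using that unfolding P3_def by auto
    have "reg s3 3 = 1" using s3(1) by (simp add: keeps_def r)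
    then have "wp ramp_code (6 * q + 1) (\<lambda>s'. keeps {15, 20, 21} s3 s' \<and>
       heap s' = (\<lambda>y. if reg s3 20 \<le> y \<and> y < reg s3 20 + reg s3 15 then reg s3 21 + (y - reg s3 20)
                      else heap s3 y)) s3"
      using num_regs_le_adr[of n "lv (Suc j)" "3 + q"] by (intro wp_ramp) (simp_all add: s3(2,3))
    then show ?thesis
    proof (rule wp_mono[OF _ order_refl])
      fix s' assume "keeps {15, 20, 21} s3 s' \<and>
         heap s' = (\<lambda>y. if reg s3 20 \<le> y \<and> y < reg s3 20 + reg s3 15 then reg s3 21 + (y - reg s3 20)
                        else heap s3 y)"
      then have k: "keeps {15, 20, 21} s3 s'" and h: "heap s' =
         (\<lambda>y. if reg s3 20 \<le> y \<and> y < reg s3 20 + reg s3 15 then reg s3 21 + (y - reg s3 20) else heap s3 y)"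
        by auto
      have "keeps {14, 15, 16, 20, 21, 22} s s'" using s3(1) k by (auto simp: keeps_def)
      moreover have "heap s' (adr n x i) = heap s (adr n x i)"
        if i: "i < stride n" and x: "x \<noteq> lv (Suc j) \<or> i < 3 + q" for x i
      proof -
        have "\<not> (?a' \<le> adr n x i \<and> adr n x i < ?a' + ?c)"
          using adr_range[of i n "3 + q" ?c "lv (Suc j)" x] i x size cm by auto
        moreover have "\<not> (adr n (lv (Suc j)) (3 + q + ?c) \<le> adr n x i \<and> adr n x i < adr n (lv (Suc j)) (3 + q + ?c) + (q - d))"
          using adr_range[of i n "3 + q + ?c" "q - d" "lv (Suc j)" x] i x size cm m(4) by auto
        ultimately show ?thesis unfolding h s3(2,3,5) adr_add by auto
      qed
      moreover have "heap s' (adr n (lv (Suc j)) (3 + q + i)) =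
         (if i \<le> q * m + d then w ! i else top_vertex j + (i - q * m - 1))" if i: "i \<le> q * (m + 1)" for i
      proof (cases "i \<le> q * m + d")
        case True
        then have "i \<le> q * fan_size w" using m(5) by simp
        then have "heap s (adr n (lv j) (3 + q + i)) = w ! i" using level unfolding level_ok_def by simp
        moreover have "heap s' (?a' + i) = heap s (?a + i)" using True unfolding h s3(2,3,5) by auto
        ultimately show ?thesis using True by (simp add: adr_add)
      next
        case False
        have "heap s' (?a' + i) = top_vertex j + d + (i - ?c)"
          using False i m(4) unfolding h s3(2-5) by auto
        then show ?thesis using False by (simp add: adr_add)
      qed
      ultimately show "keeps {14, 15, 16, 20, 21, 22} s s' \<and>
        (\<forall>x i. i < stride n \<longrightarrow> x \<noteq> lv (Suc j) \<or> i < 3 + q \<longrightarrow> heap s' (adr n x i) = heap s (adr n x i)) \<and>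
        (\<forall>i\<le>q * (m + 1). heap s' (adr n (lv (Suc j)) (3 + q + i)) =
           (if i \<le> q * m + d then w ! i else top_vertex j + (i - q * m - 1)))" by blast
    qed
  qed
  show ?thesis
    unfolding copy_link_code_def
    by (rule wp_Seq'[OF 1 wp_Seq'[OF 2 wp_Seq'[OF 3 4 order_refl] order_refl]]) (use T cm in simp_all)
qed

lemma wp_descend:
  assumes regs: "regs_ok n j M s" and j: "Suc j < n" and m: "reg s 19 = m" and T: "5 * q + 17 \<le> T"
  defines "b \<equiv> heap s (adr n (lv (Suc j)) 0)"
  shows "wp descend_code T (\<lambda>s'. regs_ok n (Suc j) M s' \<and> out s' = out s \<and> reg s' 22 = b \<and> reg s' 23 = m + 1 \<and>
    (\<forall>x i. i < stride n \<longrightarrow> x \<noteq> lv (Suc j) \<or> i = 0 \<or> 2 + q \<le> i \<longrightarrow> heap s' (adr n x i) = heap s (adr n x i)) \<and>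
    heap s' (adr n (lv (Suc j)) 1) = m + 1 \<and>
    (\<forall>t<q. heap s' (adr n (lv (Suc j)) (2 + t)) = (if b = 0 then 0 else m + 1))) s"
proof -
  note r = regs_okD[OF regs]
  let ?L = "lv (Suc j)"
  have size: "2 + q < stride n" "1 < stride n" "0 < stride n" unfolding stride_def by simp_all
  define v where "v = (if b = 0 then 0 else m + 1)"
  define h where "h = (heap s)(adr n ?L 1 := m + 1)"
  have h: "h (adr n x i) = heap s (adr n x i)" if "i < stride n" "x \<noteq> ?L \<or> i \<noteq> 1" for x i
    using that adr_eq_iff[OF that(1) size(2)] unfolding h_def by auto
  have addr: "Suc (adr n ?L 0) = adr n ?L 1" "Suc (Suc (adr n ?L 0)) = adr n ?L 2"
    "Suc (Suc (adr n 1 (2 * j))) = adr n 1 (2 * Suc j)" unfolding adr_def by simp_all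
  define P where "P s' \<longleftrightarrow> regs_ok n (Suc j) M s' \<and> out s' = out s \<and> reg s' 22 = b \<and> reg s' 23 = m + 1 \<and> heap s' = h" for s'
  have 1: "wp (Do [Add 8 8 5, Add 9 9 3, Sub 13 13 3, Add 12 12 4, Add 11 11 3, Add 11 11 3,
         Add 23 19 3, Add 14 8 3, Store 14 23, Load 22 8]) 10 P s"
  proof (rule wp_Do)
    show "P (run_block [Add 8 8 5, Add 9 9 3, Sub 13 13 3, Add 12 12 4, Add 11 11 3, Add 11 11 3,
         Add 23 19 3, Add 14 8 3, Store 14 23, Load 22 8] s)"
      using j h[of 0 ?L] size addr(3) adr_eq_iff[OF size(3) size(2), of ?L ?L]
      by (simp add: P_def regs_ok_def r m adr_Suc_level top_vertex_Suc addr h_def b_def)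
  qed (simp_all add: r adr_Suc_level addr num_regs_le_adr)
  have 2: "wp (Cond 22 (Do [Add 21 23 2]) (Do [Const 21 0])) 3 (\<lambda>s'. P s' \<and> reg s' 21 = v) s1" if "P s1" for s1
    using that by (intro wp_Cond[where T=1]) (auto intro!: wp_Do simp: P_def regs_ok_def v_def)
  have 3: "wp (Do [Const 20 2, Add 20 20 8, Add 15 4 2]) 3
      (\<lambda>s'. P s' \<and> reg s' 21 = v \<and> reg s' 20 = adr n ?L 2 \<and> reg s' 15 = q) s2" if "P s2 \<and> reg s2 21 = v" for s2
  proof -
    have "reg s2 8 = adr n ?L 0" "reg s2 4 = q" "reg s2 2 = 0" using that unfolding P_def regs_ok_def by simp_all
    then show ?thesis using that by (intro wp_Do) (simp_all add: P_def regs_ok_def addr(2))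
  qed
  have 4: "wp fill_code (5 * q + 1) (\<lambda>s'. regs_ok n (Suc j) M s' \<and> out s' = out s \<and> reg s' 22 = b \<and> reg s' 23 = m + 1 \<and>
    (\<forall>x i. i < stride n \<longrightarrow> x \<noteq> ?L \<or> i = 0 \<or> 2 + q \<le> i \<longrightarrow> heap s' (adr n x i) = heap s (adr n x i)) \<and>
    heap s' (adr n ?L 1) = m + 1 \<and> (\<forall>t<q. heap s' (adr n ?L (2 + t)) = (if b = 0 then 0 else m + 1))) s3"
    if "P s3 \<and> reg s3 21 = v \<and> reg s3 20 = adr n ?L 2 \<and> reg s3 15 = q" for s3
  proof -
    have s3: "regs_ok n (Suc j) M s3" "out s3 = out s" "reg s3 22 = b" "reg s3 23 = m + 1" "heap s3 = h"
      "reg s3 21 = v" "reg s3 20 = adr n ?L 2" "reg s3 15 = q" using that unfolding P_def by simp_all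
    have "wp fill_code (5 * q + 1) (\<lambda>s'. keeps {15, 20} s3 s' \<and>
      heap s' = (\<lambda>y. if reg s3 20 \<le> y \<and> y < reg s3 20 + reg s3 15 then reg s3 21 else heap s3 y)) s3"
      by (rule wp_fill) (simp_all add: s3(7,8) regs_okD[OF s3(1)] num_regs_le_adr)
    then show ?thesis
    proof (rule wp_mono[OF _ order_refl])
      fix s' assume "keeps {15, 20} s3 s' \<and>
        heap s' = (\<lambda>y. if reg s3 20 \<le> y \<and> y < reg s3 20 + reg s3 15 then reg s3 21 else heap s3 y)"
      then have k: "keeps {15, 20} s3 s'"
        and hs: "heap s' = (\<lambda>y. if adr n ?L 2 \<le> y \<and> y < adr n ?L 2 + q then v else h y)"
        unfolding s3(5-8) by simp_all
      have rng: "adr n ?L 2 \<le> adr n x i \<and> adr n x i < adr n ?L 2 + q \<longleftrightarrow> x = ?L \<and> 2 \<le> i \<and> i < 2 + q"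
        if "i < stride n" for x i using adr_range[of i n 2 q ?L x] that size by simp
      have "regs_ok n (Suc j) M s'" by (rule regs_ok_keeps[OF s3(1) k]) simp
      moreover have "heap s' (adr n x i) = heap s (adr n x i)"
        if "i < stride n" "x \<noteq> ?L \<or> i = 0 \<or> 2 + q \<le> i" for x i
        using that rng[OF that(1), of x] h[OF that(1), of x] unfolding hs by auto
      moreover have "heap s' (adr n ?L 1) = m + 1" using rng[OF size(2), of ?L] unfolding hs h_def by auto
      moreover have "heap s' (adr n ?L (2 + t)) = v" if "t < q" for t
        using rng[of "2 + t" ?L] that size unfolding hs by auto
      ultimately show "regs_ok n (Suc j) M s' \<and> out s' = out s \<and> reg s' 22 = b \<and> reg s' 23 = m + 1 \<and>
        (\<forall>x i. i < stride n \<longrightarrow> x \<noteq> ?L \<or> i = 0 \<or> 2 + q \<le> i \<longrightarrow> heap s' (adr n x i) = heap s (adr n x i)) \<and>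
        heap s' (adr n ?L 1) = m + 1 \<and> (\<forall>t<q. heap s' (adr n ?L (2 + t)) = (if b = 0 then 0 else m + 1))"
        using k s3(2-4) unfolding v_def by (simp add: keeps_def)
    qed
  qed
  show ?thesis unfolding descend_code_def
    by (rule wp_Seq'[OF 1 wp_Seq'[OF 2 wp_Seq'[OF 3 4 order_refl] order_refl]]) (use T in simp_all)
qed

lemma slot_address: "i < j \<Longrightarrow> adr n 1 (2 * j) - 2 * i - 1 = adr n 1 (2 * (j - 1 - i) + 1)"
  "i < j \<Longrightarrow> adr n 1 (2 * j) - 2 * i - 2 = adr n 1 (2 * (j - 1 - i))"
  unfolding adr_def by simp_all

lemma wp_write_struts:
  assumes regs: "regs_ok n j M s" and r: "reg s 23 = r" "r \<le> j" "j < n" and T: "9 * r + 11 \<le> T"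
    and w: "\<And>i. i \<le> q * r \<Longrightarrow> heap s (adr n (lv j) (3 + q + i)) = w ! i"
  defines "d \<equiv> (if reg s 22 = 0 then 0 else q)"
  shows "wp write_struts_code T (\<lambda>s'. regs_ok n j M s' \<and> out s' = out s \<and>
    (\<forall>x i. i < stride n \<longrightarrow> x \<noteq> 1 \<or> i < 2 * (j - r) \<longrightarrow> heap s' (adr n x i) = heap s (adr n x i)) \<and>
    (\<forall>i<r. slot_ok n (heap s') (j - 1 - i) (w ! (q * i + d), top_vertex j + d))) s"
proof -
  note rr = regs_okD[OF regs]
  let ?L = "lv j"
  have addr: "3 + q + adr n ?L 0 = adr n ?L (3 + q)" "adr n ?L (3 + q) + q = adr n ?L (3 + q + q)"
    unfolding adr_def by simp_all
  have size: "2 * j < stride n" using r(3) unfolding stride_def by simp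
  define P where "P s' \<longleftrightarrow> regs_ok n j M s' \<and> out s' = out s \<and> heap s' = heap s \<and> reg s' 20 = adr n 1 (2 * j) \<and>
    reg s' 15 = r" for s'
  have 1: "wp (Do [Const 14 3, Add 14 14 4, Add 14 14 8, Add 21 12 2, Add 20 11 2, Add 15 23 2]) 6
      (\<lambda>s'. P s' \<and> reg s' 14 = adr n ?L (3 + q) \<and> reg s' 21 = top_vertex j \<and> reg s' 22 = reg s 22) s"
    by (intro wp_Do) (simp_all add: rr r P_def regs_ok_def addr)
  have 2: "wp (Cond 22 (Do [Add 14 14 4, Add 21 21 4]) (Do [])) 4
      (\<lambda>s'. P s' \<and> reg s' 14 = adr n ?L (3 + q + d) \<and> reg s' 21 = top_vertex j + d) s1"
    if "P s1 \<and> reg s1 14 = adr n ?L (3 + q) \<and> reg s1 21 = top_vertex j \<and> reg s1 22 = reg s 22" for s1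
  proof -
    have s1: "P s1" "reg s1 14 = adr n ?L (3 + q)" "reg s1 21 = top_vertex j" "reg s1 22 = reg s 22"
      using that by simp_all
    have q4: "reg s1 4 = q" using s1(1) unfolding P_def regs_ok_def by simp
    show ?thesis
    proof (rule wp_Cond[where T=2])
      let ?Q = "\<lambda>s'. P s' \<and> reg s' 14 = adr n ?L (3 + q + d) \<and> reg s' 21 = top_vertex j + d"
      have "wp (Do [Add 14 14 4, Add 21 21 4]) 2 ?Q s1" if "reg s 22 \<noteq> 0"
        using s1(1) that by (intro wp_Do) (simp_all add: s1(2,3) q4 P_def regs_ok_def addr(2) d_def add.assoc[symmetric])
      moreover have "wp (Do []) 2 ?Q s1" if "reg s 22 = 0"
        using s1(1) that by (intro wp_Do) (simp_all add: s1(2,3) d_def)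
      ultimately show "if reg s1 22 \<noteq> 0 then wp (Do [Add 14 14 4, Add 21 21 4]) 2 ?Q s1 else wp (Do []) 2 ?Q s1"
        unfolding s1(4) by simp
    qed simp
  qed
  have 3: "wp struts_code (9 * r + 1) (\<lambda>s'. regs_ok n j M s' \<and> out s' = out s \<and>
    (\<forall>x i. i < stride n \<longrightarrow> x \<noteq> 1 \<or> i < 2 * (j - r) \<longrightarrow> heap s' (adr n x i) = heap s (adr n x i)) \<and>
    (\<forall>i<r. slot_ok n (heap s') (j - 1 - i) (w ! (q * i + d), top_vertex j + d))) s2"
    if "P s2 \<and> reg s2 14 = adr n ?L (3 + q + d) \<and> reg s2 21 = top_vertex j + d" for s2
  proof -
    have s2: "regs_ok n j M s2" "out s2 = out s" "heap s2 = heap s" "reg s2 20 = adr n 1 (2 * j)"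
      "reg s2 15 = r" "reg s2 14 = adr n ?L (3 + q + d)" "reg s2 21 = top_vertex j + d"
      using that unfolding P_def by simp_all
    have "adr n 1 (2 * j) \<le> adr n ?L (3 + q + d)"
    proof -
      have "2 * stride n \<le> ?L * stride n" unfolding lv_def by simp
      then show ?thesis using size unfolding adr_def by linarith
    qed
    moreover have "num_regs + 2 * r \<le> adr n 1 (2 * j)" using r(2) unfolding adr_def by simp
    ultimately have "wp struts_code (9 * r + 1) (\<lambda>s'. keeps {14, 15, 16, 20} s2 s' \<and>
      (\<forall>y. \<not> (reg s2 20 - 2 * reg s2 15 \<le> y \<and> y < reg s2 20) \<longrightarrow> heap s' y = heap s2 y) \<and>
      (\<forall>i<reg s2 15. heap s' (reg s2 20 - 2 * i - 1) = reg s2 21 \<and>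
         heap s' (reg s2 20 - 2 * i - 2) = heap s2 (reg s2 14 + reg s2 4 * i))) s2"
      by (intro wp_struts) (simp_all add: s2(4,5,6) regs_okD[OF s2(1)] del: One_nat_def)
    then show ?thesis
    proof (rule wp_mono[OF _ order_refl])
      fix s' assume A: "keeps {14, 15, 16, 20} s2 s' \<and>
        (\<forall>y. \<not> (reg s2 20 - 2 * reg s2 15 \<le> y \<and> y < reg s2 20) \<longrightarrow> heap s' y = heap s2 y) \<and>
        (\<forall>i<reg s2 15. heap s' (reg s2 20 - 2 * i - 1) = reg s2 21 \<and>
           heap s' (reg s2 20 - 2 * i - 2) = heap s2 (reg s2 14 + reg s2 4 * i))"
      then have k: "keeps {14, 15, 16, 20} s2 s'" by blast
      have same: "heap s' y = heap s y" if "\<not> (adr n 1 (2 * j) - 2 * r \<le> y \<and> y < adr n 1 (2 * j))" for y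
        using A that unfolding s2(3-5) by blast
      have new: "heap s' (adr n 1 (2 * j) - 2 * i - 1) = top_vertex j + d"
        "heap s' (adr n 1 (2 * j) - 2 * i - 2) = heap s (adr n ?L (3 + q + d) + q * i)" if "i < r" for i
        using A that unfolding s2(3-7) regs_okD(3)[OF s2(1)] by blast+
      have "regs_ok n j M s'" by (rule regs_ok_keeps[OF s2(1) k]) simp
      moreover have "heap s' (adr n x i) = heap s (adr n x i)"
        if "i < stride n" "x \<noteq> 1 \<or> i < 2 * (j - r)" for x i
      proof (rule same)
        have "adr n 1 (2 * j) - 2 * r = adr n 1 (2 * (j - r))" "adr n 1 (2 * j) = adr n 1 (2 * (j - r)) + 2 * r"
          using r(2) unfolding adr_def by simp_all
        then show "\<not> (adr n 1 (2 * j) - 2 * r \<le> adr n x i \<and> adr n x i < adr n 1 (2 * j))"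
          using adr_range[of i n "2 * (j - r)" "2 * r" 1 x] that size r(2) by auto
      qed
      moreover have "slot_ok n (heap s') (j - 1 - i) (w ! (q * i + d), top_vertex j + d)" if "i < r" for i
      proof -
        have "q * i + d \<le> q * Suc i" unfolding d_def by simp
        moreover have "q * Suc i \<le> q * r" using that by (intro mult_le_mono) auto
        ultimately have "heap s (adr n ?L (3 + q + (q * i + d))) = w ! (q * i + d)" using w by simp
        moreover have "adr n ?L (3 + q + d) + q * i = adr n ?L (3 + q + (q * i + d))" unfolding adr_def by simp
        moreover have "i < j" using that r(2) by simp
        ultimately show ?thesis unfolding slot_ok_def using new[OF that] slot_address[of i j n] by simp
      qed
      ultimately show "regs_ok n j M s' \<and> out s' = out s \<and>
        (\<forall>x i. i < stride n \<longrightarrow> x \<noteq> 1 \<or> i < 2 * (j - r) \<longrightarrow> heap s' (adr n x i) = heap s (adr n x i)) \<and>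
        (\<forall>i<r. slot_ok n (heap s') (j - 1 - i) (w ! (q * i + d), top_vertex j + d))"
        using keeps_out[OF k] s2(2) by simp
    qed
  qed
  show ?thesis unfolding write_struts_code_def
    by (rule wp_Seq'[OF 1 wp_Seq'[OF 2 3 order_refl]]) (use T in simp_all)
qed

lemma slots_ok_child:
  assumes "slots_ok n h j nd f (last f)" "length (fst nd) + fan_size (snd nd) = j" "i < length (fst (child j nd f))"
  shows "slot_ok n h i (fst (child j nd f) ! i)"
proof (cases "i < length (fst nd)")
  case True
  then show ?thesis using assms(1) unfolding slots_ok_def child_def by (simp add: nth_append)
next
  case False
  let ?r = "fan_size (snd nd)"
  define t where "t = i - length (fst nd)"
  have i: "i = length (fst nd) + t" "t < ?r - last f" using False assms(3) unfolding t_def child_def by auto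
  then have "rev [last f..<?r] ! t = ?r - 1 - t" by (simp add: rev_nth)
  then have "fst (child j nd f) ! i = strut_pair j (snd nd) f (?r - 1 - t)"
    unfolding child_def using i by (simp add: nth_append)
  moreover have "j - 1 - (?r - 1 - t) = i" using i assms(2) by simp
  moreover have "last f \<le> ?r - 1 - t" "?r - 1 - t < ?r" using i by auto
  ultimately show ?thesis using assms(1) unfolding slots_ok_def by metis
qed

lemma link_of_child:
  assumes "coded n j nd f"
  defines "m \<equiv> last f" and "d \<equiv> count_above f (last f)"
  shows "fan_size (snd (child j nd f)) = m + 1" "length (snd (child j nd f)) = q * (m + 1) + 1"
    "length (fst (child j nd f)) + m = j"
    "i \<le> q * (m + 1) \<Longrightarrow>
      snd (child j nd f) ! i = (if i \<le> q * m + d then snd nd ! i else top_vertex j + (i - q * m - 1))"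
proof -
  note c = codedD[OF assms(1), folded m_def d_def]
  have w': "snd (child j nd f) = take (q * m + d + 1) (snd nd) @ [top_vertex j + d..<top_vertex j + q]"
    unfolding child_def child_link_def m_def d_def by simp
  show len: "length (snd (child j nd f)) = q * (m + 1) + 1" unfolding w' using c by simp
  then show "fan_size (snd (child j nd f)) = m + 1" unfolding fan_size_def using q_pos by simp
  show "length (fst (child j nd f)) + m = j"
    using assms(1) c(1) unfolding child_def coded_def m_def by simp
  show "snd (child j nd f) ! i = (if i \<le> q * m + d then snd nd ! i else top_vertex j + (i - q * m - 1))"
    if "i \<le> q * (m + 1)" unfolding w' using c that by (auto simp: nth_append)
qed

text \<open>The time is dominated by copying a link of length about \<open>q * (last f + 1)\<close>.
  The node entered has \<open>last f + 1\<close> fan cells and hence at least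
  \<open>last f + 2\<close> children, which will pay for it.\<close>

lemma wp_init:
  assumes regs: "regs_ok n j M s" and j: "Suc j < n" and tables: "tables_ok n (heap s)"
    and level: "level_ok n (heap s) j (snd nd) f" and coded: "coded n j nd f"
    and slots: "slots_ok n (heap s) j nd f (last f)" and sentinel: "heap s (adr n (lv (Suc j)) (2 + q)) = 0"
    and T: "50 * (q + 1) * (last f + 2) \<le> T"
  defines "nd' \<equiv> child j nd f" and "b \<equiv> heap s (adr n (lv (Suc j)) 0)"
  defines "f' \<equiv> replicate q (if b = 0 then 0 else fan_size (snd nd'))"
  shows "wp init_code T (\<lambda>s'. regs_ok n (Suc j) M s' \<and> out s' = out s \<and>
    level_ok n (heap s') (Suc j) (snd nd') f' \<and> slots_ok n (heap s') (Suc j) nd' f' 0 \<and>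
    (\<forall>x i. i < stride n \<longrightarrow> x \<noteq> 1 \<longrightarrow> x \<noteq> lv (Suc j) \<or> i = 0 \<longrightarrow> heap s' (adr n x i) = heap s (adr n x i)) \<and>
    (\<forall>i<2 * length (fst nd'). heap s' (adr n 1 i) = heap s (adr n 1 i))) s"
proof -
  let ?m = "last f" and ?d = "count_above f (last f)" and ?L = "lv (Suc j)" and ?w = "snd nd'"
  note c = codedD[OF coded]
  note w' = link_of_child[OF coded, folded nd'_def]
  define P1 where "P1 s' \<longleftrightarrow> keeps {14, 15, 16, 18, 19} s s' \<and> heap s' = heap s \<and> reg s' 19 = ?m \<and> reg s' 18 = ?d" for s'
  define P2 where "P2 s' \<longleftrightarrow> regs_ok n j M s' \<and> out s' = out s \<and> reg s' 19 = ?m \<and>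
    (\<forall>x i. i < stride n \<longrightarrow> x \<noteq> ?L \<or> i < 3 + q \<longrightarrow> heap s' (adr n x i) = heap s (adr n x i)) \<and>
    (\<forall>i\<le>q * (?m + 1). heap s' (adr n ?L (3 + q + i)) = ?w ! i)" for s'
  define P3 where "P3 s' \<longleftrightarrow> regs_ok n (Suc j) M s' \<and> out s' = out s \<and> reg s' 22 = b \<and> reg s' 23 = ?m + 1 \<and>
    (\<forall>x i. i < stride n \<longrightarrow> x \<noteq> ?L \<or> i = 0 \<or> i = 2 + q \<longrightarrow> heap s' (adr n x i) = heap s (adr n x i)) \<and>
    heap s' (adr n ?L 1) = ?m + 1 \<and> (\<forall>t<q. heap s' (adr n ?L (2 + t)) = (if b = 0 then 0 else ?m + 1)) \<and>
    (\<forall>i\<le>q * (?m + 1). heap s' (adr n ?L (3 + q + i)) = ?w ! i)" for s'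
  have size: "3 + q + i < stride n" if "i \<le> q * (?m + 1)" for i
    by (rule level_size[of "?m + 1"]) (use that c in simp_all)
  have size2: "2 + q < stride n" "0 < stride n" "2 * Suc j < stride n" using j unfolding stride_def by simp_all
  have 1: "wp count_last_code (9 * q + 9) P1 s"
    unfolding P1_def by (rule wp_count_last[OF regs level coded order_refl])
  have 2: "wp copy_link_code (7 * (q * ?m + q) + 6 * q + 13) P2 s1" if "P1 s1" for s1
  proof -
    have s1: "keeps {14, 15, 16, 18, 19} s s1" "heap s1 = heap s" "reg s1 19 = ?m" "reg s1 18 = ?d"
      using that unfolding P1_def by simp_all
    have r1: "regs_ok n j M s1" by (rule regs_ok_keeps[OF regs s1(1)]) simp
    have len: "length (snd nd) = q * fan_size (snd nd) + 1" using coded unfolding coded_def by simp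
    have "wp copy_link_code (7 * (q * ?m + q) + 6 * q + 13) (\<lambda>s'. keeps {14, 15, 16, 20, 21, 22} s1 s' \<and>
      (\<forall>x i. i < stride n \<longrightarrow> x \<noteq> lv (Suc j) \<or> i < 3 + q \<longrightarrow> heap s' (adr n x i) = heap s1 (adr n x i)) \<and>
      (\<forall>i\<le>q * (?m + 1). heap s' (adr n (lv (Suc j)) (3 + q + i)) =
         (if i \<le> q * ?m + ?d then snd nd ! i else top_vertex j + (i - q * ?m - 1)))) s1"
      by (rule wp_copy_link[where f=f, OF r1]) (use tables level c s1 len in simp_all)
    then show ?thesis
    proof (rule wp_mono[OF _ order_refl])
      fix s' assume A: "keeps {14, 15, 16, 20, 21, 22} s1 s' \<and>
      (\<forall>x i. i < stride n \<longrightarrow> x \<noteq> lv (Suc j) \<or> i < 3 + q \<longrightarrow> heap s' (adr n x i) = heap s1 (adr n x i)) \<and>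
      (\<forall>i\<le>q * (?m + 1). heap s' (adr n (lv (Suc j)) (3 + q + i)) =
         (if i \<le> q * ?m + ?d then snd nd ! i else top_vertex j + (i - q * ?m - 1)))"
      then have k: "keeps {14, 15, 16, 20, 21, 22} s1 s'" by blast
      have "regs_ok n j M s'" by (rule regs_ok_keeps[OF r1 k]) simp
      moreover have "out s' = out s" "reg s' 19 = ?m" using k s1 by (simp_all add: keeps_def)
      ultimately show "P2 s'" unfolding P2_def using A w'(4) s1(2) by simp
    qed
  qed
  have 3: "wp descend_code (5 * q + 17) P3 s2" if "P2 s2" for s2
  proof -
    have s2: "regs_ok n j M s2" "out s2 = out s" "reg s2 19 = ?m"
      "\<And>x i. i < stride n \<Longrightarrow> x \<noteq> ?L \<or> i < 3 + q \<Longrightarrow> heap s2 (adr n x i) = heap s (adr n x i)"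
      "\<And>i. i \<le> q * (?m + 1) \<Longrightarrow> heap s2 (adr n ?L (3 + q + i)) = ?w ! i"
      using that unfolding P2_def by simp_all
    have b2: "heap s2 (adr n ?L 0) = b" unfolding b_def using s2(4) size2 by simp
    show ?thesis
    proof (rule wp_mono[OF wp_descend[OF s2(1) j s2(3) order_refl] order_refl])
      fix s' assume A: "regs_ok n (Suc j) M s' \<and> out s' = out s2 \<and> reg s' 22 = heap s2 (adr n ?L 0) \<and> reg s' 23 = ?m + 1 \<and>
        (\<forall>x i. i < stride n \<longrightarrow> x \<noteq> ?L \<or> i = 0 \<or> 2 + q \<le> i \<longrightarrow> heap s' (adr n x i) = heap s2 (adr n x i)) \<and>
        heap s' (adr n ?L 1) = ?m + 1 \<and>
        (\<forall>t<q. heap s' (adr n ?L (2 + t)) = (if heap s2 (adr n ?L 0) = 0 then 0 else ?m + 1))"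
      have "heap s' (adr n x i) = heap s (adr n x i)" if "i < stride n" "x \<noteq> ?L \<or> i = 0 \<or> i = 2 + q" for x i
      proof -
        have "heap s' (adr n x i) = heap s2 (adr n x i)" using A that by auto
        also have "\<dots> = heap s (adr n x i)" using s2(4)[OF that(1)] that(2) by auto
        finally show ?thesis .
      qed
      moreover have "heap s' (adr n ?L (3 + q + i)) = ?w ! i" if "i \<le> q * (?m + 1)" for i
      proof -
        have "2 + q \<le> 3 + q + i" by simp
        then have "heap s' (adr n ?L (3 + q + i)) = heap s2 (adr n ?L (3 + q + i))" using A size[OF that] by blast
        then show ?thesis using s2(5)[OF that] by simp
      qed
      ultimately show "P3 s'" unfolding P3_def using A b2 s2(2) by auto
    qed
  qed
  have 4: "wp write_struts_code (9 * (?m + 1) + 11) (\<lambda>s'. regs_ok n (Suc j) M s' \<and> out s' = out s \<and>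
    level_ok n (heap s') (Suc j) ?w f' \<and> slots_ok n (heap s') (Suc j) nd' f' 0 \<and>
    (\<forall>x i. i < stride n \<longrightarrow> x \<noteq> 1 \<longrightarrow> x \<noteq> lv (Suc j) \<or> i = 0 \<longrightarrow> heap s' (adr n x i) = heap s (adr n x i)) \<and>
    (\<forall>i<2 * length (fst nd'). heap s' (adr n 1 i) = heap s (adr n 1 i))) s3" if "P3 s3" for s3
  proof -
    have s3: "regs_ok n (Suc j) M s3" "out s3 = out s" "reg s3 22 = b" "reg s3 23 = ?m + 1"
      "\<And>x i. i < stride n \<Longrightarrow> x \<noteq> ?L \<or> i = 0 \<or> i = 2 + q \<Longrightarrow> heap s3 (adr n x i) = heap s (adr n x i)"
      "heap s3 (adr n ?L 1) = ?m + 1" "\<And>t. t < q \<Longrightarrow> heap s3 (adr n ?L (2 + t)) = (if b = 0 then 0 else ?m + 1)"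
      "\<And>i. i \<le> q * (?m + 1) \<Longrightarrow> heap s3 (adr n ?L (3 + q + i)) = ?w ! i"
      using that unfolding P3_def by blast+
    have mj: "?m + 1 \<le> Suc j" using c by simp
    have len: "Suc j - (?m + 1) = length (fst nd')" using w'(3) by simp
    show ?thesis
    proof (rule wp_mono[OF wp_write_struts[OF s3(1,4) mj j order_refl s3(8)] order_refl])
      fix s' assume A: "regs_ok n (Suc j) M s' \<and> out s' = out s3 \<and>
        (\<forall>x i. i < stride n \<longrightarrow> x \<noteq> 1 \<or> i < 2 * (Suc j - (?m + 1)) \<longrightarrow> heap s' (adr n x i) = heap s3 (adr n x i)) \<and>
        (\<forall>i<?m + 1. slot_ok n (heap s') (Suc j - 1 - i)
          (?w ! (q * i + (if reg s3 22 = 0 then 0 else q)), top_vertex (Suc j) + (if reg s3 22 = 0 then 0 else q)))"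
      have same: "heap s' (adr n x i) = heap s3 (adr n x i)" if "i < stride n" "x \<noteq> 1 \<or> i < 2 * length (fst nd')" for x i
        using A that unfolding len by blast
      have lv: "?L \<noteq> 1" by (rule lv_neq)
      have "level_ok n (heap s') (Suc j) ?w f'"
        unfolding level_ok_def w'(1)
      proof (intro conjI allI impI)
        show "heap s' (adr n ?L 1) = ?m + 1" using same[of 1 ?L] lv size2 s3(6) by simp
        show "heap s' (adr n ?L (2 + q)) = 0" using same[OF size2(1)] lv s3(5)[OF size2(1)] sentinel by simp
        show "heap s' (adr n ?L (2 + t)) = f' ! t" if "t < q" for t
        proof -
          have "2 + t < stride n" using that size2 by simp
          then show ?thesis using same[of "2 + t" ?L] lv s3(7)[OF that] that unfolding f'_def w'(1) by simp
        qed
        show "heap s' (adr n ?L (3 + q + i)) = ?w ! i" if "i \<le> q * (?m + 1)" for i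
          using same[OF size[OF that], of ?L] lv s3(8)[OF that] by simp
      qed
      moreover have small: "heap s' (adr n 1 i) = heap s (adr n 1 i)" if "i < 2 * length (fst nd')" for i
      proof -
        have i: "i < stride n" using that w'(3) size2(3) by simp
        have "1 \<noteq> ?L" by (rule lv_neq)
        then show ?thesis using same[OF i, of 1] that s3(5)[OF i, of 1] by simp
      qed
      moreover have "slots_ok n (heap s') (Suc j) nd' f' 0"
        unfolding slots_ok_def
      proof (intro conjI allI impI)
        fix i assume i: "i < length (fst nd')"
        have "slot_ok n (heap s) i (fst nd' ! i)"
          using slots_ok_child[OF slots, of i] i coded unfolding nd'_def coded_def by simp
        then show "slot_ok n (heap s') i (fst nd' ! i)"
          unfolding slot_ok_def using small[of "2 * i"] small[of "2 * i + 1"] i by simp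
      next
        fix i assume i: "i < fan_size (snd nd')"
        have "count_above f' i = (if b = 0 then 0 else q)" using i unfolding f'_def by simp
        then show "slot_ok n (heap s') (Suc j - 1 - i) (strut_pair (Suc j) (snd nd') f' i)"
          using A i unfolding strut_pair_def w'(1) s3(3) by simp
      qed
      moreover have "heap s' (adr n x i) = heap s (adr n x i)"
        if "i < stride n" "x \<noteq> 1" "x \<noteq> ?L \<or> i = 0" for x i
        using same[OF that(1), of x] s3(5)[OF that(1), of x] that by auto
      ultimately show "regs_ok n (Suc j) M s' \<and> out s' = out s \<and>
        level_ok n (heap s') (Suc j) ?w f' \<and> slots_ok n (heap s') (Suc j) nd' f' 0 \<and>
        (\<forall>x i. i < stride n \<longrightarrow> x \<noteq> 1 \<longrightarrow> x \<noteq> lv (Suc j) \<or> i = 0 \<longrightarrow> heap s' (adr n x i) = heap s (adr n x i)) \<and>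
        (\<forall>i<2 * length (fst nd'). heap s' (adr n 1 i) = heap s (adr n 1 i))"
        using A s3(2) by simp
    qed
  qed
  have time: "9 * q + 9 + (7 * (q * ?m + q) + 6 * q + 13 + (5 * q + 17 + (9 * (?m + 1) + 11))) \<le> T"
    using T by (simp add: algebra_simps)
  show ?thesis unfolding init_code_def
    by (rule wp_Seq'[OF 1 wp_Seq'[OF 2 wp_Seq'[OF 3 4 order_refl] order_refl] time])
qed

end

section \<open>Moving on to the next sibling or back to the parent\<close>

definition scan_body :: com where
  "scan_body =
     Do [Load 27 14, Add 16 14 3, Load 28 16, Add 16 28 28, Add 16 16 6, Add 16 16 3, Load 16 16,
         Sub 24 22 16, Sub 16 16 22, Add 24 24 16] ;;
     Cond 24 (Do [Sub 29 27 28]) (Do [Sub 29 23 27]) ;;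
     Cond 29 (Do [Const 25 0, Const 26 1]) (Do [Add 14 14 3, Sub 15 15 3, Add 25 15 2])"

definition scan_code :: com where
  "scan_code =
     Do [Load 22 8, Add 14 8 3, Load 23 14, Const 14 2, Add 14 14 8, Add 15 4 2, Const 26 0, Const 25 1] ;;
     While 25 scan_body"

definition change_code :: com where
  "change_code =
     Cond 24 (Do [Sub 28 27 3, Add 19 28 2]) (Do [Add 28 27 3, Add 19 27 2]) ;;
     Do [Store 14 28, Add 16 28 28, Add 16 16 6, Add 16 16 3, Load 16 16,
         Sub 17 22 16, Sub 16 16 22, Add 17 17 16] ;;
     Cond 17 (Do [Add 21 23 2]) (Do [Add 21 28 2]) ;;
     Do [Sub 15 4 15, Const 20 2, Add 20 20 8] ;; fill_code"

definition move_code :: com where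
  "move_code = change_code ;; count_code ;;
     Do [Add 14 6 19, Add 14 14 19, Load 14 14, Add 14 14 18, Add 14 14 4, Add 14 14 8, Const 16 3,
         Add 14 14 16, Load 16 14, Add 17 12 18, Sub 20 11 19, Sub 20 20 19, Sub 20 20 3, Store 20 17,
         Sub 20 20 3, Store 20 16, Const 10 1]"

text \<open>The first two instructions reverse the bit of the level that is left, which is the
  \<open>1 - hd bs\<close> of \<open>zigzag\<close>.\<close>

definition back_code :: com where
  "back_code = Do [Sub 22 3 22, Store 8 22, Sub 8 8 5, Sub 9 9 3, Add 13 13 3, Sub 12 12 4,
     Sub 11 11 3, Sub 11 11 3]"

definition step_code :: com where
  "step_code = scan_code ;; Cond 26 move_code back_code"

context dissecting
begin

text \<open>Whether the entry \<open>t\<close> of the code has reached the last value in its current direction.\<close>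

definition at_end :: "nat \<Rightarrow> nat \<Rightarrow> nat list \<Rightarrow> nat \<Rightarrow> bool" where
  "at_end b r f t \<longleftrightarrow> f ! t = (if even (b + (f @ [0]) ! Suc t) then r else (f @ [0]) ! Suc t)"

text \<open>At least one of the truncated differences of two bits vanishes, so their sum is the
  exclusive or. This is how the program obtains the parity of \<open>b + v\<close> from the
  table.\<close>

lemma xor_parity: "b < 2 \<Longrightarrow> (b - v mod 2) + (v mod 2 - b) = (b + v) mod (2 :: nat)"
  by (cases "even v"; cases "b = 0") (auto simp: mod2_eq_if less_2_cases_iff)

definition scan_state :: "nat \<Rightarrow> nat \<Rightarrow> nat \<Rightarrow> nat \<Rightarrow> store \<Rightarrow> nat \<Rightarrow> store \<Rightarrow> bool" where
  "scan_state n j b r s t s' \<longleftrightarrow> regs_ok n j 2 s' \<and> out s' = out s \<and> heap s' = heap s \<and>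
     reg s' 22 = b \<and> reg s' 23 = r \<and> reg s' 14 = adr n (lv j) (2 + t) \<and> reg s' 15 = q - t"

lemma code_bounds:
  assumes "bounded_code r f" "t < q"
  shows "(f @ [0]) ! Suc t \<le> f ! t" "f ! t \<le> r" "(f @ [0]) ! t = f ! t"
proof -
  have f: "length f = q" "sorted_wrt (\<ge>) f" "set f \<subseteq> {0..r}" using assms(1) unfolding bounded_code_def by auto
  have "f ! t \<in> set f" using f(1) assms(2) by simp
  then show "f ! t \<le> r" using f(3) by auto
  show "(f @ [0]) ! t = f ! t" using f(1) assms(2) by (simp add: nth_append)
  show "(f @ [0]) ! Suc t \<le> f ! t"
    using assms(2) sorted_wrt_nth_less[OF f(2), of t "Suc t"] by (simp add: nth_append f(1))
qed

text \<open>The parity in register \<open>24\<close> selects the bound with which the entry is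
  compared: \<open>r\<close> on the way up, the next entry on the way down. A zero difference in
  register \<open>29\<close> means that the bound has been reached.\<close>

lemma wp_scan_body:
  assumes tables: "tables_ok n (heap s)" and level: "level_ok n (heap s) j w f" and code: "bounded_code r f"
    and r: "r = fan_size w" "r \<le> n" and b: "b < 2" and t: "t < q"
    and s': "scan_state n j b r s t s'" "reg s' 26 = 0"
  shows "wp scan_body 18 (\<lambda>s''. if at_end b r f t then
      scan_state n j b r s (Suc t) s'' \<and> reg s'' 25 = q - Suc t \<and> reg s'' 26 = 0
    else scan_state n j b r s t s'' \<and> reg s'' 25 = 0 \<and> reg s'' 26 = 1 \<and> reg s'' 27 = f ! t \<and>
      reg s'' 24 = (b + (f @ [0]) ! Suc t) mod 2) s'"
proof -
  let ?nxt = "(f @ [0]) ! Suc t"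
  have len: "length f = q" using code unfolding bounded_code_def by simp
  note c = code_bounds[OF code t]
  have regs: "regs_ok n j 2 s'" and S: "heap s' = heap s" "reg s' 22 = b" "reg s' 23 = r"
    "reg s' 14 = adr n (lv j) (2 + t)" "reg s' 15 = q - t" "out s' = out s"
    using s' unfolding scan_state_def by simp_all
  note rr = regs_okD[OF regs]
  have cur: "heap s (adr n (lv j) (2 + t)) = f ! t" using level t unfolding level_ok_def by simp
  \<comment> \<open>For \<open>t = q - 1\<close> the next entry is the zero stored behind the code,
    which acts as the lower bound of the last entry.\<close>
  have nxt: "heap s (adr n (lv j) (2 + Suc t)) = ?nxt"
  proof (cases "Suc t < q")
    case True
    then show ?thesis using level len unfolding level_ok_def by (simp add: nth_append)
  next
    case False
    then have "Suc t = q" using t by simp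
    then show ?thesis using level len unfolding level_ok_def by (simp add: nth_append)
  qed
  have "?nxt \<le> n" using c r by simp
  then have par: "heap s (adr n 0 (2 * ?nxt + 1)) = ?nxt mod 2" using tables unfolding tables_ok_def by simp
  define u where "u = (b + ?nxt) mod 2"
  define P where "P s'' \<longleftrightarrow> scan_state n j b r s t s'' \<and> reg s'' 26 = 0 \<and> reg s'' 27 = f ! t \<and>
    reg s'' 28 = ?nxt \<and> reg s'' 24 = u" for s''
  have 1: "wp (Do [Load 27 14, Add 16 14 3, Load 28 16, Add 16 28 28, Add 16 16 6, Add 16 16 3, Load 16 16,
         Sub 24 22 16, Sub 16 16 22, Add 24 24 16]) 10 P s'"
    using s'(2) xor_parity[OF b, of ?nxt] cur nxt par
    by (intro wp_Do) (simp_all add: P_def scan_state_def regs_ok_def rr S adr_simps num_regs_le_adr u_def mult_2)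
  have 2: "wp (Cond 24 (Do [Sub 29 27 28]) (Do [Sub 29 23 27])) 3
      (\<lambda>s''. P s'' \<and> (reg s'' 29 = 0 \<longleftrightarrow> at_end b r f t)) s1" if "P s1" for s1
  proof (rule wp_Cond[where T=1])
    have s1: "reg s1 27 = f ! t" "reg s1 28 = ?nxt" "reg s1 24 = u" "reg s1 23 = r"
      using that unfolding P_def scan_state_def by simp_all
    have "wp (Do [Sub 29 27 28]) 1 (\<lambda>s''. P s'' \<and> (reg s'' 29 = 0 \<longleftrightarrow> at_end b r f t)) s1" if "u \<noteq> 0"
    proof -
      have "odd (b + ?nxt)" using that unfolding u_def by (simp add: even_iff_mod_2_eq_zero)
      then have "f ! t - ?nxt = 0 \<longleftrightarrow> at_end b r f t" using c unfolding at_end_def by auto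
      then show ?thesis using \<open>P s1\<close> by (intro wp_Do) (simp_all add: P_def scan_state_def regs_ok_def s1)
    qed
    moreover have "wp (Do [Sub 29 23 27]) 1 (\<lambda>s''. P s'' \<and> (reg s'' 29 = 0 \<longleftrightarrow> at_end b r f t)) s1" if "u = 0"
    proof -
      have "even (b + ?nxt)" using that unfolding u_def by (simp add: even_iff_mod_2_eq_zero)
      then have "r - f ! t = 0 \<longleftrightarrow> at_end b r f t" using c unfolding at_end_def by auto
      then show ?thesis using \<open>P s1\<close> by (intro wp_Do) (simp_all add: P_def scan_state_def regs_ok_def s1)
    qed
    ultimately show "if reg s1 24 \<noteq> 0
      then wp (Do [Sub 29 27 28]) 1 (\<lambda>s''. P s'' \<and> (reg s'' 29 = 0 \<longleftrightarrow> at_end b r f t)) s1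
      else wp (Do [Sub 29 23 27]) 1 (\<lambda>s''. P s'' \<and> (reg s'' 29 = 0 \<longleftrightarrow> at_end b r f t)) s1"
      unfolding s1(3) by simp
  qed simp
  let ?Q = "\<lambda>s''. if at_end b r f t then
      scan_state n j b r s (Suc t) s'' \<and> reg s'' 25 = q - Suc t \<and> reg s'' 26 = 0
    else scan_state n j b r s t s'' \<and> reg s'' 25 = 0 \<and> reg s'' 26 = 1 \<and> reg s'' 27 = f ! t \<and> reg s'' 24 = u"
  have 3: "wp (Cond 29 (Do [Const 25 0, Const 26 1]) (Do [Add 14 14 3, Sub 15 15 3, Add 25 15 2])) 5 ?Q s2"
    if "P s2 \<and> (reg s2 29 = 0 \<longleftrightarrow> at_end b r f t)" for s2
  proof (rule wp_Cond[where T=3])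
    have P2: "P s2" and e: "reg s2 29 = 0 \<longleftrightarrow> at_end b r f t" using that by simp_all
    have s2: "reg s2 14 = adr n (lv j) (2 + t)" "reg s2 15 = q - t" "reg s2 3 = 1" "reg s2 2 = 0"
      using P2 unfolding P_def scan_state_def regs_ok_def by simp_all
    have "wp (Do [Const 25 0, Const 26 1]) 3 ?Q s2" if "\<not> at_end b r f t"
      using P2 that by (intro wp_Do) (simp_all add: P_def scan_state_def regs_ok_def)
    moreover have "wp (Do [Add 14 14 3, Sub 15 15 3, Add 25 15 2]) 3 ?Q s2" if "at_end b r f t"
      using P2 that by (intro wp_Do) (simp_all add: P_def scan_state_def regs_ok_def s2 adr_simps)
    ultimately show "if reg s2 29 \<noteq> 0 then wp (Do [Const 25 0, Const 26 1]) 3 ?Q s2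
        else wp (Do [Add 14 14 3, Sub 15 15 3, Add 25 15 2]) 3 ?Q s2" using e by auto
  qed simp
  show ?thesis unfolding scan_body_def
    by (rule wp_mono[OF wp_Seq'[OF 1 wp_Seq'[OF 2 3 order_refl] order_refl]]) (simp_all add: u_def)
qed

lemma wp_scan:
  assumes regs: "regs_ok n j 2 s" and tables: "tables_ok n (heap s)" and level: "level_ok n (heap s) j w f"
    and code: "bounded_code r f" and r: "r = fan_size w" "r \<le> n" and b: "heap s (adr n (lv j) 0) = b" "b < 2"
    and p: "p \<le> q" "\<And>t. t < p \<Longrightarrow> at_end b r f t" "p < q \<Longrightarrow> \<not> at_end b r f p"
    and T: "20 * q + 29 \<le> T"
  shows "wp scan_code T (\<lambda>s'. scan_state n j b r s p s' \<and> reg s' 26 = (if p < q then 1 else 0) \<and>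
    (p < q \<longrightarrow> reg s' 27 = f ! p \<and> reg s' 24 = (b + (f @ [0]) ! Suc p) mod 2)) s"
proof -
  note rr = regs_okD[OF regs]
  have fs: "heap s (adr n (lv j) 1) = r" using level r unfolding level_ok_def by simp
  let ?Q = "\<lambda>s'. scan_state n j b r s p s' \<and> reg s' 26 = (if p < q then 1 else 0) \<and>
    (p < q \<longrightarrow> reg s' 27 = f ! p \<and> reg s' 24 = (b + (f @ [0]) ! Suc p) mod 2)"
  \<comment> \<open>Stages up to \<open>p\<close> say that so many entries have been passed; stage
    \<open>p + 1\<close> is the successful end of the search and exists only if
    \<open>p < q\<close>. Hence there are \<open>min (Suc p) q\<close> iterations.\<close>
  define I where "I i s' \<longleftrightarrow> (if i \<le> p then scan_state n j b r s i s' \<and> reg s' 26 = 0 \<and>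
    reg s' 25 = (if i = 0 then 1 else q - i) else ?Q s' \<and> reg s' 25 = 0)" for i s'
  have 1: "wp (Do [Load 22 8, Add 14 8 3, Load 23 14, Const 14 2, Add 14 14 8, Add 15 4 2, Const 26 0, Const 25 1]) 8 (I 0) s"
  proof (rule wp_Do)
    show "I 0 (run_block [Load 22 8, Add 14 8 3, Load 23 14, Const 14 2, Add 14 14 8, Add 15 4 2, Const 26 0, Const 25 1] s)"
      using fs b(1) by (simp add: I_def scan_state_def regs_ok_def rr adr_simps)
  qed (simp_all add: rr adr_simps num_regs_le_adr)
  have step: "reg s' 25 \<noteq> 0 \<and> wp scan_body 18 (I (Suc i)) s'" if i: "i < min (Suc p) q" and Ii: "I i s'" for i s'
  proof -
    have "i \<le> p" "i < q" using i by auto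
    then have s': "scan_state n j b r s i s'" "reg s' 26 = 0" "reg s' 25 = (if i = 0 then 1 else q - i)"
      using Ii unfolding I_def by auto
    have "wp scan_body 18 (I (Suc i)) s'"
    proof (rule wp_mono[OF wp_scan_body[OF tables level code r b(2) \<open>i < q\<close> s'(1,2)] order_refl])
      fix s'' assume A: "if at_end b r f i then
        scan_state n j b r s (Suc i) s'' \<and> reg s'' 25 = q - Suc i \<and> reg s'' 26 = 0
        else scan_state n j b r s i s'' \<and> reg s'' 25 = 0 \<and> reg s'' 26 = 1 \<and> reg s'' 27 = f ! i \<and>
          reg s'' 24 = (b + (f @ [0]) ! Suc i) mod 2"
      show "I (Suc i) s''"
      proof (cases "i < p")
        case True
        then show ?thesis using A p(2)[OF True] unfolding I_def by simp
      next
        case False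
        then have "i = p" using \<open>i \<le> p\<close> by simp
        then show ?thesis using A p(3) \<open>i < q\<close> unfolding I_def by simp
      qed
    qed
    then show ?thesis using s'(3) \<open>i < q\<close> by simp
  qed
  have fin: "reg s' 25 = 0 \<and> ?Q s'" if "I (min (Suc p) q) s'" for s'
  proof (cases "p < q")
    case True
    then show ?thesis using that unfolding I_def by auto
  next
    case False
    then have "p = q" using p(1) by simp
    then show ?thesis using that q_pos unfolding I_def by simp
  qed
  have "min (Suc p) q * 20 \<le> q * 20" by (intro mult_le_mono1) simp
  then have bound: "min (Suc p) q * (18 + 2) + 1 \<le> 20 * q + 21" unfolding numeral_plus_numeral add_num_simps by linarith
  have 2: "wp (While 25 scan_body) (20 * q + 21) ?Q s1" if "I 0 s1" for s1
    by (rule wp_While_count[where m="min (Suc p) q" and B=18 and I=I, OF that step fin bound])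
  show ?thesis unfolding scan_code_def by (rule wp_Seq'[OF 1 2]) (use T in simp_all)
qed

lemma wp_back:
  assumes regs: "regs_ok n (Suc j) 2 s" and j: "Suc j < n" and b: "reg s 22 = b" and T: "8 \<le> T"
  shows "wp back_code T (\<lambda>s'. regs_ok n j 2 s' \<and> out s' = out s \<and>
    heap s' = (heap s)(adr n (lv (Suc j)) 0 := 1 - b)) s"
proof -
  note rr = regs_okD[OF regs]
  have "adr n (lv (Suc j)) 0 - stride n = adr n (lv j) 0" unfolding adr_Suc_level[symmetric] by simp
  moreover have "adr n 1 (2 * Suc j) - Suc (Suc 0) = adr n 1 (2 * j)" unfolding adr_def by simp
  moreover have "Suc (n - Suc (Suc j)) = n - Suc j" using j by simp
  moreover have "top_vertex (Suc j) - q = top_vertex j" unfolding top_vertex_Suc by simp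
  ultimately show ?thesis unfolding back_code_def using T
    by (intro wp_Do) (simp_all add: rr b regs_ok_def num_regs_le_adr)
qed

text \<open>The prefix is filled by the rule of \<open>monotone_move\<close>. The smaller one of the
  old and the new entry is the index of the strut that moves.\<close>

lemma wp_change:
  assumes tables: "tables_ok n (heap s)"
    and r: "r = fan_size w" "r \<le> n" and b: "b < 2" and p: "p < q"
    and s1: "scan_state n j b r s p s1" "reg s1 27 = f ! p" "reg s1 24 = (b + (f @ [0]) ! Suc p) mod 2"
    and v': "v' = (if even (b + (f @ [0]) ! Suc p) then f ! p + 1 else f ! p - 1)" "v' \<le> n"
    and T: "5 * q + 22 \<le> T"
  shows "wp change_code T (\<lambda>s'. regs_ok n j 2 s' \<and> out s' = out s \<and> reg s' 19 = min (f ! p) v' \<and>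
    (\<forall>x i. i < stride n \<longrightarrow> \<not> (x = lv j \<and> 2 \<le> i \<and> i \<le> 2 + p) \<longrightarrow> heap s' (adr n x i) = heap s (adr n x i)) \<and>
    heap s' (adr n (lv j) (2 + p)) = v' \<and>
    (\<forall>t<p. heap s' (adr n (lv j) (2 + t)) = (if even (b + v') then v' else r))) s1"
proof -
  let ?v = "f ! p" and ?u = "(b + (f @ [0]) ! Suc p) mod 2" and ?L = "lv j"
  have regs: "regs_ok n j 2 s1" and S: "heap s1 = heap s" "reg s1 22 = b" "reg s1 23 = r"
    "reg s1 14 = adr n ?L (2 + p)" "reg s1 15 = q - p" "out s1 = out s"
    using s1(1) unfolding scan_state_def by simp_all
  note rr = regs_okD[OF regs]
  have size: "2 + q < stride n" "2 + p < stride n" using p unfolding stride_def by simp_all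
  define c where "c = (if even (b + v') then v' else r)"
  define h where "h = (heap s)(adr n ?L (2 + p) := v')"
  have h: "h (adr n x i) = heap s (adr n x i)" if "i < stride n" "x \<noteq> ?L \<or> i \<noteq> 2 + p" for x i
    using that adr_eq_iff[OF that(1) size(2)] unfolding h_def by auto
  define P where "P s' \<longleftrightarrow> regs_ok n j 2 s' \<and> out s' = out s \<and> reg s' 22 = b \<and> reg s' 23 = r \<and>
    reg s' 15 = q - p \<and> reg s' 19 = min ?v v' \<and> reg s' 28 = v'" for s'
  have 1: "wp (Cond 24 (Do [Sub 28 27 3, Add 19 28 2]) (Do [Add 28 27 3, Add 19 27 2])) 4
      (\<lambda>s'. P s' \<and> heap s' = heap s \<and> reg s' 14 = adr n ?L (2 + p)) s1"
  proof (rule wp_Cond[where T=2])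
    let ?Q = "\<lambda>s'. P s' \<and> heap s' = heap s \<and> reg s' 14 = adr n ?L (2 + p)"
    have "wp (Do [Sub 28 27 3, Add 19 28 2]) 2 ?Q s1" if "?u \<noteq> 0"
    proof -
      have "v' = ?v - 1" using that v'(1) by (simp add: even_iff_mod_2_eq_zero)
      then show ?thesis by (intro wp_Do) (simp_all add: P_def regs_ok_def rr S s1(2))
    qed
    moreover have "wp (Do [Add 28 27 3, Add 19 27 2]) 2 ?Q s1" if "?u = 0"
    proof -
      have "v' = ?v + 1" using that v'(1) by (simp add: even_iff_mod_2_eq_zero)
      then show ?thesis by (intro wp_Do) (simp_all add: P_def regs_ok_def rr S s1(2))
    qed
    ultimately show "if reg s1 24 \<noteq> 0 then wp (Do [Sub 28 27 3, Add 19 28 2]) 2 ?Q s1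
        else wp (Do [Add 28 27 3, Add 19 27 2]) 2 ?Q s1" unfolding s1(3) by simp
  qed simp
  have 2: "wp (Do [Store 14 28, Add 16 28 28, Add 16 16 6, Add 16 16 3, Load 16 16,
         Sub 17 22 16, Sub 16 16 22, Add 17 17 16]) 8 (\<lambda>s'. P s' \<and> heap s' = h \<and> reg s' 17 = (b + v') mod 2) s2"
    if "P s2 \<and> heap s2 = heap s \<and> reg s2 14 = adr n ?L (2 + p)" for s2
  proof -
    have s2: "regs_ok n j 2 s2" "out s2 = out s" "reg s2 22 = b" "reg s2 23 = r" "reg s2 15 = q - p"
      "reg s2 19 = min ?v v'" "reg s2 28 = v'" "heap s2 = heap s" "reg s2 14 = adr n ?L (2 + p)"
      using that unfolding P_def by simp_all
    have "2 * v' + 1 < stride n" using v'(2) unfolding stride_def by simp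
    then have "adr n 0 (2 * v' + 1) \<noteq> adr n ?L (2 + p)" using adr_eq_iff size(2) lv_neq by simp
    moreover have "heap s (adr n 0 (2 * v' + 1)) = v' mod 2" using tables v'(2) unfolding tables_ok_def by simp
    ultimately have par: "adr n 0 (Suc (v' + v')) \<noteq> adr n ?L (Suc (Suc p))"
      "heap s (adr n 0 (Suc (v' + v'))) = v' mod 2" by (simp_all add: mult_2)
    show ?thesis
    proof (rule wp_Do)
      show "P (run_block [Store 14 28, Add 16 28 28, Add 16 16 6, Add 16 16 3, Load 16 16,
         Sub 17 22 16, Sub 16 16 22, Add 17 17 16] s2) \<and>
         heap (run_block [Store 14 28, Add 16 28 28, Add 16 16 6, Add 16 16 3, Load 16 16,
         Sub 17 22 16, Sub 16 16 22, Add 17 17 16] s2) = h \<and>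
         reg (run_block [Store 14 28, Add 16 28 28, Add 16 16 6, Add 16 16 3, Load 16 16,
         Sub 17 22 16, Sub 16 16 22, Add 17 17 16] s2) 17 = (b + v') mod 2"
        using par xor_parity[OF b, of v']
        by (simp add: P_def regs_ok_def regs_okD[OF s2(1)] s2 adr_simps h_def)
    qed (simp_all add: regs_okD[OF s2(1)] s2 adr_simps num_regs_le_adr)
  qed
  have 3: "wp (Cond 17 (Do [Add 21 23 2]) (Do [Add 21 28 2])) 3 (\<lambda>s'. P s' \<and> heap s' = h \<and> reg s' 21 = c) s3"
    if "P s3 \<and> heap s3 = h \<and> reg s3 17 = (b + v') mod 2" for s3
  proof (rule wp_Cond[where T=1])
    have s3: "P s3" "heap s3 = h" "reg s3 17 = (b + v') mod 2" "reg s3 23 = r" "reg s3 28 = v'" "reg s3 2 = 0"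
      using that unfolding P_def regs_ok_def by simp_all
    have "wp (Do [Add 21 23 2]) 1 (\<lambda>s'. P s' \<and> heap s' = h \<and> reg s' 21 = c) s3" if "(b + v') mod 2 \<noteq> 0"
    proof -
      have "c = r" using that unfolding c_def by (simp add: even_iff_mod_2_eq_zero)
      then show ?thesis using s3(1) by (intro wp_Do) (simp_all add: P_def regs_ok_def s3)
    qed
    moreover have "wp (Do [Add 21 28 2]) 1 (\<lambda>s'. P s' \<and> heap s' = h \<and> reg s' 21 = c) s3" if "(b + v') mod 2 = 0"
    proof -
      have "c = v'" using that unfolding c_def by (simp add: even_iff_mod_2_eq_zero)
      then show ?thesis using s3(1) by (intro wp_Do) (simp_all add: P_def regs_ok_def s3)
    qed
    ultimately show "if reg s3 17 \<noteq> 0 then wp (Do [Add 21 23 2]) 1 (\<lambda>s'. P s' \<and> heap s' = h \<and> reg s' 21 = c) s3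
       else wp (Do [Add 21 28 2]) 1 (\<lambda>s'. P s' \<and> heap s' = h \<and> reg s' 21 = c) s3" unfolding s3(3) by simp
  qed simp
  define P4 where "P4 s' \<longleftrightarrow> regs_ok n j 2 s' \<and> out s' = out s \<and> reg s' 19 = min ?v v' \<and> heap s' = h \<and>
    reg s' 21 = c \<and> reg s' 15 = p \<and> reg s' 20 = adr n ?L 2" for s'
  have 4: "wp (Do [Sub 15 4 15, Const 20 2, Add 20 20 8]) 3 P4 s4" if "P s4 \<and> heap s4 = h \<and> reg s4 21 = c" for s4
  proof -
    have s4: "regs_ok n j 2 s4" "reg s4 15 = q - p" "reg s4 19 = min ?v v'" using that unfolding P_def by simp_all
    show ?thesis using that p
      by (intro wp_Do) (simp_all add: P_def P4_def regs_ok_def regs_okD[OF s4(1)] adr_simps)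
  qed
  have 5: "wp fill_code (5 * q + 1) (\<lambda>s'. regs_ok n j 2 s' \<and> out s' = out s \<and> reg s' 19 = min (f ! p) v' \<and>
    (\<forall>x i. i < stride n \<longrightarrow> \<not> (x = lv j \<and> 2 \<le> i \<and> i \<le> 2 + p) \<longrightarrow> heap s' (adr n x i) = heap s (adr n x i)) \<and>
    heap s' (adr n (lv j) (2 + p)) = v' \<and>
    (\<forall>t<p. heap s' (adr n (lv j) (2 + t)) = (if even (b + v') then v' else r))) s5" if "P4 s5" for s5
  proof -
    have s5: "regs_ok n j 2 s5" "out s5 = out s" "reg s5 19 = min ?v v'" "heap s5 = h" "reg s5 21 = c"
      "reg s5 15 = p" "reg s5 20 = adr n ?L 2" using that unfolding P4_def by simp_all
    have "wp fill_code (5 * q + 1) (\<lambda>s'. keeps {15, 20} s5 s' \<and>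
      heap s' = (\<lambda>y. if reg s5 20 \<le> y \<and> y < reg s5 20 + reg s5 15 then reg s5 21 else heap s5 y)) s5"
      by (rule wp_fill) (use p in \<open>simp_all add: s5(6,7) regs_okD[OF s5(1)] num_regs_le_adr\<close>)
    then show ?thesis
    proof (rule wp_mono[OF _ order_refl])
      fix s' assume "keeps {15, 20} s5 s' \<and>
        heap s' = (\<lambda>y. if reg s5 20 \<le> y \<and> y < reg s5 20 + reg s5 15 then reg s5 21 else heap s5 y)"
      then have k: "keeps {15, 20} s5 s'"
        and hs: "heap s' = (\<lambda>y. if adr n ?L 2 \<le> y \<and> y < adr n ?L 2 + p then c else h y)"
        unfolding s5(4-7) by simp_all
      have rng: "adr n ?L 2 \<le> adr n x i \<and> adr n x i < adr n ?L 2 + p \<longleftrightarrow> x = ?L \<and> 2 \<le> i \<and> i < 2 + p"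
        if "i < stride n" for x i using adr_range[of i n 2 p ?L x] that size by simp
      have "regs_ok n j 2 s'" by (rule regs_ok_keeps[OF s5(1) k]) simp
      moreover have "heap s' (adr n x i) = heap s (adr n x i)"
        if "i < stride n" "\<not> (x = lv j \<and> 2 \<le> i \<and> i \<le> 2 + p)" for x i
        using that rng[OF that(1), of x] h[OF that(1), of x] unfolding hs by auto
      moreover have "heap s' (adr n ?L (2 + p)) = v'"
        using rng[OF size(2), of ?L] unfolding hs h_def by auto
      moreover have "heap s' (adr n ?L (2 + t)) = c" if "t < p" for t
        using rng[of "2 + t" ?L] that size unfolding hs by auto
      ultimately show "regs_ok n j 2 s' \<and> out s' = out s \<and> reg s' 19 = min (f ! p) v' \<and>
        (\<forall>x i. i < stride n \<longrightarrow> \<not> (x = lv j \<and> 2 \<le> i \<and> i \<le> 2 + p) \<longrightarrow> heap s' (adr n x i) = heap s (adr n x i)) \<and>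
        heap s' (adr n (lv j) (2 + p)) = v' \<and>
        (\<forall>t<p. heap s' (adr n (lv j) (2 + t)) = (if even (b + v') then v' else r))"
        using k s5(2,3) unfolding c_def by (simp add: keeps_def)
    qed
  qed
  show ?thesis unfolding change_code_def
    by (rule wp_Seq'[OF 1 wp_Seq'[OF 2 wp_Seq'[OF 3 wp_Seq'[OF 4 5 order_refl] order_refl] order_refl]])
      (use T in simp_all)
qed

text \<open>Counting the entries above the changed index yields the new shift in time linear in
  \<open>q\<close>; just one slot of the array of diagonals is rewritten.\<close>

lemma wp_move:
  assumes tables: "tables_ok n (heap s)" and level: "level_ok n (heap s) j w f" and code: "bounded_code r f"
    and r: "r = fan_size w" "r \<le> j" "j < n" and b: "b < 2" and p: "p < q"
    and s1: "scan_state n j b r s p s1" "reg s1 27 = f ! p" "reg s1 24 = (b + (f @ [0]) ! Suc p) mod 2"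
    and v': "v' = (if even (b + (f @ [0]) ! Suc p) then f ! p + 1 else f ! p - 1)" "v' \<le> r"
    and f': "f' = replicate p (if even (b + v') then v' else r) @ v' # drop (Suc p) f"
    and i: "i = min (f ! p) v'" "i < r"
    and T: "14 * q + 44 \<le> T"
  shows "wp move_code T (\<lambda>s'. regs_ok n j 1 s' \<and> out s' = out s \<and> level_ok n (heap s') j w f' \<and>
    (\<forall>x y. y < stride n \<longrightarrow> x \<noteq> 1 \<longrightarrow> x \<noteq> lv j \<or> y = 0 \<longrightarrow> heap s' (adr n x y) = heap s (adr n x y)) \<and>
    (\<forall>y<stride n. y \<noteq> 2 * (j - 1 - i) \<longrightarrow> y \<noteq> 2 * (j - 1 - i) + 1 \<longrightarrow> heap s' (adr n 1 y) = heap s (adr n 1 y)) \<and>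
    slot_ok n (heap s') (j - 1 - i) (strut_pair j w f' i)) s1"
proof -
  let ?L = "lv j"
  have len: "length f = q" using code unfolding bounded_code_def by simp
  have len': "length f' = q" unfolding f' using p len by simp
  have f'_nth: "f' ! t = (if t < p then if even (b + v') then v' else r else if t = p then v' else f ! t)" if "t < q" for t
    unfolding f' using that p len by (auto simp: nth_append nth_Cons' )
  have size: "2 + q < stride n" "2 * j + 1 < stride n" using r(3) unfolding stride_def by simp_all
  have sizew: "3 + q + y < stride n" if "y \<le> q * r" for y by (rule level_size[of r]) (use that r in simp_all)
  let ?d = "count_above f' i"
  have d: "?d \<le> q" using count_above_le[of f' i] len' by simp
  have id: "q * i + ?d \<le> q * r"
  proof -
    have "q * Suc i \<le> q * r" using i(2) by (intro mult_le_mono) auto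
    then show ?thesis using d by simp
  qed
  have rn: "r \<le> n" "v' \<le> n" using r v'(2) by simp_all
  define P1 where "P1 s' \<longleftrightarrow> regs_ok n j 2 s' \<and> out s' = out s \<and> reg s' 19 = i \<and> level_ok n (heap s') j w f' \<and>
    (\<forall>x y. y < stride n \<longrightarrow> \<not> (x = lv j \<and> 2 \<le> y \<and> y < 2 + q) \<longrightarrow> heap s' (adr n x y) = heap s (adr n x y))" for s'
  have 1: "wp change_code (5 * q + 22) P1 s1"
  proof (rule wp_mono[OF wp_change[OF tables r(1) rn(1) b p s1 v'(1) rn(2) order_refl] order_refl])
    fix s' assume A: "regs_ok n j 2 s' \<and> out s' = out s \<and> reg s' 19 = min (f ! p) v' \<and>
      (\<forall>x i. i < stride n \<longrightarrow> \<not> (x = lv j \<and> 2 \<le> i \<and> i \<le> 2 + p) \<longrightarrow> heap s' (adr n x i) = heap s (adr n x i)) \<and>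
      heap s' (adr n (lv j) (2 + p)) = v' \<and>
      (\<forall>t<p. heap s' (adr n (lv j) (2 + t)) = (if even (b + v') then v' else r))"
    have same: "heap s' (adr n x y) = heap s (adr n x y)" if "y < stride n" "\<not> (x = lv j \<and> 2 \<le> y \<and> y \<le> 2 + p)" for x y
      using A that by blast
    have "level_ok n (heap s') j w f'"
      unfolding level_ok_def
    proof (intro conjI allI impI)
      show "heap s' (adr n ?L 1) = fan_size w" using same[of 1 ?L] size level unfolding level_ok_def by simp
      show "heap s' (adr n ?L (2 + q)) = 0" using same[OF size(1), of ?L] p level unfolding level_ok_def by simp
      show "heap s' (adr n ?L (3 + q + y)) = w ! y" if "y \<le> q * fan_size w" for y
      proof -
        have "3 + q + y < stride n" using sizew that r(1) by simp
        then show ?thesis using same[of "3 + q + y" ?L] p level that unfolding level_ok_def by simp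
      qed
      show "heap s' (adr n ?L (2 + t)) = f' ! t" if t: "t < q" for t
      proof -
        have "heap s' (adr n ?L (2 + t)) = heap s (adr n ?L (2 + t))" if "p < t"
          using same[of "2 + t" ?L] t that size by simp
        then show ?thesis unfolding f'_nth[OF t] using A level t unfolding level_ok_def
          by (metis linorder_neqE_nat)
      qed
    qed
    moreover have "heap s' (adr n x y) = heap s (adr n x y)"
      if "y < stride n" "\<not> (x = lv j \<and> 2 \<le> y \<and> y < 2 + q)" for x y
      using same[OF that(1), of x] that(2) p by auto
    ultimately show "P1 s'" unfolding P1_def i(1) using A by blast
  qed
  have 2: "wp count_code (9 * q + 5) (\<lambda>s'. P1 s' \<and> reg s' 18 = ?d) s2" if "P1 s2" for s2
  proof -
    have s2: "regs_ok n j 2 s2" "out s2 = out s" "reg s2 19 = i" "level_ok n (heap s2) j w f'"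
      using that unfolding P1_def by simp_all
    have "wp count_code (9 * q + 5) (\<lambda>s'. keeps {14, 15, 16, 18} s2 s' \<and> heap s' = heap s2 \<and>
      reg s' 18 = count_above f' (reg s2 19)) s2"
    proof (rule wp_count)
      show "heap s2 (reg s2 8 + 2 + t) = f' ! t" if "t < length f'" for t
        using s2(4) that len' unfolding level_ok_def regs_okD[OF s2(1)] adr_add by simp
    qed (simp_all add: regs_okD[OF s2(1)] len' num_regs_le_adr)
    then show ?thesis
    proof (rule wp_mono[OF _ order_refl])
      fix s' assume A: "keeps {14, 15, 16, 18} s2 s' \<and> heap s' = heap s2 \<and> reg s' 18 = count_above f' (reg s2 19)"
      then have k: "keeps {14, 15, 16, 18} s2 s'" by blast
      have "regs_ok n j 2 s'" by (rule regs_ok_keeps[OF s2(1) k]) simp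
      then show "P1 s' \<and> reg s' 18 = ?d" using A that s2(3) unfolding P1_def by (simp add: keeps_def)
    qed
  qed
  define x where "x = w ! (q * i + ?d)"
  define y where "y = top_vertex j + ?d"
  have 3: "wp (Do [Add 14 6 19, Add 14 14 19, Load 14 14, Add 14 14 18, Add 14 14 4, Add 14 14 8, Const 16 3,
         Add 14 14 16, Load 16 14, Add 17 12 18, Sub 20 11 19, Sub 20 20 19, Sub 20 20 3, Store 20 17,
         Sub 20 20 3, Store 20 16, Const 10 1]) 17 (\<lambda>s'. regs_ok n j 1 s' \<and> out s' = out s \<and>
         heap s' = (heap s3)(adr n 1 (2 * (j - 1 - i) + 1) := y, adr n 1 (2 * (j - 1 - i)) := x)) s3"
    if "P1 s3 \<and> reg s3 18 = ?d" for s3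
  proof -
    have s3: "regs_ok n j 2 s3" "out s3 = out s" "reg s3 19 = i" "level_ok n (heap s3) j w f'" "reg s3 18 = ?d"
      using that unfolding P1_def by simp_all
    have tab: "heap s3 (adr n 0 (i + i)) = q * i"
    proof -
      have "2 * i < stride n" using i(2) r(2) size(2) by simp
      then have "heap s3 (adr n 0 (2 * i)) = heap s (adr n 0 (2 * i))" using that lv_neq(3)[of j] unfolding P1_def by simp
      then show ?thesis using tables i(2) r unfolding tables_ok_def by (simp add: mult_2)
    qed
    have "heap s3 (adr n ?L (3 + q + (q * i + ?d))) = x"
      using s3(4) id r(1) unfolding level_ok_def x_def by simp
    moreover have "q * i + ?d + q + 3 = 3 + q + (q * i + ?d)" by simp
    ultimately have hx: "heap s3 (adr n ?L (q * i + ?d + q + 3)) = x" by metis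
    have sub: "adr n (Suc 0) (2 * j) - i - i - Suc 0 = adr n (Suc 0) (Suc (2 * (j - Suc i)))"
      "adr n (Suc 0) (Suc (2 * (j - Suc i))) - Suc 0 = adr n (Suc 0) (2 * (j - Suc i))"
      using i(2) r(2) unfolding adr_def by simp_all
    have jeq: "j - Suc 0 - i = j - Suc i" by simp
    show ?thesis
    proof (rule wp_Do)
      show "safe_block [Add 14 6 19, Add 14 14 19, Load 14 14, Add 14 14 18, Add 14 14 4, Add 14 14 8, Const 16 3,
         Add 14 14 16, Load 16 14, Add 17 12 18, Sub 20 11 19, Sub 20 20 19, Sub 20 20 3, Store 20 17,
         Sub 20 20 3, Store 20 16, Const 10 1] s3"
        by (simp add: regs_okD[OF s3(1)] s3 adr_simps num_regs_le_adr tab sub del: diff_diff_left)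
      show "regs_ok n j 1 (run_block [Add 14 6 19, Add 14 14 19, Load 14 14, Add 14 14 18, Add 14 14 4, Add 14 14 8,
         Const 16 3, Add 14 14 16, Load 16 14, Add 17 12 18, Sub 20 11 19, Sub 20 20 19, Sub 20 20 3, Store 20 17,
         Sub 20 20 3, Store 20 16, Const 10 1] s3) \<and>
        out (run_block [Add 14 6 19, Add 14 14 19, Load 14 14, Add 14 14 18, Add 14 14 4, Add 14 14 8,
         Const 16 3, Add 14 14 16, Load 16 14, Add 17 12 18, Sub 20 11 19, Sub 20 20 19, Sub 20 20 3, Store 20 17,
         Sub 20 20 3, Store 20 16, Const 10 1] s3) = out s \<and>
        heap (run_block [Add 14 6 19, Add 14 14 19, Load 14 14, Add 14 14 18, Add 14 14 4, Add 14 14 8,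
         Const 16 3, Add 14 14 16, Load 16 14, Add 17 12 18, Sub 20 11 19, Sub 20 20 19, Sub 20 20 3, Store 20 17,
         Sub 20 20 3, Store 20 16, Const 10 1] s3) =
           (heap s3)(adr n 1 (2 * (j - 1 - i) + 1) := y, adr n 1 (2 * (j - 1 - i)) := x)"
        using hx
        by (simp add: regs_ok_def regs_okD[OF s3(1)] s3 adr_simps tab sub jeq y_def add.assoc del: diff_diff_left)
    qed simp
  qed
  have 4: "wp (Do [Add 14 6 19, Add 14 14 19, Load 14 14, Add 14 14 18, Add 14 14 4, Add 14 14 8, Const 16 3,
         Add 14 14 16, Load 16 14, Add 17 12 18, Sub 20 11 19, Sub 20 20 19, Sub 20 20 3, Store 20 17,
         Sub 20 20 3, Store 20 16, Const 10 1]) 17 (\<lambda>s'. regs_ok n j 1 s' \<and> out s' = out s \<and> level_ok n (heap s') j w f' \<and>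
    (\<forall>x y. y < stride n \<longrightarrow> x \<noteq> 1 \<longrightarrow> x \<noteq> lv j \<or> y = 0 \<longrightarrow> heap s' (adr n x y) = heap s (adr n x y)) \<and>
    (\<forall>y<stride n. y \<noteq> 2 * (j - 1 - i) \<longrightarrow> y \<noteq> 2 * (j - 1 - i) + 1 \<longrightarrow> heap s' (adr n 1 y) = heap s (adr n 1 y)) \<and>
    slot_ok n (heap s') (j - 1 - i) (strut_pair j w f' i)) s3"
    if "P1 s3 \<and> reg s3 18 = ?d" for s3
  proof (rule wp_mono[OF 3[OF that] order_refl])
    fix s' assume A: "regs_ok n j 1 s' \<and> out s' = out s \<and>
      heap s' = (heap s3)(adr n 1 (2 * (j - 1 - i) + 1) := y, adr n 1 (2 * (j - 1 - i)) := x)"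
    have s3: "level_ok n (heap s3) j w f'" and same: "\<And>x y. y < stride n \<Longrightarrow> \<not> (x = lv j \<and> 2 \<le> y \<and> y < 2 + q) \<Longrightarrow>
      heap s3 (adr n x y) = heap s (adr n x y)" using that unfolding P1_def by blast+
    have sz: "2 * (j - 1 - i) < stride n" "2 * (j - 1 - i) + 1 < stride n" using size(2) by simp_all
    have h: "heap s' (adr n x' y') = heap s3 (adr n x' y')"
      if "y' < stride n" "x' \<noteq> 1 \<or> (y' \<noteq> 2 * (j - 1 - i) \<and> y' \<noteq> 2 * (j - 1 - i) + 1)" for x' y'
      using A that adr_eq_iff[OF that(1) sz(1), of x' 1] adr_eq_iff[OF that(1) sz(2), of x' 1] by auto
    have lv1: "lv j \<noteq> 1" by (rule lv_neq)
    have "level_ok n (heap s') j w f'"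
      unfolding level_ok_def
    proof (intro conjI allI impI)
      show "heap s' (adr n ?L 1) = fan_size w" using h[of 1 ?L] lv1 size s3 unfolding level_ok_def by simp
      show "heap s' (adr n ?L (2 + q)) = 0" using h[of "2 + q" ?L] lv1 size s3 unfolding level_ok_def by simp
      show "heap s' (adr n ?L (3 + q + y)) = w ! y" if "y \<le> q * fan_size w" for y
        using h[of "3 + q + y" ?L] lv1 sizew[of y] r(1) that s3 unfolding level_ok_def by simp
      show "heap s' (adr n ?L (2 + t)) = f' ! t" if "t < q" for t
        using h[of "2 + t" ?L] lv1 size that s3 unfolding level_ok_def by simp
    qed
    moreover have "heap s' (adr n x' y') = heap s (adr n x' y')"
      if "y' < stride n" "x' \<noteq> 1" "x' \<noteq> lv j \<or> y' = 0" for x' y'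
      using h[of y' x'] same[of y' x'] that by auto
    moreover have "heap s' (adr n 1 y') = heap s (adr n 1 y')"
      if "y' < stride n" "y' \<noteq> 2 * (j - 1 - i)" "y' \<noteq> 2 * (j - 1 - i) + 1" for y'
      using h[of y' 1] same[of y' 1] that lv_neq(4)[of j] by auto
    moreover have "slot_ok n (heap s') (j - 1 - i) (strut_pair j w f' i)"
      using A adr_eq_iff[OF sz(1) sz(2), of 1 1] unfolding slot_ok_def strut_pair_def x_def y_def by simp
    ultimately show "regs_ok n j 1 s' \<and> out s' = out s \<and> level_ok n (heap s') j w f' \<and>
      (\<forall>x y. y < stride n \<longrightarrow> x \<noteq> 1 \<longrightarrow> x \<noteq> lv j \<or> y = 0 \<longrightarrow> heap s' (adr n x y) = heap s (adr n x y)) \<and>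
      (\<forall>y<stride n. y \<noteq> 2 * (j - 1 - i) \<longrightarrow> y \<noteq> 2 * (j - 1 - i) + 1 \<longrightarrow> heap s' (adr n 1 y) = heap s (adr n 1 y)) \<and>
      slot_ok n (heap s') (j - 1 - i) (strut_pair j w f' i)" using A by blast
  qed
  show ?thesis unfolding move_code_def
    by (rule wp_Seq'[OF 1 wp_Seq'[OF 2 4 order_refl]]) (use T in simp_all)
qed

text \<open>The prefix has finished its inner traversal and the moving entry has not reached its
  bound, so a search for the first entry that is not \<open>at_end\<close> finds the move. By the
  last claim only the moved strut can leave the fan, so every other strut required afterwards is
  already stored.\<close>

lemma monotone_move_at_end:
  assumes move: "monotone_move b r 0 f f'" and code: "bounded_code r f" "bounded_code r f'"
  obtains p v' where "p < q" "\<And>t. t < p \<Longrightarrow> at_end b r f t" "\<not> at_end b r f p"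
    "v' = (if even (b + (f @ [0]) ! Suc p) then f ! p + 1 else f ! p - 1)" "v' \<le> r"
    "f' = replicate p (if even (b + v') then v' else r) @ v' # drop (Suc p) f" "min (f ! p) v' < r"
    "\<And>i. i \<noteq> min (f ! p) v' \<Longrightarrow> count_above f i = count_above f' i"
    "\<And>i. last f' \<le> i \<Longrightarrow> i \<noteq> min (f ! p) v' \<Longrightarrow> last f \<le> i"
proof -
  obtain p v v' suf where *: "f = replicate p (if even (b + v) then r else v) @ v # suf"
    "f' = replicate p (if even (b + v') then v' else r) @ v' # suf"
    "if even (b + hd (suf @ [0])) then v < r \<and> v' = Suc v else v = Suc v' \<and> hd (suf @ [0]) \<le> v'"
    using move unfolding monotone_move_def by (elim exE conjE) (rule that)
  let ?c = "if even (b + v) then r else v"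
  have len: "length f = q" "set f \<subseteq> {0..r}" "set f' \<subseteq> {0..r}" using code unfolding bounded_code_def by auto
  have p: "p < q" using len(1) unfolding *(1) by simp
  have v: "v \<le> r" "v' \<le> r" using len(2,3) unfolding * by auto
  have fp: "f ! p = v" unfolding *(1) by (simp add: nth_append)
  have nxt: "(f @ [0]) ! Suc p = hd (suf @ [0])" unfolding *(1) by (cases suf) (auto simp: nth_append)
  have drop: "drop (Suc p) f = suf" unfolding *(1) by simp
  have vv': "v' = Suc v \<and> v < r \<or> v = Suc v' \<and> v' < r" using *(3) v by (auto split: if_splits)
  show ?thesis
  proof (rule that[of p v'])
    show "p < q" by (rule p)
    show "at_end b r f t" if t: "t < p" for t
    proof -
      have "f ! t = ?c" unfolding *(1) using t by (simp add: nth_append)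
      moreover have "(f @ [0]) ! Suc t = (if Suc t < p then ?c else v)"
        unfolding *(1) using t by (auto simp: nth_append nth_Cons')
      ultimately show ?thesis unfolding at_end_def by auto
    qed
    show "\<not> at_end b r f p" unfolding at_end_def fp nxt using *(3) by (auto split: if_splits)
    show "v' = (if even (b + (f @ [0]) ! Suc p) then f ! p + 1 else f ! p - 1)"
      unfolding fp nxt using *(3) by (auto split: if_splits)
    show "v' \<le> r" by (rule v)
    show "f' = replicate p (if even (b + v') then v' else r) @ v' # drop (Suc p) f" unfolding drop by (rule *(2))
    show "min (f ! p) v' < r" unfolding fp using vv' by auto
    show "count_above f i = count_above f' i" if "i \<noteq> min (f ! p) v'" for i
      using that vv' unfolding fp unfolding * by auto
    show "last f \<le> i" if "last f' \<le> i" "i \<noteq> min (f ! p) v'" for i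
      using that vv' unfolding fp unfolding * by (auto split: if_splits)
  qed
qed

text \<open>On the final code the scan passes all entries, and this is the signal to go back
  up.\<close>

lemma last_code_at_end:
  assumes "f = replicate q (if b = 0 then r else 0)" "b < 2" "t < q"
  shows "at_end b r f t"
proof -
  have "(f @ [0]) ! Suc t = (if Suc t < q then if b = 0 then r else 0 else 0)"
    using assms(1,3) by (auto simp: nth_append)
  then show ?thesis using assms unfolding at_end_def by (auto simp: less_2_cases_iff)
qed

lemma slots_ok_move:
  assumes "slots_ok n h j nd f lo" "lo = 0 \<and> lo' = 0 \<or> lo = last f \<and> lo' = last f'"
    "length (fst nd) + fan_size (snd nd) = j" "i < fan_size (snd nd)"
    "\<And>i'. i' \<noteq> i \<Longrightarrow> count_above f i' = count_above f' i'"
    "\<And>i'. last f' \<le> i' \<Longrightarrow> i' \<noteq> i \<Longrightarrow> last f \<le> i'"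
    "\<And>y. y < 2 * j \<Longrightarrow> y \<noteq> 2 * (j - 1 - i) \<Longrightarrow> y \<noteq> 2 * (j - 1 - i) + 1 \<Longrightarrow> h' (adr n 1 y) = h (adr n 1 y)"
    "slot_ok n h' (j - 1 - i) (strut_pair j (snd nd) f' i)"
  shows "slots_ok n h' j nd f' lo'"
proof -
  have keep: "slot_ok n h' k p" if "slot_ok n h k p" "k < j" "k \<noteq> j - 1 - i" for k p
  proof -
    have "2 * k < 2 * j" "2 * k + 1 < 2 * j" "2 * k \<noteq> 2 * (j - 1 - i)" "2 * k \<noteq> 2 * (j - 1 - i) + 1"
      "2 * k + 1 \<noteq> 2 * (j - 1 - i)" "2 * k + 1 \<noteq> 2 * (j - 1 - i) + 1" using that(2,3) by presburger+
    then have "h' (adr n 1 (2 * k)) = h (adr n 1 (2 * k))" "h' (adr n 1 (2 * k + 1)) = h (adr n 1 (2 * k + 1))"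
      using assms(7) by blast+
    then show ?thesis using that(1) unfolding slot_ok_def by simp
  qed
  show ?thesis
    unfolding slots_ok_def
  proof (intro conjI allI impI)
    fix k assume k: "k < length (fst nd)"
    then have "slot_ok n h k (fst nd ! k)" using assms(1) unfolding slots_ok_def by blast
    then show "slot_ok n h' k (fst nd ! k)" by (rule keep) (use k assms(3,4) in auto)
  next
    fix k assume k: "lo' \<le> k" "k < fan_size (snd nd)"
    show "slot_ok n h' (j - 1 - k) (strut_pair j (snd nd) f' k)"
    proof (cases "k = i")
      case True
      then show ?thesis using assms(8) by simp
    next
      case False
      then have "lo \<le> k" using assms(2,6) k by auto
      then have "slot_ok n h (j - 1 - k) (strut_pair j (snd nd) f k)" using assms(1) k unfolding slots_ok_def by blast
      moreover have "strut_pair j (snd nd) f k = strut_pair j (snd nd) f' k"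
        unfolding strut_pair_def using assms(5)[OF False] by simp
      ultimately show ?thesis using keep[of "j - 1 - k"] False k assms(3,4) by simp
    qed
  qed
qed

text \<open>The bound is made up of \<open>20 * q + 29\<close> for the scan and
  \<open>14 * q + 46\<close> for the branch.\<close>

lemma wp_step_move:
  assumes regs: "regs_ok n j 2 s" and tables: "tables_ok n (heap s)" and level: "level_ok n (heap s) j (snd nd) f"
    and coded: "coded n j nd f" and code': "bounded_code (fan_size (snd nd)) f'"
    and b: "heap s (adr n (lv j) 0) = b" "b < 2" and move: "monotone_move b (fan_size (snd nd)) 0 f f'"
    and slots: "slots_ok n (heap s) j nd f lo" "lo = 0 \<and> lo' = 0 \<or> lo = last f \<and> lo' = last f'"
    and T: "34 * q + 75 \<le> T"
  shows "wp step_code T (\<lambda>s'. regs_ok n j 1 s' \<and> out s' = out s \<and> level_ok n (heap s') j (snd nd) f' \<and>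
    slots_ok n (heap s') j nd f' lo' \<and>
    (\<forall>x y. y < stride n \<longrightarrow> x \<noteq> 1 \<longrightarrow> x \<noteq> lv j \<or> y = 0 \<longrightarrow> heap s' (adr n x y) = heap s (adr n x y)) \<and>
    (\<forall>y<2 * length (fst nd). heap s' (adr n 1 y) = heap s (adr n 1 y))) s"
proof -
  let ?r = "fan_size (snd nd)"
  have code: "bounded_code ?r f" and lj: "length (fst nd) + ?r = j" using coded unfolding coded_def by auto
  note c = codedD[OF coded]
  obtain p v' where p: "p < q" "\<And>t. t < p \<Longrightarrow> at_end b ?r f t" "\<not> at_end b ?r f p"
    "v' = (if even (b + (f @ [0]) ! Suc p) then f ! p + 1 else f ! p - 1)" "v' \<le> ?r"
    "f' = replicate p (if even (b + v') then v' else ?r) @ v' # drop (Suc p) f" "min (f ! p) v' < ?r"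
    "\<And>i. i \<noteq> min (f ! p) v' \<Longrightarrow> count_above f i = count_above f' i"
    "\<And>i. last f' \<le> i \<Longrightarrow> i \<noteq> min (f ! p) v' \<Longrightarrow> last f \<le> i"
    using monotone_move_at_end[OF move code code'] by blast
  define i where "i = min (f ! p) v'"
  have rn: "?r \<le> n" using c by simp
  have size: "2 * j < stride n" using c(4) unfolding stride_def by simp
  have 1: "wp scan_code (20 * q + 29) (\<lambda>s'. scan_state n j b ?r s p s' \<and> reg s' 26 = (if p < q then 1 else 0) \<and>
    (p < q \<longrightarrow> reg s' 27 = f ! p \<and> reg s' 24 = (b + (f @ [0]) ! Suc p) mod 2)) s"
    by (rule wp_scan[OF regs tables level code refl rn b]) (use p in auto)
  have 2: "wp (Cond 26 move_code back_code) (14 * q + 46) (\<lambda>s'. regs_ok n j 1 s' \<and> out s' = out s \<and>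
    level_ok n (heap s') j (snd nd) f' \<and> slots_ok n (heap s') j nd f' lo' \<and>
    (\<forall>x y. y < stride n \<longrightarrow> x \<noteq> 1 \<longrightarrow> x \<noteq> lv j \<or> y = 0 \<longrightarrow> heap s' (adr n x y) = heap s (adr n x y)) \<and>
    (\<forall>y<2 * length (fst nd). heap s' (adr n 1 y) = heap s (adr n 1 y))) s1"
    if A: "scan_state n j b ?r s p s1 \<and> reg s1 26 = (if p < q then 1 else 0) \<and>
      (p < q \<longrightarrow> reg s1 27 = f ! p \<and> reg s1 24 = (b + (f @ [0]) ! Suc p) mod 2)" for s1
  proof -
    have s1: "scan_state n j b ?r s p s1" "reg s1 27 = f ! p" "reg s1 24 = (b + (f @ [0]) ! Suc p) mod 2" "reg s1 26 = 1"
      using A p(1) by simp_all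
    have "wp move_code (14 * q + 44) (\<lambda>s'. regs_ok n j 1 s' \<and> out s' = out s \<and>
      level_ok n (heap s') j (snd nd) f' \<and> slots_ok n (heap s') j nd f' lo' \<and>
      (\<forall>x y. y < stride n \<longrightarrow> x \<noteq> 1 \<longrightarrow> x \<noteq> lv j \<or> y = 0 \<longrightarrow> heap s' (adr n x y) = heap s (adr n x y)) \<and>
      (\<forall>y<2 * length (fst nd). heap s' (adr n 1 y) = heap s (adr n 1 y))) s1"
    proof (rule wp_mono[OF wp_move[OF tables level code refl c(3,4) b(2) p(1) s1(1-3) p(4,5,6) i_def p(7)[folded i_def] order_refl] order_refl])
      fix s' assume B: "regs_ok n j 1 s' \<and> out s' = out s \<and> level_ok n (heap s') j (snd nd) f' \<and>
        (\<forall>x y. y < stride n \<longrightarrow> x \<noteq> 1 \<longrightarrow> x \<noteq> lv j \<or> y = 0 \<longrightarrow> heap s' (adr n x y) = heap s (adr n x y)) \<and>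
        (\<forall>y<stride n. y \<noteq> 2 * (j - 1 - i) \<longrightarrow> y \<noteq> 2 * (j - 1 - i) + 1 \<longrightarrow> heap s' (adr n 1 y) = heap s (adr n 1 y)) \<and>
        slot_ok n (heap s') (j - 1 - i) (strut_pair j (snd nd) f' i)"
      have same: "heap s' (adr n 1 y) = heap s (adr n 1 y)"
        if "y < 2 * j" "y \<noteq> 2 * (j - 1 - i)" "y \<noteq> 2 * (j - 1 - i) + 1" for y
        using B that size by (meson less_trans)
      have "slots_ok n (heap s') j nd f' lo'"
        by (rule slots_ok_move[OF slots lj p(7)[folded i_def] p(8)[folded i_def] p(9)[folded i_def] same])
          (use B in auto)
      moreover have "heap s' (adr n 1 y) = heap s (adr n 1 y)" if "y < 2 * length (fst nd)" for y
        by (rule same) (use that lj p(7)[folded i_def] in auto)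
      ultimately show "regs_ok n j 1 s' \<and> out s' = out s \<and>
        level_ok n (heap s') j (snd nd) f' \<and> slots_ok n (heap s') j nd f' lo' \<and>
        (\<forall>x y. y < stride n \<longrightarrow> x \<noteq> 1 \<longrightarrow> x \<noteq> lv j \<or> y = 0 \<longrightarrow> heap s' (adr n x y) = heap s (adr n x y)) \<and>
        (\<forall>y<2 * length (fst nd). heap s' (adr n 1 y) = heap s (adr n 1 y))" using B by blast
    qed
    then show ?thesis by (intro wp_Cond[where T="14 * q + 44"]) (simp_all add: s1(4))
  qed
  show ?thesis unfolding step_code_def by (rule wp_Seq'[OF 1 2]) (use T in simp_all)
qed

lemma wp_step_back:
  assumes regs: "regs_ok n (Suc j) 2 s" and tables: "tables_ok n (heap s)"
    and level: "level_ok n (heap s) (Suc j) (snd nd) f" and coded: "coded n (Suc j) nd f"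
    and b: "heap s (adr n (lv (Suc j)) 0) = b" "b < 2" and f: "f = replicate q (if b = 0 then fan_size (snd nd) else 0)"
    and T: "34 * q + 75 \<le> T"
  shows "wp step_code T (\<lambda>s'. regs_ok n j 2 s' \<and> out s' = out s \<and>
    heap s' = (heap s)(adr n (lv (Suc j)) 0 := 1 - b)) s"
proof -
  let ?r = "fan_size (snd nd)"
  have code: "bounded_code ?r f" using coded unfolding coded_def by auto
  note c = codedD[OF coded]
  have rn: "?r \<le> n" using c by simp
  have 1: "wp scan_code (20 * q + 29) (\<lambda>s'. scan_state n (Suc j) b ?r s q s' \<and> reg s' 26 = (if q < q then 1 else 0) \<and>
    (q < q \<longrightarrow> reg s' 27 = f ! q \<and> reg s' 24 = (b + (f @ [0]) ! Suc q) mod 2)) s"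
    by (rule wp_scan[OF regs tables level code refl rn b]) (use last_code_at_end[OF f b(2)] in auto)
  have 2: "wp (Cond 26 move_code back_code) 10 (\<lambda>s'. regs_ok n j 2 s' \<and> out s' = out s \<and>
    heap s' = (heap s)(adr n (lv (Suc j)) 0 := 1 - b)) s1"
    if A: "scan_state n (Suc j) b ?r s q s1 \<and> reg s1 26 = (if q < q then 1 else 0) \<and>
      (q < q \<longrightarrow> reg s1 27 = f ! q \<and> reg s1 24 = (b + (f @ [0]) ! Suc q) mod 2)" for s1
  proof -
    have s1: "regs_ok n (Suc j) 2 s1" "out s1 = out s" "heap s1 = heap s" "reg s1 22 = b" "reg s1 26 = 0"
      using A unfolding scan_state_def by simp_all
    have "wp back_code 8 (\<lambda>s'. regs_ok n j 2 s' \<and> out s' = out s \<and>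
      heap s' = (heap s)(adr n (lv (Suc j)) 0 := 1 - b)) s1"
      using wp_back[OF s1(1) c(4) s1(4) order_refl] unfolding s1(2,3) .
    then show ?thesis by (intro wp_Cond[where T=8]) (simp_all add: s1(5))
  qed
  show ?thesis unfolding step_code_def by (rule wp_Seq'[OF 1 2]) (use T in simp_all)
qed

end

section \<open>The main loop\<close>

text \<open>Register \<open>16\<close> holds the mode minus one, so a test for zero tells the way
  down from the way up. The way up ends on level \<open>0\<close>, and the way down ends with a
  visit when no level is left.\<close>

definition body_code :: com where
  "body_code = Do [Sub 16 10 3] ;;
     Cond 16 (Cond 9 step_code (Do [Const 10 0])) (Cond 13 init_code (Do [Visit 7, Const 10 2]))"

section \<open>The invariant of the main loop and the cost of a subtree\<close>

context dissecting
begin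

lemma wp_body:
  assumes regs: "regs_ok n j M s" and "M \<noteq> 0"
    and c: "c = (if M = 1 then if n - 1 - j \<noteq> 0 then init_code else Do [Visit 7, Const 10 2]
                 else if j \<noteq> 0 then step_code else Do [Const 10 0])"
    and wp: "\<And>s'. regs_ok n j M s' \<Longrightarrow> heap s' = heap s \<Longrightarrow> out s' = out s \<Longrightarrow> wp c T Q s'"
    and T: "T + 5 \<le> T'"
  shows "wp body_code T' Q s"
proof -
  note r = regs_okD[OF regs]
  define P where "P s' \<longleftrightarrow> regs_ok n j M s' \<and> heap s' = heap s \<and> out s' = out s \<and> reg s' 16 = M - 1" for s'
  have 1: "wp (Do [Sub 16 10 3]) 1 P s" by (intro wp_Do) (simp_all add: P_def regs_ok_def r)
  have 2: "wp (Cond 16 (Cond 9 step_code (Do [Const 10 0])) (Cond 13 init_code (Do [Visit 7, Const 10 2]))) (T + 4) Q s1"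
    if "P s1" for s1
  proof -
    have s1: "regs_ok n j M s1" "heap s1 = heap s" "out s1 = out s" "reg s1 16 = M - 1"
      using that unfolding P_def by simp_all
    have wp1: "wp c T Q s1" by (rule wp[OF s1(1-3)])
    show ?thesis
    proof (rule wp_Cond[where T="T + 2"])
      have "wp (Cond 9 step_code (Do [Const 10 0])) (T + 2) Q s1" if "M \<noteq> 1"
        by (rule wp_Cond[where T=T]) (use wp1 that in \<open>simp_all add: c regs_okD[OF s1(1)] split: if_splits\<close>)
      moreover have "wp (Cond 13 init_code (Do [Visit 7, Const 10 2])) (T + 2) Q s1" if "M = 1"
        by (rule wp_Cond[where T=T]) (use wp1 that in \<open>simp_all add: c regs_okD[OF s1(1)] split: if_splits\<close>)
      ultimately show "if reg s1 16 \<noteq> 0 then wp (Cond 9 step_code (Do [Const 10 0])) (T + 2) Q s1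
        else wp (Cond 13 init_code (Do [Visit 7, Const 10 2])) (T + 2) Q s1"
        unfolding s1(4) using \<open>M \<noteq> 0\<close> by auto
    qed simp
  qed
  show ?thesis unfolding body_code_def by (rule wp_Seq'[OF 1 2]) (use T in simp_all)
qed

text \<open>The memory is zero initially, and codes and links are written around these words. All
  levels are included because the deeper ones are entered later.\<close>

definition sentinels_ok :: "nat \<Rightarrow> (nat \<Rightarrow> nat) \<Rightarrow> bool" where
  "sentinels_ok n h \<longleftrightarrow> (\<forall>j<n. h (adr n (lv j) (2 + q)) = 0)"

text \<open>\<open>bs\<close> holds the bits of the levels below \<open>j\<close>, in the order in
  which \<open>zigzag\<close> consumes them. The bit of level \<open>j\<close> itself is tracked
  separately.\<close>

definition state :: "nat \<Rightarrow> nat \<Rightarrow> node \<Rightarrow> nat list \<Rightarrow> nat list \<Rightarrow> nat \<Rightarrow> store \<Rightarrow> bool" where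
  "state n j nd f bs M s \<longleftrightarrow> regs_ok n j M s \<and> tables_ok n (heap s) \<and> level_ok n (heap s) j (snd nd) f \<and>
     sentinels_ok n (heap s) \<and> slots_ok n (heap s) j nd f (if Suc j = n then 0 else last f) \<and>
     (\<forall>i<length bs. heap s (adr n (lv (Suc j + i)) 0) = bs ! i)"

text \<open>What the traversal of a subtree leaves alone: the table, the regions up to level
  \<open>j\<close> and the first \<open>m\<close> diagonals. Region \<open>1\<close>, the array of
  diagonals, is exempt from the first clause since all levels share it.\<close>

definition untouched :: "nat \<Rightarrow> nat \<Rightarrow> nat \<Rightarrow> store \<Rightarrow> store \<Rightarrow> bool" where
  "untouched n j m s s' \<longleftrightarrow>
     (\<forall>x i. i < stride n \<longrightarrow> x \<noteq> 1 \<longrightarrow> x \<le> lv j \<longrightarrow> heap s' (adr n x i) = heap s (adr n x i)) \<and>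
     (\<forall>i<2 * m. heap s' (adr n 1 i) = heap s (adr n 1 i))"

lemma untouched_refl: "untouched n j m s s"
  unfolding untouched_def by simp

lemma untouched_trans:
  assumes "untouched n j m s s'" "untouched n j' m' s' s''" "j \<le> j'" "m \<le> m'"
  shows "untouched n j m s s''"
proof -
  have "lv j \<le> lv j'" using assms(3) unfolding lv_def by simp
  then have "heap s'' (adr n x i) = heap s (adr n x i)" if "i < stride n" "x \<noteq> 1" "x \<le> lv j" for x i
    using assms(1,2) that unfolding untouched_def by (metis le_trans)
  moreover have "heap s'' (adr n 1 i) = heap s (adr n 1 i)" if "i < 2 * m" for i
  proof -
    have "i < 2 * m'" using that assms(4) by simp
    then show ?thesis using assms(1,2) that unfolding untouched_def by simp
  qed
  ultimately show ?thesis unfolding untouched_def by blast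
qed

definition visits :: "nat \<Rightarrow> store \<Rightarrow> store \<Rightarrow> node list \<Rightarrow> bool" where
  "visits n s s' us \<longleftrightarrow> (\<exists>vs. out s' = out s @ vs \<and> map (stored_dissection n) vs = map (dissection_of n) us)"

lemma visits_trans: "visits n s s' us \<Longrightarrow> visits n s' s'' vs \<Longrightarrow> visits n s s'' (us @ vs)"
  unfolding visits_def by (metis append.assoc map_append)

lemma visits_out_eq: "visits n s s' us \<Longrightarrow> out s0 = out s \<Longrightarrow> out s'' = out s' \<Longrightarrow> visits n s0 s'' us"
  unfolding visits_def by simp

lemma tables_ok_untouched:
  assumes "tables_ok n (heap s)" "untouched n j m s s'"
  shows "tables_ok n (heap s')"
  unfolding tables_ok_def
proof (intro allI impI conjI)
  fix i assume i: "i \<le> n"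
  have "2 * i < stride n" "2 * i + 1 < stride n" using i unfolding stride_def by simp_all
  then have "heap s' (adr n 0 (2 * i)) = heap s (adr n 0 (2 * i))"
    "heap s' (adr n 0 (2 * i + 1)) = heap s (adr n 0 (2 * i + 1))"
    using assms(2) unfolding untouched_def by simp_all
  then show "heap s' (adr n 0 (2 * i)) = q * i" "heap s' (adr n 0 (2 * i + 1)) = i mod 2"
    using assms(1) i unfolding tables_ok_def by simp_all
qed

lemma level_ok_untouched:
  assumes "level_ok n (heap s) j (snd nd) f" "untouched n j m s s'" "coded n j nd f"
  shows "level_ok n (heap s') j (snd nd) f"
proof -
  have same: "heap s' (adr n (lv j) i) = heap s (adr n (lv j) i)" if "i < stride n" for i
    using assms(2) that lv_neq(2)[of j] unfolding untouched_def by simp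
  have size: "2 + q < stride n" unfolding stride_def by simp
  have "3 + q + i < stride n" if "i \<le> q * fan_size (snd nd)" for i
    by (rule level_size[OF _ that]) (use codedD[OF assms(3)] in simp)
  then show ?thesis using assms(1) same size unfolding level_ok_def by simp
qed

lemma slots_ok_untouched:
  assumes "slots_ok n h j nd f (last f)" "coded n j nd f"
    "\<And>i. i < 2 * length (fst (child j nd f)) \<Longrightarrow> h' (adr n 1 i) = h (adr n 1 i)"
  shows "slots_ok n h' j nd f (last f)"
proof -
  have len: "length (fst (child j nd f)) + last f = j" by (rule link_of_child(3)[OF assms(2)])
  have lj: "length (fst nd) + fan_size (snd nd) = j" using assms(2) unfolding coded_def by simp
  have keep: "slot_ok n h' i p" if "slot_ok n h i p" "i < length (fst (child j nd f))" for i p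
    using that assms(3)[of "2 * i"] assms(3)[of "2 * i + 1"] unfolding slot_ok_def by simp
  have le: "length (fst nd) \<le> length (fst (child j nd f))" unfolding child_def by simp
  show ?thesis
    unfolding slots_ok_def
  proof (intro conjI allI impI)
    fix i assume "i < length (fst nd)"
    then show "slot_ok n h' i (fst nd ! i)" using assms(1) le keep unfolding slots_ok_def by simp
  next
    fix i assume i: "last f \<le> i" "i < fan_size (snd nd)"
    then have "j - 1 - i < length (fst (child j nd f))" using len lj by linarith
    then show "slot_ok n h' (j - 1 - i) (strut_pair j (snd nd) f i)"
      using assms(1) i keep unfolding slots_ok_def by simp
  qed
qed

lemma coded_child:
  assumes "coded n j nd f" "Suc j < n" "bounded_code (fan_size (snd (child j nd f))) f'"
  shows "coded n (Suc j) (child j nd f) f'"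
  using link_of_child(1-3)[OF assms(1)] assms(2,3) unfolding coded_def by simp

lemma stored_dissection_slots:
  assumes "slots_ok n h j nd f 0" "coded n j nd f" "n = Suc j" "node_ok j nd" "1 \<le> j"
  shows "stored_dissection n (\<lambda>i. h (adr n 1 i)) = dissection_of n (child j nd f)"
proof -
  let ?r = "fan_size (snd nd)"
  have lj: "length (fst nd) + ?r = j" and code: "bounded_code ?r f" using assms(2) unfolding coded_def by auto
  have D: "dissection_of n (child j nd f) = pairs (fst nd) \<union> struts j (snd nd) (count_above f) {..<?r}"
    using child_ok(2)[OF assms(4,5) code] assms(3) by simp
  let ?e = "\<lambda>i. {h (adr n 1 (2 * i)), h (adr n 1 (2 * i + 1))}"
  have "stored_dissection n (\<lambda>i. h (adr n 1 i)) = ?e ` {..<j}"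
    unfolding stored_dissection_def assms(3) by auto
  also have "{..<j} = {..<length (fst nd)} \<union> (\<lambda>i. j - 1 - i) ` {..<?r}"
  proof (intro set_eqI iffI)
    fix i assume "i \<in> {..<j}"
    then show "i \<in> {..<length (fst nd)} \<union> (\<lambda>i. j - 1 - i) ` {..<?r}"
      using lj by (cases "i < length (fst nd)") (auto intro!: image_eqI[of _ _ "j - 1 - i"])
  qed (use lj in auto)
  also have "?e ` \<dots> = ?e ` {..<length (fst nd)} \<union> (\<lambda>i. ?e (j - 1 - i)) ` {..<?r}"
    by (simp add: image_Un image_image)
  also have "?e ` {..<length (fst nd)} = pairs (fst nd)"
  proof -
    have "?e i = (\<lambda>(a, b). {a, b}) (fst nd ! i)" if "i < length (fst nd)" for i
      using assms(1) that unfolding slots_ok_def slot_ok_def by (simp add: case_prod_unfold)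
    then have "?e ` {..<length (fst nd)} = (\<lambda>i. (\<lambda>(a, b). {a, b}) (fst nd ! i)) ` {..<length (fst nd)}"
      by (intro image_cong) auto
    also have "\<dots> = (\<lambda>(a, b). {a, b}) ` ((!) (fst nd) ` {0..<length (fst nd)})"
      by (simp add: image_image lessThan_atLeast0)
    also have "(!) (fst nd) ` {0..<length (fst nd)} = set (fst nd)" using nth_image[of "length (fst nd)" "fst nd"] by simp
    finally show ?thesis unfolding pairs_def .
  qed
  also have "(\<lambda>i. ?e (j - 1 - i)) ` {..<?r} = struts j (snd nd) (count_above f) {..<?r}"
    unfolding struts_def
  proof (rule image_cong)
    fix i assume "i \<in> {..<?r}"
    then have "slot_ok n h (j - 1 - i) (strut_pair j (snd nd) f i)" using assms(1) unfolding slots_ok_def by simp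
    then show "?e (j - 1 - i) = {snd nd ! (q * i + count_above f i), top_vertex j + count_above f i}"
      unfolding slot_ok_def strut_pair_def by simp
  qed simp
  finally show ?thesis unfolding D .
qed

text \<open>\<open>278 = 2 * (57 + 82)\<close>: a node spends \<open>57 * (q + 1)\<close> per child
  on the descent into it and \<open>82 * (q + 1)\<close> per child on the step to the next sibling
  or back. The factor two leaves half of the credit to be passed on.\<close>

definition cost :: nat where
  "cost = 278 * (q + 1)"

lemma reach_body:
  assumes "regs_ok n j M s" "M \<noteq> 0"
    "c = (if M = 1 then if n - 1 - j \<noteq> 0 then init_code else Do [Visit 7, Const 10 2]
          else if j \<noteq> 0 then step_code else Do [Const 10 0])"
    "\<And>s'. regs_ok n j M s' \<Longrightarrow> heap s' = heap s \<Longrightarrow> out s' = out s \<Longrightarrow> wp c T Q s'"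
    "T + 7 \<le> T'"
  shows "reach 10 body_code T' Q s"
proof (rule reach_step)
  show "reg s 10 \<noteq> 0" using regs_okD(9)[OF assms(1)] assms(2) by simp
  show "wp body_code (T + 5) Q s" by (rule wp_body[OF assms(1-4)]) simp_all
qed (use assms(5) in simp)

lemma reach_visit:
  assumes n: "n = Suc j" "2 \<le> n" and coded: "coded n j nd f" and nd: "1 \<le> j \<Longrightarrow> node_ok j nd"
    and state: "state n j nd f [] 1 s"
  shows "reach 10 body_code 9 (\<lambda>s'. state n j nd f [] 2 s' \<and> untouched n j m s s' \<and> visits n s s' [child j nd f]) s"
proof (rule reach_body[where T=2])
  show "regs_ok n j 1 s" using state unfolding state_def by blast
  have j: "1 \<le> j" using n by simp
  fix s1 assume s1: "regs_ok n j 1 s1" "heap s1 = heap s" "out s1 = out s"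
  have "stored_dissection n (\<lambda>i. heap s1 (adr n 1 i)) = dissection_of n (child j nd f)"
    by (rule stored_dissection_slots[OF _ coded n(1) nd[OF j] j])
      (use state n in \<open>simp add: state_def s1(2)\<close>)
  then have "visits n s (s1\<lparr>out := out s1 @ [\<lambda>i. heap s1 (adr n 1 i)]\<rparr>) [child j nd f]"
    unfolding visits_def using s1(3) by (intro exI[of _ "[\<lambda>i. heap s1 (adr n 1 i)]"]) simp
  then have v: "visits n s s' [child j nd f]" if "out s' = out s1 @ [\<lambda>i. heap s1 (adr n 1 i)]" for s'
    using that unfolding visits_def by simp
  show "wp (Do [Visit 7, Const 10 2]) 2
      (\<lambda>s'. state n j nd f [] 2 s' \<and> untouched n j m s s' \<and> visits n s s' [child j nd f]) s1"
  proof (rule wp_Do)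
    let ?s' = "run_block [Visit 7, Const 10 2] s1"
    have "out ?s' = out s1 @ [\<lambda>i. heap s1 (adr n 1 i)]"
      by (simp add: regs_okD[OF s1(1)] adr_simps)
    moreover have "heap ?s' = heap s" using s1(2) by simp
    moreover have "regs_ok n j 2 ?s'" using s1(1) unfolding regs_ok_def by simp
    ultimately show "state n j nd f [] 2 ?s' \<and> untouched n j m s ?s' \<and> visits n s ?s' [child j nd f]"
      using state v unfolding state_def untouched_def by simp
  qed (simp_all add: regs_okD[OF s1(1)] num_regs_le_adr)
qed (use n in simp_all)

text \<open>\<open>IH\<close> is the claim for the subtrees of the children. Summed over
  \<open>fs\<close> it leaves the credit \<open>cost\<close> per child, against which stands one
  \<open>step_code\<close> per child: a move, or the way back after the last one.\<close>

lemma visit_children: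
  assumes IH: "\<And>f bs s us bs'. bounded_code r f \<Longrightarrow> length bs = h \<Longrightarrow> set bs \<subseteq> {0, 1} \<Longrightarrow>
      state n (Suc j) nd f bs 1 s \<Longrightarrow> zigzag h (Suc (Suc j)) (child (Suc j) nd f) bs = (us, bs') \<Longrightarrow>
      length bs' = h \<and> set bs' \<subseteq> {0, 1} \<and> (\<exists>T. T + cost \<le> 2 * cost * length us \<and>
        reach 10 body_code T (\<lambda>s'. state n (Suc j) nd f bs' 2 s' \<and>
          untouched n (Suc j) (length (fst (child (Suc j) nd f))) s s' \<and> visits n s s' us) s)"
    and coded: "\<And>f. bounded_code r f \<Longrightarrow> coded n (Suc j) nd f" and r: "r = fan_size (snd nd)" and b: "b < 2"
    and "fs \<noteq> []" "successively (monotone_move b r 0) fs" "\<forall>f\<in>set fs. bounded_code r f"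
    "last fs = replicate q (if b = 0 then r else 0)" "state n (Suc j) nd (hd fs) bs 1 s"
    "heap s (adr n (lv (Suc j)) 0) = b" "length bs = h" "set bs \<subseteq> {0, 1}"
    "zigzags (zigzag h (Suc (Suc j))) (map (child (Suc j) nd) fs) bs = (us, bs')"
  shows "\<exists>T. T + cost * length fs \<le> 2 * cost * length us + 82 * (q + 1) * length fs \<and>
    reach 10 body_code T (\<lambda>s'. regs_ok n j 2 s' \<and> sentinels_ok n (heap s') \<and>
      heap s' (adr n (lv (Suc j)) 0) = 1 - b \<and> (\<forall>i<length bs'. heap s' (adr n (lv (Suc (Suc j) + i)) 0) = bs' ! i) \<and>
      untouched n j (length (fst nd)) s s' \<and> visits n s s' us) s"
  using assms(5-)
proof (induction fs arbitrary: bs s us bs')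
  case (Cons f fs)
  obtain us1 bs1 where z1: "zigzag h (Suc (Suc j)) (child (Suc j) nd f) bs = (us1, bs1)" by fastforce
  obtain us2 bs2 where z2: "zigzags (zigzag h (Suc (Suc j))) (map (child (Suc j) nd) fs) bs1 = (us2, bs2)" by fastforce
  have us: "us = us1 @ us2" "bs' = bs2" using Cons.prems(9) z1 z2 by simp_all
  have f: "bounded_code r f" using Cons.prems(3) by simp
  have st: "state n (Suc j) nd f bs 1 s" using Cons.prems(5) by simp
  obtain T1 where bs1: "length bs1 = h" "set bs1 \<subseteq> {0, 1}" and T1: "T1 + cost \<le> 2 * cost * length us1"
    and reach1: "reach 10 body_code T1 (\<lambda>s'. state n (Suc j) nd f bs1 2 s' \<and>
          untouched n (Suc j) (length (fst (child (Suc j) nd f))) s s' \<and> visits n s s' us1) s"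
    using IH[OF f Cons.prems(7,8) st z1] by blast
  have cf: "coded n (Suc j) nd f" by (rule coded[OF f])
  have size: "0 < stride n" "2 + q < stride n" unfolding stride_def by simp_all
  have len: "length (fst nd) \<le> length (fst (child (Suc j) nd f))" unfolding child_def by simp
  have weak: "untouched n j (length (fst nd)) s s'"
    if "untouched n (Suc j) (length (fst (child (Suc j) nd f))) s s'" for s'
    by (rule untouched_trans[OF untouched_refl that _ len]) simp
  define Q where "Q us s' \<longleftrightarrow> regs_ok n j 2 s' \<and> sentinels_ok n (heap s') \<and> heap s' (adr n (lv (Suc j)) 0) = 1 - b \<and>
    (\<forall>i<length bs'. heap s' (adr n (lv (Suc (Suc j) + i)) 0) = bs' ! i) \<and>
    untouched n j (length (fst nd)) s s' \<and> visits n s s' us" for us s'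
  have time: "34 * q + 75 + 7 \<le> 82 * (q + 1)" by simp
  have cM: "step_code = (if (2::nat) = 1 then if n - 1 - Suc j \<noteq> 0 then init_code else Do [Visit 7, Const 10 2]
       else if Suc j \<noteq> 0 then step_code else Do [Const 10 0])" by simp
  show ?case
  proof (cases "fs = []")
    case True
    then have e: "us = us1" "bs' = bs1" using us z2 by simp_all
    have flast: "f = replicate q (if b = 0 then fan_size (snd nd) else 0)" using Cons.prems(4) True r by simp
    have "reach 10 body_code (T1 + 82 * (q + 1)) (Q us) s"
    proof (rule reach_trans[OF reach1])
      fix s1 assume A: "state n (Suc j) nd f bs1 2 s1 \<and>
          untouched n (Suc j) (length (fst (child (Suc j) nd f))) s s1 \<and> visits n s s1 us1"
      then have u: "untouched n (Suc j) (length (fst (child (Suc j) nd f))) s s1" by blast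
      have s1: "regs_ok n (Suc j) 2 s1" "tables_ok n (heap s1)" "level_ok n (heap s1) (Suc j) (snd nd) f"
        "sentinels_ok n (heap s1)" "\<forall>i<length bs1. heap s1 (adr n (lv (Suc (Suc j) + i)) 0) = bs1 ! i"
        using A unfolding state_def by simp_all
      have b1: "heap s1 (adr n (lv (Suc j)) 0) = b"
        using u Cons.prems(6) size lv_neq(2) unfolding untouched_def by simp
      show "reach 10 body_code (82 * (q + 1)) (Q us) s1"
      proof (rule reach_body[OF s1(1) _ cM _ time])
        fix s0 assume s0: "regs_ok n (Suc j) 2 s0" "heap s0 = heap s1" "out s0 = out s1"
        show "wp step_code (34 * q + 75) (Q us) s0"
        proof (rule wp_mono[OF wp_step_back[OF s0(1) _ _ cf _ b flast order_refl] order_refl])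
          fix s' assume B: "regs_ok n j 2 s' \<and> out s' = out s0 \<and> heap s' = (heap s0)(adr n (lv (Suc j)) 0 := 1 - b)"
          have h: "heap s' (adr n x i) = heap s1 (adr n x i)" if "i < stride n" "x \<noteq> lv (Suc j) \<or> i \<noteq> 0" for x i
            using B s0(2) that adr_eq_iff[OF that(1) size(1), of x "lv (Suc j)"] by auto
          have "sentinels_ok n (heap s')" using s1(4) h size(2) unfolding sentinels_ok_def by simp
          moreover have "heap s' (adr n (lv (Suc j)) 0) = 1 - b" using B by simp
          moreover have "heap s' (adr n (lv (Suc (Suc j) + i)) 0) = bs1 ! i" if "i < length bs1" for i
            using h[OF size(1), of "lv (Suc (Suc j) + i)"] s1(5) that by (simp add: lv_neq)
          moreover have "untouched n j (length (fst nd)) s1 s'"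
          proof -
            have "x \<noteq> lv (Suc j)" if "x \<le> lv j" for x using that unfolding lv_def by simp
            moreover have "2 * length (fst nd) \<le> stride n"
              using cf unfolding coded_def stride_def by simp
            moreover have "1 \<noteq> lv (Suc j)" by (rule lv_neq)
            ultimately show ?thesis unfolding untouched_def using h by (meson less_le_trans)
          qed
          then have "untouched n j (length (fst nd)) s s'" by (rule untouched_trans[OF weak[OF u] _ order_refl order_refl])
          moreover have "visits n s s' us1" using visits_out_eq[of n s s1 us1 s s'] A B s0(3) by simp
          ultimately show "Q us s'" unfolding Q_def e using B by blast
        qed (simp_all add: s0 s1 b1)
      qed simp
    qed simp
    moreover have "T1 + 82 * (q + 1) + cost * length (f # fs) \<le> 2 * cost * length us + 82 * (q + 1) * length (f # fs)"
      using T1 True e by simp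
    ultimately show ?thesis unfolding Q_def by blast
  next
    case False
    then obtain f2 fs2 where fs: "fs = f2 # fs2" by (cases fs) auto
    have move: "monotone_move b (fan_size (snd nd)) 0 f f2" using Cons.prems(2) fs r by simp
    have f2: "bounded_code (fan_size (snd nd)) f2" using Cons.prems(3) fs r by simp
    define P where "P s2 \<longleftrightarrow> state n (Suc j) nd f2 bs1 1 s2 \<and> heap s2 (adr n (lv (Suc j)) 0) = b \<and>
      untouched n j (length (fst nd)) s s2 \<and> visits n s s2 us1" for s2
    have reach2: "reach 10 body_code (T1 + 82 * (q + 1)) P s"
    proof (rule reach_trans[OF reach1])
      fix s1 assume A: "state n (Suc j) nd f bs1 2 s1 \<and>
          untouched n (Suc j) (length (fst (child (Suc j) nd f))) s s1 \<and> visits n s s1 us1"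
      then have u: "untouched n (Suc j) (length (fst (child (Suc j) nd f))) s s1" by blast
      let ?lo = "if Suc (Suc j) = n then 0 else last f" and ?lo' = "if Suc (Suc j) = n then 0 else last f2"
      have s1: "regs_ok n (Suc j) 2 s1" "tables_ok n (heap s1)" "level_ok n (heap s1) (Suc j) (snd nd) f"
        "sentinels_ok n (heap s1)" "\<forall>i<length bs1. heap s1 (adr n (lv (Suc (Suc j) + i)) 0) = bs1 ! i"
        "slots_ok n (heap s1) (Suc j) nd f ?lo"
        using A unfolding state_def by simp_all
      have b1: "heap s1 (adr n (lv (Suc j)) 0) = b"
        using u Cons.prems(6) size lv_neq(2) unfolding untouched_def by simp
      have lo: "?lo = 0 \<and> ?lo' = 0 \<or> ?lo = last f \<and> ?lo' = last f2" by simp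
      show "reach 10 body_code (82 * (q + 1)) P s1"
      proof (rule reach_body[OF s1(1) _ cM _ time])
        fix s0 assume s0: "regs_ok n (Suc j) 2 s0" "heap s0 = heap s1" "out s0 = out s1"
        show "wp step_code (34 * q + 75) P s0"
        proof (rule wp_mono[OF wp_step_move[OF s0(1) _ _ cf f2 _ b move _ lo order_refl] order_refl])
          fix s2 assume B: "regs_ok n (Suc j) 1 s2 \<and> out s2 = out s0 \<and> level_ok n (heap s2) (Suc j) (snd nd) f2 \<and>
            slots_ok n (heap s2) (Suc j) nd f2 ?lo' \<and>
            (\<forall>x y. y < stride n \<longrightarrow> x \<noteq> 1 \<longrightarrow> x \<noteq> lv (Suc j) \<or> y = 0 \<longrightarrow> heap s2 (adr n x y) = heap s0 (adr n x y)) \<and>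
            (\<forall>y<2 * length (fst nd). heap s2 (adr n 1 y) = heap s0 (adr n 1 y))"
          have h: "heap s2 (adr n x y) = heap s1 (adr n x y)"
            if "y < stride n" "x \<noteq> 1" "x \<noteq> lv (Suc j) \<or> y = 0" for x y using B that s0(2) by simp
          have ut: "untouched n j (length (fst nd)) s1 s2"
          proof -
            have "x \<noteq> lv (Suc j)" if "x \<le> lv j" for x using that unfolding lv_def by simp
            then show ?thesis unfolding untouched_def using h B s0(2) by simp
          qed
          have "tables_ok n (heap s2)" by (rule tables_ok_untouched[OF s1(2) ut])
          moreover have "sentinels_ok n (heap s2)"
            unfolding sentinels_ok_def
          proof (intro allI impI)
            fix j' assume j': "j' < n"
            show "heap s2 (adr n (lv j') (2 + q)) = 0"
            proof (cases "j' = Suc j")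
              case True
              then show ?thesis using B unfolding level_ok_def by simp
            next
              case False
              then show ?thesis using h[OF size(2), of "lv j'"] s1(4) j' lv_neq unfolding sentinels_ok_def by simp
            qed
          qed
          moreover have "heap s2 (adr n (lv (Suc (Suc j) + i)) 0) = bs1 ! i" if "i < length bs1" for i
            using h[OF size(1), of "lv (Suc (Suc j) + i)"] s1(5) that lv_neq by simp
          moreover have "heap s2 (adr n (lv (Suc j)) 0) = b" using h[OF size(1)] b1 lv_neq by simp
          moreover have "untouched n j (length (fst nd)) s s2"
            by (rule untouched_trans[OF weak[OF u] ut order_refl order_refl])
          moreover have "visits n s s2 us1" using visits_out_eq[of n s s1 us1 s s2] A B s0(3) by simp
          ultimately show "P s2" unfolding P_def state_def using B by blast
        qed (simp_all add: s0 s1 b1)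
      qed simp
    qed simp
    have succ: "successively (monotone_move b r 0) fs" using Cons.prems(2) fs by simp
    have IH2: "\<exists>T. T + cost * length fs \<le> 2 * cost * length us2 + 82 * (q + 1) * length fs \<and>
      reach 10 body_code T (\<lambda>s'. regs_ok n j 2 s' \<and> sentinels_ok n (heap s') \<and>
      heap s' (adr n (lv (Suc j)) 0) = 1 - b \<and> (\<forall>i<length bs2. heap s' (adr n (lv (Suc (Suc j) + i)) 0) = bs2 ! i) \<and>
      untouched n j (length (fst nd)) s2 s' \<and> visits n s2 s' us2) s2" if "P s2" for s2
      using that succ Cons.prems(3,4) bs1 z2 fs unfolding P_def by (intro Cons.IH) simp_all
    have rest: "\<exists>T. T + cost * length fs \<le> 2 * cost * length us2 + 82 * (q + 1) * length fs \<and>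
      reach 10 body_code T (Q us) s2" if P: "P s2" for s2
    proof -
      obtain T where T: "T + cost * length fs \<le> 2 * cost * length us2 + 82 * (q + 1) * length fs"
        and rT: "reach 10 body_code T (\<lambda>s'. regs_ok n j 2 s' \<and> sentinels_ok n (heap s') \<and>
      heap s' (adr n (lv (Suc j)) 0) = 1 - b \<and> (\<forall>i<length bs2. heap s' (adr n (lv (Suc (Suc j) + i)) 0) = bs2 ! i) \<and>
      untouched n j (length (fst nd)) s2 s' \<and> visits n s2 s' us2) s2"
        using IH2[OF P] by blast
      have "reach 10 body_code T (Q us) s2"
      proof -
        have "Q us s'" if B: "regs_ok n j 2 s' \<and> sentinels_ok n (heap s') \<and>
          heap s' (adr n (lv (Suc j)) 0) = 1 - b \<and> (\<forall>i<length bs2. heap s' (adr n (lv (Suc (Suc j) + i)) 0) = bs2 ! i) \<and>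
          untouched n j (length (fst nd)) s2 s' \<and> visits n s2 s' us2" for s'
        proof -
          have "untouched n j (length (fst nd)) s s2" "visits n s s2 us1" using P unfolding P_def by simp_all
          then have "untouched n j (length (fst nd)) s s'" "visits n s s' us"
            using untouched_trans[of n j "length (fst nd)" s s2 j "length (fst nd)" s'] visits_trans B us by simp_all
          then show ?thesis unfolding Q_def us(2) using B by blast
        qed
        then show ?thesis using rT unfolding reach_def by blast
      qed
      then show ?thesis using T by blast
    qed
    \<comment> \<open>The time obtained for the remaining children may depend on the state
      \<open>s2\<close>. The largest value permitted by the bound serves all states; the existence
      of one such state shows that the subtraction is not truncated.\<close>
    obtain T2 where T2: "T2 + cost * length fs \<le> 2 * cost * length us2 + 82 * (q + 1) * length fs"
      and r2: "\<And>s2. P s2 \<Longrightarrow> reach 10 body_code T2 (Q us) s2"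
    proof -
      define T2 where "T2 = 2 * cost * length us2 + 82 * (q + 1) * length fs - cost * length fs"
      obtain s2 where "P s2" using reach2 unfolding reach_def by blast
      then have "cost * length fs \<le> 2 * cost * length us2 + 82 * (q + 1) * length fs"
        using rest by fastforce
      then have "T2 + cost * length fs \<le> 2 * cost * length us2 + 82 * (q + 1) * length fs" unfolding T2_def by simp
      moreover have "reach 10 body_code T2 (Q us) s2" if P: "P s2" for s2
      proof -
        obtain T where "T + cost * length fs \<le> 2 * cost * length us2 + 82 * (q + 1) * length fs"
          "reach 10 body_code T (Q us) s2"
          using rest[OF P] by blast
        moreover then have "T \<le> T2" unfolding T2_def by simp
        ultimately show ?thesis unfolding reach_def by (meson le_trans)
      qed
      ultimately show thesis by (rule that)
    qed
    have "reach 10 body_code (T1 + 82 * (q + 1) + T2) (Q us) s" by (rule reach_trans[OF reach2 r2]) simp_all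
    moreover have "T1 + 82 * (q + 1) + T2 + cost * length (f # fs) \<le> 2 * cost * length us + 82 * (q + 1) * length (f # fs)"
      using T1 T2 us(1) by (simp add: algebra_simps)
    ultimately show ?thesis unfolding Q_def by blast
  qed
qed simp

lemma length_zigzags:
  assumes "\<And>x bs. x \<in> set xs \<Longrightarrow> m \<le> length (fst (g x bs))"
  shows "length xs * m \<le> length (fst (zigzags g xs bs))"
  using assms
proof (induction xs arbitrary: bs)
  case (Cons x xs)
  obtain us bs' where us: "g x bs = (us, bs')" by fastforce
  obtain vs bs'' where vs: "zigzags g xs bs' = (vs, bs'')" by fastforce
  have "m \<le> length us" using Cons.prems[of x bs] us by simp
  moreover have "length xs * m \<le> length vs" using Cons.IH[of bs'] Cons.prems vs by simp
  ultimately show ?case using us vs by simp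
qed simp

lemma length_monotone_code_ge: "r + 1 \<le> length (monotone_code b r q 0)"
  using length_monotone_code[of r 0 b "q - 1"] q_pos by simp

text \<open>Every node has at least two children, so a subtree has more leaves than levels below its
  root. This bounds the preparation time, which is linear in \<open>n\<close>, by the number of
  leaves.\<close>

lemma length_zigzag:
  assumes "node_ok l nd" "1 \<le> l" "1 \<le> fan_size (snd nd)"
  shows "h < length (fst (zigzag h l nd bs))"
  using assms
proof (induction h arbitrary: l nd bs)
  case (Suc h)
  define fs where "fs = monotone_code (hd bs) (fan_size (snd nd)) q 0"
  have "Suc h \<le> length (fst (zigzag h (Suc l) x bs'))" if "x \<in> set (map (child l nd) fs)" for x bs'
  proof -
    have "x \<in> child l nd ` set fs" using that by simp
    then obtain f where f: "x = child l nd f" "bounded_code (fan_size (snd nd)) f"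
      unfolding fs_def bounded_code_iff[of _ _ "hd bs"] by blast
    show ?thesis unfolding f(1) using Suc.IH child_ok[OF Suc.prems(1,2) f(2)] by (simp add: Suc_leI)
  qed
  then have "length (map (child l nd) fs) * Suc h \<le> length (fst (zigzags (zigzag h (Suc l)) (map (child l nd) fs) (tl bs)))"
    by (rule length_zigzags)
  moreover have "2 * Suc h \<le> length fs * Suc h"
    using length_monotone_code_ge[of "fan_size (snd nd)" "hd bs"] Suc.prems(3) unfolding fs_def by (intro mult_le_mono1) simp
  moreover have "fst (zigzag (Suc h) l nd bs) = fst (zigzags (zigzag h (Suc l)) (map (child l nd) fs) (tl bs))"
    unfolding fs_def by (simp add: case_prod_unfold Let_def)
  ultimately show ?case by simp
qed simp

lemma visit_subtree:
  assumes "n = Suc (j + h)" "2 \<le> n" "coded n j nd f" "node_ok (Suc j) (child j nd f)" "1 \<le> j \<Longrightarrow> node_ok j nd"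
    "length bs = h" "set bs \<subseteq> {0, 1}" "state n j nd f bs 1 s" "zigzag h (Suc j) (child j nd f) bs = (us, bs')"
  shows "length bs' = h \<and> set bs' \<subseteq> {0, 1} \<and> (\<exists>T. T + cost \<le> 2 * cost * length us \<and>
    reach 10 body_code T (\<lambda>s'. state n j nd f bs' 2 s' \<and>
      untouched n j (length (fst (child j nd f))) s s' \<and> visits n s s' us) s)"
  using assms
proof (induction h arbitrary: j nd f bs s us bs')
  case 0
  then have e: "bs = []" "us = [child j nd f]" "bs' = []" by auto
  have "9 + cost \<le> 2 * cost * length us" unfolding e cost_def by simp
  moreover have "reach 10 body_code 9 (\<lambda>s'. state n j nd f bs' 2 s' \<and>
      untouched n j (length (fst (child j nd f))) s s' \<and> visits n s s' us) s"
    unfolding e by (rule reach_visit) (use 0 e in simp_all)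
  ultimately show ?case using e by auto
next
  case (Suc h)
  define nd' where "nd' = child j nd f"
  define r where "r = fan_size (snd nd')"
  obtain b bs1 where bs: "bs = b # bs1" using Suc.prems(6) by (cases bs) auto
  have b: "b < 2" "length bs1 = h" "set bs1 \<subseteq> {0, 1}" using Suc.prems(6,7) bs by auto
  define fs where "fs = monotone_code b r q 0"
  obtain us' bs1' where z': "zigzags (zigzag h (Suc (Suc j))) (map (child (Suc j) nd') fs) bs1 = (us', bs1')" by fastforce
  have "zigzag (Suc h) (Suc j) nd' bs = (us', (1 - b) # bs1')" using z' unfolding bs fs_def r_def by simp
  then have bs': "bs' = (1 - b) # bs1'" and z: "zigzags (zigzag h (Suc (Suc j))) (map (child (Suc j) nd') fs) bs1 = (us, bs1')"
    using Suc.prems(9) z' unfolding nd'_def[symmetric] by simp_all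
  have j: "Suc j < n" using Suc.prems(1) by simp
  have r: "r = last f + 1" unfolding r_def nd'_def by (rule link_of_child(1)[OF Suc.prems(3)])
  have nd': "node_ok (Suc j) nd'" unfolding nd'_def by (rule Suc.prems(4))
  have coded: "coded n (Suc j) nd' f'" if "bounded_code r f'" for f'
    unfolding nd'_def by (rule coded_child[OF Suc.prems(3) j]) (use that in \<open>simp add: r_def nd'_def\<close>)
  have fs: "fs \<noteq> []" "hd fs = replicate q (if b = 0 then 0 else r)" "last fs = replicate q (if b = 0 then r else 0)"
    using hd_last_monotone_code[of 0 r b q] b(1) unfolding fs_def by (auto simp: less_2_cases_iff)
  have code: "\<forall>f\<in>set fs. bounded_code r f" using bounded_code_iff unfolding fs_def by blast
  have succ: "successively (monotone_move b r 0) fs" unfolding fs_def by (rule successively_monotone_code) simp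
  have st: "regs_ok n j 1 s" "tables_ok n (heap s)" "level_ok n (heap s) j (snd nd) f" "sentinels_ok n (heap s)"
    "slots_ok n (heap s) j nd f (last f)" "heap s (adr n (lv (Suc j)) 0) = b"
    "\<And>i. i < h \<Longrightarrow> heap s (adr n (lv (Suc (Suc j) + i)) 0) = bs1 ! i"
  proof -
    have bits: "heap s (adr n (lv (Suc j + i)) 0) = bs ! i" if "i < Suc h" for i
      using Suc.prems(6,8) that unfolding state_def by simp
    show "heap s (adr n (lv (Suc j)) 0) = b" using bits[of 0] bs by simp
    show "heap s (adr n (lv (Suc (Suc j) + i)) 0) = bs1 ! i" if "i < h" for i using bits[of "Suc i"] bs that by simp
  qed (use Suc.prems(8) j in \<open>simp_all add: state_def\<close>)
  have size: "0 < stride n" "2 + q < stride n" unfolding stride_def by simp_all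
  define P where "P s1 \<longleftrightarrow> state n (Suc j) nd' (hd fs) bs1 1 s1 \<and> heap s1 (adr n (lv (Suc j)) 0) = b \<and>
    untouched n j (length (fst nd')) s s1 \<and> out s1 = out s" for s1
  have reach1: "reach 10 body_code (57 * (q + 1) * length fs) P s"
  proof (rule reach_body[OF st(1)])
    show "init_code = (if (1::nat) = 1 then if n - 1 - j \<noteq> 0 then init_code else Do [Visit 7, Const 10 2]
       else if j \<noteq> 0 then step_code else Do [Const 10 0])" using j by simp
    show "50 * (q + 1) * (last f + 2) + 7 \<le> 57 * (q + 1) * length fs"
    proof -
      \<comment> \<open>The node entered has \<open>last f + 1\<close> fan cells, hence enough
        children to share the cost of the descent.\<close>
      have "last f + 2 \<le> length fs" using length_monotone_code_ge[of r b] r unfolding fs_def by simp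
      then have "(q + 1) * (last f + 2) \<le> (q + 1) * length fs" by (rule mult_le_mono2)
      moreover have "2 * 1 \<le> (q + 1) * (last f + 2)" using q_pos by (intro mult_le_mono) auto
      ultimately show ?thesis by linarith
    qed
    fix s0 assume s0: "regs_ok n j 1 s0" "heap s0 = heap s" "out s0 = out s"
    have init: "wp init_code (50 * (q + 1) * (last f + 2)) (\<lambda>s'. regs_ok n (Suc j) 1 s' \<and> out s' = out s0 \<and>
      level_ok n (heap s') (Suc j) (snd nd') (hd fs) \<and> slots_ok n (heap s') (Suc j) nd' (hd fs) 0 \<and>
      (\<forall>x i. i < stride n \<longrightarrow> x \<noteq> 1 \<longrightarrow> x \<noteq> lv (Suc j) \<or> i = 0 \<longrightarrow> heap s' (adr n x i) = heap s0 (adr n x i)) \<and>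
      (\<forall>i<2 * length (fst nd'). heap s' (adr n 1 i) = heap s0 (adr n 1 i))) s0"
    proof -
      have "heap s0 (adr n (lv (Suc j)) (2 + q)) = 0" using st(4) j s0(2) unfolding sentinels_ok_def by simp
      from wp_init[OF s0(1) j _ _ Suc.prems(3) _ this order_refl] show ?thesis
        using st(2,3,5,6) s0(2) fs(2) unfolding nd'_def[symmetric] r_def[symmetric] by simp
    qed
    show "wp init_code (50 * (q + 1) * (last f + 2)) P s0"
    proof (rule wp_mono[OF init order_refl])
      fix s1 assume A: "regs_ok n (Suc j) 1 s1 \<and> out s1 = out s0 \<and>
      level_ok n (heap s1) (Suc j) (snd nd') (hd fs) \<and> slots_ok n (heap s1) (Suc j) nd' (hd fs) 0 \<and>
      (\<forall>x i. i < stride n \<longrightarrow> x \<noteq> 1 \<longrightarrow> x \<noteq> lv (Suc j) \<or> i = 0 \<longrightarrow> heap s1 (adr n x i) = heap s0 (adr n x i)) \<and>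
      (\<forall>i<2 * length (fst nd'). heap s1 (adr n 1 i) = heap s0 (adr n 1 i))"
      have h: "heap s1 (adr n x i) = heap s (adr n x i)"
        if "i < stride n" "x \<noteq> 1" "x \<noteq> lv (Suc j) \<or> i = 0" for x i using A that s0(2) by simp
      have ut: "untouched n j (length (fst nd')) s s1"
      proof -
        have "x \<noteq> lv (Suc j)" if "x \<le> lv j" for x using that unfolding lv_def by simp
        then show ?thesis unfolding untouched_def using h A s0(2) by simp
      qed
      have "tables_ok n (heap s1)" by (rule tables_ok_untouched[OF st(2) ut])
      moreover have "sentinels_ok n (heap s1)"
        unfolding sentinels_ok_def
      proof (intro allI impI)
        fix j' assume j': "j' < n"
        show "heap s1 (adr n (lv j') (2 + q)) = 0"
        proof (cases "j' = Suc j")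
          case True
          then show ?thesis using A unfolding level_ok_def by simp
        next
          case False
          then show ?thesis using h[OF size(2), of "lv j'"] st(4) j' lv_neq unfolding sentinels_ok_def by simp
        qed
      qed
      moreover have "heap s1 (adr n (lv (Suc (Suc j) + i)) 0) = bs1 ! i" if "i < length bs1" for i
        using h[OF size(1), of "lv (Suc (Suc j) + i)"] st(7) that b(2) lv_neq by simp
      moreover have "heap s1 (adr n (lv (Suc j)) 0) = b" using h[OF size(1)] st(6) lv_neq by simp
      moreover have "slots_ok n (heap s1) (Suc j) nd' (hd fs) (if Suc (Suc j) = n then 0 else last (hd fs))"
        using A unfolding slots_ok_def by simp
      moreover have "out s1 = out s" using A s0(3) by simp
      ultimately show "P s1" unfolding P_def state_def using A ut by blast
    qed
  qed simp
  have IH: "length bs' = h \<and> set bs' \<subseteq> {0, 1} \<and> (\<exists>T. T + cost \<le> 2 * cost * length us \<and>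
        reach 10 body_code T (\<lambda>s'. state n (Suc j) nd' f bs' 2 s' \<and>
          untouched n (Suc j) (length (fst (child (Suc j) nd' f))) s s' \<and> visits n s s' us) s)"
    if "bounded_code r f" "length bs = h" "set bs \<subseteq> {0, 1}" "state n (Suc j) nd' f bs 1 s"
      "zigzag h (Suc (Suc j)) (child (Suc j) nd' f) bs = (us, bs')" for f bs s us bs'
    by (rule Suc.IH) (use that Suc.prems(1,2) coded nd' child_ok(1)[OF nd'] in \<open>simp_all add: r_def\<close>)
  define Q where "Q s1 s' \<longleftrightarrow> regs_ok n j 2 s' \<and> sentinels_ok n (heap s') \<and>
      heap s' (adr n (lv (Suc j)) 0) = 1 - b \<and>
      (\<forall>i<length bs1'. heap s' (adr n (lv (Suc (Suc j) + i)) 0) = bs1' ! i) \<and>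
      untouched n j (length (fst nd')) s1 s' \<and> visits n s1 s' us" for s1 s'
  have children: "\<exists>T. T + cost * length fs \<le> 2 * cost * length us + 82 * (q + 1) * length fs \<and>
    reach 10 body_code T (Q s1) s1" if "P s1" for s1
    unfolding Q_def
    by (rule visit_children[OF IH coded r_def b(1) fs(1) succ code fs(3)])
      (use that b(2,3) z in \<open>simp_all add: P_def\<close>)
  obtain t1 s1 where t1: "loops 10 body_code s t1 s1" "t1 \<le> 57 * (q + 1) * length fs" "P s1"
    using reach1 unfolding reach_def by blast
  obtain T t2 s2 where T: "T + cost * length fs \<le> 2 * cost * length us + 82 * (q + 1) * length fs"
    and t2: "loops 10 body_code s1 t2 s2" "t2 \<le> T" "Q s1 s2"
    using children[OF t1(3)] unfolding reach_def by blast
  have ut: "untouched n j (length (fst nd')) s s2"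
    using t1(3) t2(3) untouched_trans[OF _ _ order_refl order_refl] unfolding P_def Q_def by blast
  have "state n j nd f bs' 2 s2"
    unfolding state_def
  proof (intro conjI allI impI)
    show "regs_ok n j 2 s2" "sentinels_ok n (heap s2)" using t2(3) unfolding Q_def by simp_all
    show "tables_ok n (heap s2)" by (rule tables_ok_untouched[OF st(2) ut])
    show "level_ok n (heap s2) j (snd nd) f" by (rule level_ok_untouched[OF st(3) ut Suc.prems(3)])
    have "slots_ok n (heap s2) j nd f (last f)"
      by (rule slots_ok_untouched[OF st(5) Suc.prems(3)]) (use ut in \<open>simp add: untouched_def nd'_def\<close>)
    then show "slots_ok n (heap s2) j nd f (if Suc j = n then 0 else last f)" using j by simp
    show "heap s2 (adr n (lv (Suc j + i)) 0) = bs' ! i" if "i < length bs'" for i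
      using t2(3) that unfolding Q_def bs' by (cases i) simp_all
  qed
  moreover have "visits n s s2 us"
    by (rule visits_out_eq[of n s1 s2]) (use t1(3) t2(3) in \<open>simp_all add: P_def Q_def\<close>)
  moreover have "(t1 + t2) + cost \<le> 2 * cost * length us"
  proof -
    \<comment> \<open>The node spends \<open>139 * (q + 1) * length fs\<close>, half of the credit
      received. With at least two children the other half is at least \<open>cost\<close>.\<close>
    have "2 \<le> length fs" using length_monotone_code_ge[of r b] r unfolding fs_def by simp
    then have "(139 * (q + 1)) * 2 \<le> (139 * (q + 1)) * length fs" by (rule mult_le_mono2)
    moreover have "cost * length fs = 2 * ((139 * (q + 1)) * length fs)" "cost = 139 * (q + 1) * 2"
      unfolding cost_def by simp_all
    moreover have "57 * (q + 1) * length fs + 82 * (q + 1) * length fs = 139 * (q + 1) * length fs"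
      by (simp add: algebra_simps)
    ultimately show ?thesis using t1(2) t2(2) T by linarith
  qed
  ultimately have "\<exists>T. T + cost \<le> 2 * cost * length us \<and>
    reach 10 body_code T (\<lambda>s'. state n j nd f bs' 2 s' \<and>
      untouched n j (length (fst (child j nd f))) s s' \<and> visits n s s' us) s"
    unfolding reach_def using loops_trans[OF t1(1) t2(1)] ut unfolding nd'_def by blast
  moreover have "length bs' = Suc h \<and> set bs' \<subseteq> {0, 1}"
  proof -
    have "zigzag_ok (Suc h) (Suc j) (dissection_of (Suc j) nd') (dissection_of (Suc j) nd') bs (zigzag (Suc h) (Suc j) nd' bs)"
      by (rule zigzag_is_ok[OF nd']) (use Suc.prems(6,7) in simp_all)
    then show ?thesis using Suc.prems(9) unfolding zigzag_ok_def nd'_def by simp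
  qed
  ultimately show ?case by blast
qed

end

section \<open>Preparation and the total running time\<close>

definition prepare_code :: com where
  "prepare_code =
     Do [Const 3 1, Sub 4 0 3, Const 14 32, Const 16 0, Const 17 0, Add 15 1 3] ;;
     While 15 (Do [Store 14 16, Add 14 14 3, Store 14 17, Add 14 14 3, Add 16 16 4, Sub 17 3 17, Sub 15 15 3]) ;;
     Do [Const 5 8, Add 5 5 16, Add 5 5 1, Add 5 5 1, Const 6 32, Add 7 6 5, Add 8 7 5, Const 9 0, Const 10 1,
         Add 11 7 2, Const 12 1, Sub 13 1 3]"

definition listing_code :: com where
  "listing_code = prepare_code ;; While 10 body_code"

lemma wf_listing_code: "wf_com listing_code"
  unfolding listing_code_def prepare_code_def body_code_def init_code_def step_code_def count_last_code_def
    copy_link_code_def descend_code_def write_struts_code_def scan_body_def scan_code_def change_code_def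
    move_code_def back_code_def fill_code_def copy_code_def ramp_code_def count_code_def struts_code_def
  by (simp add: num_regs_def)

context dissecting
begin

text \<open>Register \<open>16\<close> runs through the multiples of \<open>q\<close> by addition,
  and its final value \<open>q * (n + 1)\<close> enters the region size. The literal
  \<open>32\<close> in the program is \<open>num_regs\<close>. The start state is on level
  \<open>0\<close>, with an empty node whose code is constantly zero.\<close>

lemma wp_prepare:
  assumes "2 \<le> n"
  shows "wp prepare_code (9 * n + 28)
    (\<lambda>s. state n 0 ([], [0]) (replicate q 0) (replicate (n - 1) 0) 1 s \<and> out s = []) (start_store (q + 1) n)"
proof -
  define I where "I i s \<longleftrightarrow> reg s 1 = n \<and> reg s 2 = 0 \<and> reg s 3 = 1 \<and> reg s 4 = q \<and> reg s 14 = num_regs + 2 * i \<and>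
    reg s 15 = n + 1 - i \<and> reg s 16 = q * i \<and> reg s 17 = i mod 2 \<and> out s = [] \<and>
    (\<forall>t<i. heap s (num_regs + 2 * t) = q * t \<and> heap s (num_regs + 2 * t + 1) = t mod 2) \<and>
    (\<forall>y\<ge>num_regs + 2 * i. heap s y = 0)" for i and s :: store
  let ?c1 = "Do [Const 3 1, Sub 4 0 3, Const 14 32, Const 16 0, Const 17 0, Add 15 1 3]"
  let ?body = "Do [Store 14 16, Add 14 14 3, Store 14 17, Add 14 14 3, Add 16 16 4, Sub 17 3 17, Sub 15 15 3]"
  let ?c3 = "Do [Const 5 8, Add 5 5 16, Add 5 5 1, Add 5 5 1, Const 6 32, Add 7 6 5, Add 8 7 5, Const 9 0, Const 10 1,
         Add 11 7 2, Const 12 1, Sub 13 1 3]"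
  let ?Q = "\<lambda>s. state n 0 ([], [0]) (replicate q 0) (replicate (n - 1) 0) 1 s \<and> out s = []"
  have 1: "wp ?c1 6 (I 0) (start_store (q + 1) n)"
    by (rule wp_Do) (simp_all add: I_def start_store_def num_regs_def)
  have step: "reg s 15 \<noteq> 0 \<and> wp ?body 7 (I (Suc i)) s" if i: "i < n + 1" and s: "I i s" for i s
  proof
    have r: "reg s 1 = n" "reg s 2 = 0" "reg s 3 = 1" "reg s 4 = q" "reg s 14 = num_regs + 2 * i" "reg s 15 = n + 1 - i"
      "reg s 16 = q * i" "reg s 17 = i mod 2" "out s = []" using s unfolding I_def by simp_all
    have h: "\<And>t. t < i \<Longrightarrow> heap s (num_regs + 2 * t) = q * t" "\<And>t. t < i \<Longrightarrow> heap s (num_regs + 2 * t + 1) = t mod 2"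
      "\<And>y. num_regs + 2 * i \<le> y \<Longrightarrow> heap s y = 0" using s unfolding I_def by simp_all
    show "reg s 15 \<noteq> 0" using r(6) i by simp
    let ?s = "run_block [Store 14 16, Add 14 14 3, Store 14 17, Add 14 14 3, Add 16 16 4, Sub 17 3 17, Sub 15 15 3] s"
    have heap: "heap ?s = (heap s)(num_regs + 2 * i := q * i, num_regs + 2 * i + 1 := i mod 2)" by (simp add: r)
    have ev: "heap ?s (num_regs + 2 * t) = q * t" if "t < Suc i" for t
    proof -
      have "num_regs + 2 * t \<noteq> num_regs + 2 * i + 1" by presburger
      then show ?thesis unfolding heap using h(1)[of t] that by (cases "t = i") simp_all
    qed
    have od: "heap ?s (num_regs + 2 * t + 1) = t mod 2" if "t < Suc i" for t
    proof -
      have "num_regs + 2 * t + 1 \<noteq> num_regs + 2 * i" by presburger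
      then show ?thesis unfolding heap using h(2)[of t] that by (cases "t = i") simp_all
    qed
    have zero: "heap ?s y = 0" if "num_regs + 2 * Suc i \<le> y" for y
      unfolding heap using h(3)[of y] that by simp
    have regs: "reg ?s 1 = n" "reg ?s 2 = 0" "reg ?s 3 = 1" "reg ?s 4 = q" "reg ?s 14 = num_regs + 2 * Suc i"
      "reg ?s 15 = n + 1 - Suc i" "reg ?s 16 = q * Suc i" "out ?s = []" by (simp_all add: r r(1)[simplified])
    have "reg ?s 17 = 1 - i mod 2" by (simp add: r)
    also have "\<dots> = Suc i mod 2" by presburger
    finally have "I (Suc i) ?s" unfolding I_def using regs ev od zero by blast
    then show "wp ?body 7 (I (Suc i)) s" by (intro wp_Do) (simp_all add: r)
  qed
  have 2: "wp (While 15 ?body) (9 * (n + 1) + 1) (I (n + 1)) s" if "I 0 s" for s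
    by (rule wp_While_count[where m="n + 1" and B=7 and I=I, OF that step]) (simp_all add: I_def)
  have 3: "wp ?c3 12 ?Q s" if s: "I (n + 1) s" for s
  proof -
    have r: "reg s 1 = n" "reg s 2 = 0" "reg s 3 = 1" "reg s 4 = q" "reg s 16 = q * (n + 1)" "out s = []"
      using s unfolding I_def by simp_all
    let ?s = "run_block [Const 5 8, Add 5 5 16, Add 5 5 1, Add 5 5 1, Const 6 32, Add 7 6 5, Add 8 7 5, Const 9 0,
      Const 10 1, Add 11 7 2, Const 12 1, Sub 13 1 3] s"
    have heap: "heap ?s = heap s" "out ?s = []" by (simp_all add: r)
    have zero: "heap s (adr n x i) = 0" if "x \<noteq> 0" for x i
    proof -
      have "1 * stride n \<le> x * stride n" using that by (intro mult_le_mono1) simp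
      moreover have "2 * (n + 1) \<le> 1 * stride n" unfolding stride_def by simp
      ultimately have "num_regs + 2 * (n + 1) \<le> adr n x i" unfolding adr_def by linarith
      then show ?thesis using s unfolding I_def by simp
    qed
    have "regs_ok n 0 1 ?s"
      unfolding regs_ok_def adr_def stride_def lv_def top_vertex_def by (simp add: r r(1)[simplified] num_regs_def)
    moreover have "tables_ok n (heap s)"
      using s unfolding tables_ok_def I_def adr_def by (simp add: less_Suc_eq_le add.assoc)
    moreover have "level_ok n (heap s) 0 [0] (replicate q 0)"
      unfolding level_ok_def using zero lv_neq by (simp add: fan_size_def)
    moreover have "sentinels_ok n (heap s)" unfolding sentinels_ok_def using zero lv_neq by simp
    moreover have "slots_ok n (heap s) 0 ([], [0]) f lo" for f lo unfolding slots_ok_def by (simp add: fan_size_def)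
    moreover have "heap s (adr n (lv (Suc 0 + i)) 0) = replicate (n - 1) 0 ! i" if "i < length (replicate (n - 1) (0 :: nat))" for i
      using zero lv_neq that by simp
    ultimately have "?Q ?s" unfolding state_def heap by simp
    then show ?thesis by (intro wp_Do) simp_all
  qed
  show ?thesis
    unfolding prepare_code_def
  proof (rule wp_Seq'[OF 1])
    show "wp (While 15 ?body ;; ?c3) (9 * (n + 1) + 1 + 12) ?Q s" if "I 0 s" for s
      by (rule wp_Seq'[OF 2[OF that] 3]) simp_all
  qed simp
qed

text \<open>Level \<open>0\<close> stands for the degenerate polygon on \<open>0\<close> and
  \<open>1\<close> without cells; splitting its vertex \<open>1\<close> creates the first cell. So
  the root is produced by the ordinary descent.\<close>

lemma child_empty_node: "child 0 ([], [0]) (replicate q 0) = root"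
proof -
  have "last (replicate q (0 :: nat)) = 0" using q_pos by simp
  moreover have "count_above (replicate q 0) 0 = 0" unfolding count_above_def by simp
  moreover have "[0] @ [1..<1 + q] = [0..<q + 1]" by (simp add: upt_rec)
  ultimately show ?thesis
    unfolding child_def child_link_def root_def by (simp add: fan_size_def top_vertex_def)
qed

lemma lists_dissections:
  assumes n: "2 \<le> n"
  shows "\<exists>t bs. lists_within (compile 0 listing_code) (q + 1) n t bs \<and>
    map (stored_dissection n) bs = map (dissection_of n) (dissection_list n) \<and>
    t \<le> 565 * (q + 1) * length (dissection_list n)"
proof -
  let ?f = "replicate q 0" and ?nd = "([], [0]) :: node" and ?bs = "replicate (n - 1) 0 :: nat list"
  obtain us bs' where z: "zigzag (n - 1) 1 root ?bs = (us, bs')" by fastforce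
  have us: "dissection_list n = us" unfolding dissection_list_def z by simp
  have root: "1 \<le> fan_size (snd root)" unfolding root_def fan_size_def using q_pos by simp
  have len: "n \<le> length us" using length_zigzag[OF root_ok _ root, of "n - 1" ?bs] z n by simp
  have coded: "coded n 0 ?nd ?f" unfolding coded_def bounded_code_def fan_size_def using n by (auto simp: sorted_wrt_iff_nth_less)
  \<comment> \<open>The largest time that \<open>visit_subtree\<close> permits, so that one bound
    serves all start states.\<close>
  define T where "T = 2 * cost * length us - cost"
  have cost: "cost \<le> 2 * cost * length us" using len n by (cases "length us") simp_all
  have subtree: "reach 10 body_code T (\<lambda>s'. regs_ok n 0 2 s' \<and> visits n s s' us) s"
    if s: "state n 0 ?nd ?f ?bs 1 s" for s
  proof -
    obtain T' where T': "T' + cost \<le> 2 * cost * length us"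
      "reach 10 body_code T' (\<lambda>s'. state n 0 ?nd ?f bs' 2 s' \<and>
      untouched n 0 (length (fst (child 0 ?nd ?f))) s s' \<and> visits n s s' us) s"
      using visit_subtree[of n 0 "n - 1" ?nd ?f ?bs s us bs'] n coded root_ok s z unfolding child_empty_node by auto
    then have "T' \<le> T" unfolding T_def by simp
    then show ?thesis using T'(2) unfolding reach_def state_def by (meson le_trans)
  qed
  have stop: "reach 10 body_code (T + 8) (\<lambda>s'. reg s' 10 = 0 \<and> visits n s s' us) s"
    if s: "state n 0 ?nd ?f ?bs 1 s" for s
  proof (rule reach_trans[OF subtree[OF s]])
    fix s1 assume s1: "regs_ok n 0 2 s1 \<and> visits n s s1 us"
    then have "regs_ok n 0 2 s1" by simp
    then show "reach 10 body_code 8 (\<lambda>s'. reg s' 10 = 0 \<and> visits n s s' us) s1"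
    proof (rule reach_body)
      fix s' :: store assume "out s' = out s1"
      then show "wp (Do [Const 10 0]) 1 (\<lambda>s'. reg s' 10 = 0 \<and> visits n s s' us) s'"
        using s1 by (intro wp_Do) (simp_all add: visits_def)
    qed simp_all
  qed simp
  have "wp listing_code (9 * n + 28 + (T + 9)) (\<lambda>s. map (stored_dissection n) (out s) = map (dissection_of n) us)
      (start_store (q + 1) n)"
    unfolding listing_code_def
  proof (rule wp_Seq'[OF wp_prepare[OF n]])
    fix s assume s: "state n 0 ?nd ?f ?bs 1 s \<and> out s = []"
    then have "wp (While 10 body_code) (T + 9) (\<lambda>s'. reg s' 10 = 0 \<and> visits n s s' us) s"
      by (intro wp_While_reach[OF stop]) simp_all
    then show "wp (While 10 body_code) (T + 9) (\<lambda>s. map (stored_dissection n) (out s) = map (dissection_of n) us) s"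
      by (rule wp_mono) (use s in \<open>auto simp: visits_def\<close>)
  qed simp
  then obtain t s where t: "runs listing_code (start_store (q + 1) n) t s" "t \<le> 9 * n + 28 + (T + 9)"
    "map (stored_dissection n) (out s) = map (dissection_of n) us"
    unfolding wp_def by blast
  \<comment> \<open>The constant overhead \<open>28 + 9\<close> is covered by the credit
    \<open>cost\<close> that is left at the root.\<close>
  have "37 \<le> cost" unfolding cost_def by simp
  then have "t \<le> 9 * n + 2 * cost * length us" using t(2) cost unfolding T_def by linarith
  also have "\<dots> \<le> 9 * length us + 2 * cost * length us" using len by simp
  \<comment> \<open>\<open>565 = 9 + 2 * 278\<close>, where \<open>9\<close> per leaf stems from the
    preparation.\<close>
  also have "\<dots> \<le> 565 * (q + 1) * length us" unfolding cost_def by (simp add: algebra_simps)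
  finally have "t \<le> 565 * (q + 1) * length (dissection_list n)" unfolding us .
  then show ?thesis using lists_within_compile[OF t(1) wf_listing_code] t(3) unfolding us by blast
qed

end

theorem theorem8:
  shows "\<exists>(P :: instr list) (C :: real). \<forall>(k :: nat) (n :: nat).
    2 \<le> k \<and> max 2 (5 - int k) \<le> int n \<longrightarrow>
    (let N = (k - 1) * n + 2; G = flip_graph N (k + 1) in
      \<exists>t bs. lists_within P k n t bs \<and>
             hamilton_path (map (stored_dissection n) bs) (with_proj G) \<and>
             real t \<le> C * real k * real (card (pverts G)))"
proof (intro exI allI impI)
  fix k n :: nat assume kn: "2 \<le> k \<and> max 2 (5 - int k) \<le> int n"
  define q where "q = k - 1"
  interpret dissecting q by unfold_locales (use kn in \<open>auto simp: q_def\<close>)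
  have n: "2 \<le> n" using kn by simp
  have k: "k = q + 1" using kn unfolding q_def by simp
  obtain t bs where t: "lists_within (compile 0 listing_code) (q + 1) n t bs"
    "map (stored_dissection n) bs = map (dissection_of n) (dissection_list n)"
    "t \<le> 565 * (q + 1) * length (dissection_list n)"
    using lists_dissections[OF n] by blast
  have "1 \<le> n" using n by simp
  note path = hamilton_path_dissection_list[OF this]
  have "real t \<le> real (565 * (q + 1) * length (dissection_list n))" using t(3) of_nat_le_iff by blast
  also have "\<dots> = 565 * real (q + 1) * real (card (pverts (flip_graph (q * n + 2) (q + 2))))"
    unfolding path(2) by simp
  \<comment> \<open>This step fixes both witnesses: a program that depends on neither
    \<open>k\<close> nor \<open>n\<close>, and the constant \<open>565\<close>.\<close>
  finally show "let N = (k - 1) * n + 2; G = flip_graph N (k + 1) in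
      \<exists>t bs. lists_within (compile 0 listing_code) k n t bs \<and>
             hamilton_path (map (stored_dissection n) bs) (with_proj G) \<and>
             real t \<le> 565 * real k * real (card (pverts G))"
    using t(1) path(1) unfolding Let_def k t(2)[symmetric] by (intro exI[of _ t] exI[of _ bs]) simp
qed

end
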